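(* Let $1\le m<n$ be integers and let $\Omega\subseteq\mathbb{R}^n=\mathbb{R}^m\times\mathbb{R}^{n-m}$ be an open set, with coordinates $X=(x,y)$. Let $f$, $\alpha$, $p$ satisfy the structural assumptions listed in the context. Assume that $u:\Omega\to\mathbb{R}$ satisfies $u\in C^1(\Omega)\cap C^2(\Omega\cap\{\nabla u\neq 0\})\cap L^\infty(\Omega)$ and $\nabla u\in L^\infty(\Omega)\cap W^{1,2}_{\rm loc}(\Omega)$, and that $u$ is a stable weak solution in $\Omega$ of $$-{\rm div}\big(\alpha(x)|\nabla u(X)|^{p(x)-2}\nabla u(X)\big)=f(x,u(X)).$$ Let $$\mathcal{R}:=\{(x,y)\in\Omega : \nabla_y u(x,y)\neq 0\},$$ and, on $\mathcal{R}$, $$\mathcal{S}:=-\big|\nabla_x|\nabla_y u|\big|^2+\sum_{i=1}^m\sum_{j=1}^{n-m}(u_{x_iy_j})^2,\qquad \mathcal{T}:=-\big(\nabla u\cdot\nabla|\nabla_y u|\big)^2+\sum_{j=1}^{n-m}(\nabla u\cdot\nabla u_{y_j})^2 .$$ Then, for every $\phi\in C^\infty_0(\Omega)$, $$\int_{\mathcal{R}}\alpha(x)|\nabla u|^{p(x)-2}\left(\mathcal{S}+\mathcal{K}^2|\nabla_y u|^2+\big|\nabla_L|\nabla_y u|\big|^2+\frac{p(x)-2}{|\nabla u|^2}\,\mathcal{T}\right)\phi^2\,dX\;\le\;\int_\Omega|\nabla_y u|^2\,\langle\mathcal{B}(x,\nabla u)\nabla\phi,\nabla\phi\rangle\,dX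 .$$ Moreover, $\mathcal{S}\ge 0$ and $\mathcal{T}\ge 0$ on $\mathcal{R}$, and, for $X\in\mathcal{R}$, one has $\mathcal{S}(X)=0$ if and only if $\nabla_y u_{x_i}(X)$ is parallel to $\nabla_y u(X)$ for every $i=1,\dots,m$.
   Context: Structural assumptions: $f=f(x,u)\in L^\infty(\mathbb{R}^m\times\mathbb{R})$ is differentiable in $u$ with $f_u\in L^\infty(\mathbb{R}^m\times\mathbb{R})$; $\alpha\in L^\infty(\mathbb{R}^m)$ with $\inf_{\mathbb{R}^m}\alpha>0$; $p\in L^\infty(\mathbb{R}^m)$ with $p(x)\ge 2$ for every $x\in\mathbb{R}^m$. Weak solution: $u$ is a weak solution of the equation in $\Omega$ if $\int_\Omega\alpha(x)|\nabla u|^{p(x)-2}\nabla u\cdot\nabla\xi\,dX=\int_\Omega f(x,u)\,\xi\,dX$ for every $\xi\in C^\infty_0(\Omega)$. Matrix $\mathcal{B}$: for $x\in\mathbb{R}^m$, $\eta\in\mathbb{R}^n\setminus\{0\}$, $1\le i,j\le n$, $$\mathcal{B}(x,\eta)_{ij}:=\alpha(x)|\eta|^{p(x)-2}\Big(\delta_{ij}+(p(x)-2)\frac{\eta_i\eta_j}{|\eta|^2}\Big),$$ and $\mathcal{B}(x,0)_{ij}:=\alpha(x)\delta_{ij}$ if $p(x)=2$, $\mathcal{B}(x,0)_{ij}:=0$ if $p(x)>2$. $\langle\cdot,\cdot\rangle$ is the standard scalar product of $\mathbb{R}^n$. Stability: $u$ is stable if $\int_\Omega\big(\langle\mathcal{B}(x,\nabla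 u)\nabla\xi,\nabla\xi\rangle-f_u(x,u)\xi^2\big)\,dX\ge 0$ for every $\xi\in C^\infty_0(\Omega)$. Level-set geometry: for fixed $x\in\mathbb{R}^m$ and $c\in\mathbb{R}$, let $S:=\{y : u(x,y)=c\}$ (level set of $u$ on the slice determined by $x$) and $L:=\{y\in S : \nabla_y u(x,y)\neq 0\}$; $L$ is an $(n-m-1)$-dimensional hypersurface in $\mathbb{R}^{n-m}$. For $y_o\in L$ and $G$ smooth near $y_o$, the tangential gradient along $L$ is $$\nabla_L G(y_o):=\nabla_yG(y_o)-\Big(\nabla_yG(y_o)\cdot\frac{\nabla_yu(x,y_o)}{|\nabla_yu(x,y_o)|}\Big)\frac{\nabla_yu(x,y_o)}{|\nabla_yu(x,y_o)|}.$$ For $y\in L$ let $\kappa_1(x,y),\dots,\kappa_{n-m-1}(x,y)$ be the principal curvatures of $L$ at $y$ and $\mathcal{K}(x,y):=\big(\sum_{j=1}^{n-m-1}\kappa_j(x,y)^2\big)^{1/2}$. At a point $(x,y)\in\mathcal{R}$, the quantities $\mathcal{K}$ and $\nabla_L|\nabla_yu|$ are computed with $c=u(x,y)$. Here $\nabla_x,\nabla_y$ are the gradients in $x\in\mathbb{R}^m$, $y\in\mathbb{R}^{n-m}$, and $\nabla$ the full gradient in $\mathbb{R}^n$. *)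

theory Defs
  imports "HOL-Analysis.Analysis"
begin

section \<open>Gradients and function spaces\<close>

text \<open>
  The space \<open>\<real>\<^sup>n = \<real>\<^sup>m \<times> \<real>\<^sup>n\<^sup>-\<^sup>m\<close> is the product type \<^typ>\<open>(real ^ 'm) \<times> (real ^ 'k)\<close>, where
  \<open>m = CARD('m)\<close> and \<open>n - m = CARD('k)\<close>; its norm and inner product are the Euclidean ones.
  A function on \<open>\<Omega>\<close> is a total function of which only the values on \<open>\<Omega>\<close> matter.
\<close>

text \<open>Meaningful only where \<open>g\<close> is (Frechet) differentiable.\<close>

definition grad :: "('a::euclidean_space \<Rightarrow> real) \<Rightarrow> 'a \<Rightarrow> 'a" where
  "grad g X = (THE D. GDERIV g X :> D)"

definition grad_x :: "('a::euclidean_space \<times> 'b::euclidean_space \<Rightarrow> real) \<Rightarrow> 'a \<times> 'b \<Rightarrow> 'a" where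
  "grad_x g X = grad (\<lambda>x. g (x, snd X)) (fst X)"

definition grad_y :: "('a::euclidean_space \<times> 'b::euclidean_space \<Rightarrow> real) \<Rightarrow> 'a \<times> 'b \<Rightarrow> 'b" where
  "grad_y g X = grad (\<lambda>y. g (fst X, y)) (snd X)"

text \<open>The class \<open>C\<^sup>k(U)\<close>, for \<open>U\<close> open.\<close>

primrec Ck_on :: "nat \<Rightarrow> 'a::euclidean_space set \<Rightarrow> ('a \<Rightarrow> real) \<Rightarrow> bool" where
  "Ck_on 0 U g \<longleftrightarrow> continuous_on U g"
| "Ck_on (Suc k) U g \<longleftrightarrow>
     (\<forall>X\<in>U. g differentiable (at X)) \<and> (\<forall>b\<in>Basis. Ck_on k U (\<lambda>X. grad g X \<bullet> b))"

text \<open>\<open>C\<^sub>0\<^sup>\<infinity>(\<Omega>)\<close>, its members being extended by zero to the whole space.\<close>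

definition test_fun :: "'a::euclidean_space set \<Rightarrow> ('a \<Rightarrow> real) \<Rightarrow> bool" where
  "test_fun \<Omega> \<xi> \<longleftrightarrow> (\<forall>k. Ck_on k UNIV \<xi>) \<and>
     compact (closure {X. \<xi> X \<noteq> 0}) \<and> closure {X. \<xi> X \<noteq> 0} \<subseteq> \<Omega>"

definition Linf_on :: "'a::euclidean_space set \<Rightarrow> ('a \<Rightarrow> 'b::euclidean_space) \<Rightarrow> bool" where
  "Linf_on U g \<longleftrightarrow> g \<in> borel_measurable (lebesgue_on U) \<and>
     (\<exists>C. AE X in lebesgue_on U. norm (g X) \<le> C)"

definition L2_loc_on :: "'a::euclidean_space set \<Rightarrow> ('a \<Rightarrow> real) \<Rightarrow> bool" where
  "L2_loc_on \<Omega> g \<longleftrightarrow> g \<in> borel_measurable (lebesgue_on \<Omega>) \<and>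
     (\<forall>K. compact K \<and> K \<subseteq> \<Omega> \<longrightarrow> integrable (lebesgue_on K) (\<lambda>X. (g X)\<^sup>2))"

text \<open>\<open>v\<close> is the weak derivative of \<open>g\<close> in the direction \<open>b\<close>.\<close>

definition weak_deriv_on ::
  "'a::euclidean_space set \<Rightarrow> ('a \<Rightarrow> real) \<Rightarrow> 'a \<Rightarrow> ('a \<Rightarrow> real) \<Rightarrow> bool" where
  "weak_deriv_on \<Omega> g b v \<longleftrightarrow> (\<forall>\<xi>. test_fun \<Omega> \<xi> \<longrightarrow>
     (LINT X|lebesgue_on \<Omega>. g X * (grad \<xi> X \<bullet> b)) = - (LINT X|lebesgue_on \<Omega>. v X * \<xi> X))"

definition W12_loc_on :: "'a::euclidean_space set \<Rightarrow> ('a \<Rightarrow> 'b::euclidean_space) \<Rightarrow> bool" where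
  "W12_loc_on \<Omega> G \<longleftrightarrow> (\<forall>e\<in>Basis. L2_loc_on \<Omega> (\<lambda>X. G X \<bullet> e) \<and>
     (\<forall>b\<in>Basis. \<exists>v. L2_loc_on \<Omega> v \<and> weak_deriv_on \<Omega> (\<lambda>X. G X \<bullet> e) b v))"


section \<open>Weak solutions and stability\<close>

text \<open>
  Note that \<^term>\<open>0 powr 0 = (0::real)\<close> in HOL; this is harmless in the next definition, where the
  power is multiplied by \<open>\<nabla>u\<close>.
\<close>

definition weak_solution ::
  "((real ^ 'm) \<times> (real ^ 'k)) set \<Rightarrow> (real ^ 'm \<Rightarrow> real) \<Rightarrow> (real ^ 'm \<Rightarrow> real) \<Rightarrow>
   (real ^ 'm \<Rightarrow> real \<Rightarrow> real) \<Rightarrow> ((real ^ 'm) \<times> (real ^ 'k) \<Rightarrow> real) \<Rightarrow> bool" where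
  "weak_solution \<Omega> \<alpha> p f u \<longleftrightarrow> (\<forall>\<xi>. test_fun \<Omega> \<xi> \<longrightarrow>
     (LINT X|lebesgue_on \<Omega>.
        \<alpha> (fst X) * norm (grad u X) powr (p (fst X) - 2) * (grad u X \<bullet> grad \<xi> X)) =
     (LINT X|lebesgue_on \<Omega>. f (fst X) (u X) * \<xi> X))"

text \<open>The matrix \<open>\<B>(x,\<eta>)\<close>; rows and columns are indexed by the standard basis vectors.\<close>

definition \<B> ::
  "(real ^ 'm \<Rightarrow> real) \<Rightarrow> (real ^ 'm \<Rightarrow> real) \<Rightarrow> real ^ 'm \<Rightarrow> 'a::euclidean_space \<Rightarrow> 'a \<Rightarrow> 'a \<Rightarrow> real"
  where
  "\<B> \<alpha> p x \<eta> i j =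
     (if \<eta> \<noteq> 0 then
        \<alpha> x * norm \<eta> powr (p x - 2) *
          ((if i = j then 1 else 0) + (p x - 2) * ((\<eta> \<bullet> i) * (\<eta> \<bullet> j) / (norm \<eta>)\<^sup>2))
      else if p x = 2 then \<alpha> x * (if i = j then 1 else 0)
      else 0)"

text \<open>\<open>\<langle>Mv, w\<rangle>\<close> for a matrix \<open>M\<close>.\<close>

definition matrix_form :: "('a::euclidean_space \<Rightarrow> 'a \<Rightarrow> real) \<Rightarrow> 'a \<Rightarrow> 'a \<Rightarrow> real" where
  "matrix_form M v w = (\<Sum>i\<in>Basis. (\<Sum>j\<in>Basis. M i j * (v \<bullet> j)) * (w \<bullet> i))"

definition stable_solution ::
  "((real ^ 'm) \<times> (real ^ 'k)) set \<Rightarrow> (real ^ 'm \<Rightarrow> real) \<Rightarrow> (real ^ 'm \<Rightarrow> real) \<Rightarrow>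
   (real ^ 'm \<Rightarrow> real \<Rightarrow> real) \<Rightarrow> ((real ^ 'm) \<times> (real ^ 'k) \<Rightarrow> real) \<Rightarrow> bool" where
  "stable_solution \<Omega> \<alpha> p f u \<longleftrightarrow> (\<forall>\<xi>. test_fun \<Omega> \<xi> \<longrightarrow>
     0 \<le> (LINT X|lebesgue_on \<Omega>.
        matrix_form (\<B> \<alpha> p (fst X) (grad u X)) (grad \<xi> X) (grad \<xi> X)
        - deriv (f (fst X)) (u X) * (\<xi> X)\<^sup>2))"


section \<open>Principal curvatures of a hypersurface\<close>

text \<open>
  Velocities of curves in \<open>L\<close>. Only the curve near \<open>0\<close> matters, so that it may be assumed to be
  defined on the whole line.
\<close>

definition tangent_space :: "'b::euclidean_space set \<Rightarrow> 'b \<Rightarrow> 'b set" where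
  "tangent_space L y =
     {v. \<exists>\<gamma>. \<gamma> 0 = y \<and> (\<forall>t. \<gamma> t \<in> L) \<and> (\<gamma> has_vector_derivative v) (at (0::real))}"

text \<open>
  Let \<open>\<nu>\<close> be a unit normal field along the hypersurface \<open>L\<close>. The shape operator at \<open>y\<close> maps a tangent
  vector \<open>v\<close> to \<open>- D\<^sub>v \<nu>\<close>; this depends only on the values of \<open>\<nu>\<close> on \<open>L\<close>, since a derivative of \<open>\<nu>\<close>
  within \<open>L\<close> is determined on tangent vectors. The next definition is its eigenspace for \<open>\<kappa>\<close>.
\<close>

definition principal_space ::
  "'b::euclidean_space set \<Rightarrow> ('b \<Rightarrow> 'b) \<Rightarrow> 'b \<Rightarrow> real \<Rightarrow> 'b set" where
  "principal_space L \<nu> y \<kappa> =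
     {v \<in> tangent_space L y. \<exists>N. (\<nu> has_derivative N) (at y within L) \<and> - N v = \<kappa> *\<^sub>R v}"

definition principal_curvatures ::
  "'b::euclidean_space set \<Rightarrow> ('b \<Rightarrow> 'b) \<Rightarrow> 'b \<Rightarrow> real set" where
  "principal_curvatures L \<nu> y = {\<kappa>. \<exists>v \<in> principal_space L \<nu> y \<kappa>. v \<noteq> 0}"

text \<open>
  \<open>(\<Sum>\<^sub>j \<kappa>\<^sub>j\<^sup>2)\<^sup>1\<^sup>/\<^sup>2\<close>, each principal curvature being repeated according to its multiplicity. The shape
  operator is self-adjoint, so the multiplicity is the dimension of the eigenspace. Replacing \<open>\<nu>\<close> by
  \<open>-\<nu>\<close> changes the signs of all \<open>\<kappa>\<^sub>j\<close> and does not affect the value.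
\<close>

definition curvature_norm :: "'b::euclidean_space set \<Rightarrow> ('b \<Rightarrow> 'b) \<Rightarrow> 'b \<Rightarrow> real" where
  "curvature_norm L \<nu> y =
     sqrt (\<Sum>\<kappa>\<in>principal_curvatures L \<nu> y. real (dim (principal_space L \<nu> y \<kappa>)) * \<kappa>\<^sup>2)"


section \<open>Geometry of the level sets on a slice\<close>

definition level_set ::
  "('a::euclidean_space \<times> 'b::euclidean_space) set \<Rightarrow> ('a \<times> 'b \<Rightarrow> real) \<Rightarrow> 'a \<Rightarrow> real \<Rightarrow> 'b set" where
  "level_set \<Omega> u x c = {y. (x, y) \<in> \<Omega> \<and> u (x, y) = c}"

definition regular_level_set ::
  "('a::euclidean_space \<times> 'b::euclidean_space) set \<Rightarrow> ('a \<times> 'b \<Rightarrow> real) \<Rightarrow> 'a \<Rightarrow> real \<Rightarrow> 'b set" where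
  "regular_level_set \<Omega> u x c = {y \<in> level_set \<Omega> u x c. grad_y u (x, y) \<noteq> 0}"

definition level_normal ::
  "('a::euclidean_space \<times> 'b::euclidean_space \<Rightarrow> real) \<Rightarrow> 'a \<times> 'b \<Rightarrow> 'b" where
  "level_normal u X = grad_y u X /\<^sub>R norm (grad_y u X)"

text \<open>\<open>\<nabla>\<^sub>L G\<close>, where \<open>L\<close> is the regular part of the level set of \<open>u\<close> through the given point.\<close>

definition tangential_grad ::
  "('a::euclidean_space \<times> 'b::euclidean_space \<Rightarrow> real) \<Rightarrow> ('a \<times> 'b \<Rightarrow> real) \<Rightarrow> 'a \<times> 'b \<Rightarrow> 'b" where
  "tangential_grad u G X =
     grad_y G X - (grad_y G X \<bullet> level_normal u X) *\<^sub>R level_normal u X"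

definition \<K> ::
  "('a::euclidean_space \<times> 'b::euclidean_space) set \<Rightarrow> ('a \<times> 'b \<Rightarrow> real) \<Rightarrow> 'a \<times> 'b \<Rightarrow> real" where
  "\<K> \<Omega> u X = curvature_norm (regular_level_set \<Omega> u (fst X) (u X))
                (\<lambda>y. level_normal u (fst X, y)) (snd X)"

definition \<R> ::
  "('a::euclidean_space \<times> 'b::euclidean_space) set \<Rightarrow> ('a \<times> 'b \<Rightarrow> real) \<Rightarrow> ('a \<times> 'b) set" where
  "\<R> \<Omega> u = {X \<in> \<Omega>. grad_y u X \<noteq> 0}"

definition \<S> :: "((real ^ 'm) \<times> (real ^ 'k) \<Rightarrow> real) \<Rightarrow> (real ^ 'm) \<times> (real ^ 'k) \<Rightarrow> real" where
  "\<S> u X = - (norm (grad_x (\<lambda>Z. norm (grad_y u Z)) X))\<^sup>2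
     + (\<Sum>i\<in>UNIV. \<Sum>j\<in>UNIV. (grad_y (\<lambda>Z. grad_x u Z $ i) X $ j)\<^sup>2)"

definition \<T> :: "((real ^ 'm) \<times> (real ^ 'k) \<Rightarrow> real) \<Rightarrow> (real ^ 'm) \<times> (real ^ 'k) \<Rightarrow> real" where
  "\<T> u X = - (grad u X \<bullet> grad (\<lambda>Z. norm (grad_y u Z)) X)\<^sup>2
     + (\<Sum>j\<in>UNIV. (grad u X \<bullet> grad (\<lambda>Z. grad_y u Z $ j) X)\<^sup>2)"

end

theory Submission
  imports Defs "HOL-Computational_Algebra.Polynomial"
begin

text \<open>
  On the open set \<open>\<R>\<close> the solution is \<open>C\<^sup>2\<close>, and since \<open>\<alpha>\<close> and \<open>p\<close> depend on \<open>x\<close> only, the equation may be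
  differentiated in the direction \<open>y\<^sub>j\<close>: \<open>\<integral>\<langle>\<B>\<nabla>u\<^sub>j, \<nabla>\<eta>\<rangle> = \<integral>f\<^sub>u u\<^sub>j \<eta>\<close> for test functions supported in \<open>\<R>\<close>, where
  \<open>u\<^sub>j\<close> is the derivative of \<open>u\<close> in \<open>y\<^sub>j\<close>. Put \<open>w = |\<nabla>\<^sub>y u|\<close> and let \<open>\<rho>\<close> be a cutoff vanishing near \<open>0\<close>.
  Testing with \<open>\<eta> = u\<^sub>j \<rho>(w)\<^sup>2 \<phi>\<^sup>2\<close>, summing over \<open>j\<close>, and comparing with the stability inequality for
  \<open>\<xi> = w \<rho>(w) \<phi>\<close>, the terms with \<open>f\<^sub>u\<close> cancel. What remains is the claim for
  \<open>\<Sum>\<^sub>j \<langle>\<B>\<nabla>u\<^sub>j, \<nabla>u\<^sub>j\<rangle> - \<langle>\<B>\<nabla>w, \<nabla>w\<rangle>\<close>, up to errors with \<open>w \<rho>'(w)\<close> that vanish as \<open>\<rho> \<rightarrow> 1\<close>, and this difference is the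
  geometric integrand by the Sternberg--Zumbrun identity.
\<close>

text \<open>Three obstacles shape the proof. The coefficients are merely bounded and measurable in
  x, and statements about \<open>f\<close> that hold for almost every pair (x, s) could all fail
  along the graph s = u(x, y). Hence the Borel representatives that agree with \<open>f\<close> and
  its derivative for almost every x and every s, and the restriction to lines in a direction y_j, on
  which x is fixed. Next, on \<open>\<R>\<close> the function u is C^2 and no better, so w and the
  u_j are C^1: the test functions built from them are not smooth and have to be reached by
  mollification. Last, continuity bounds the second derivatives on compact subsets of
  \<open>\<R>\<close>, while the inequality concerns all of \<open>\<R>\<close>. The cutoff in w
  keeps every support compact in \<open>\<R>\<close>, and integrability up to the boundary comes
  from Fatou's lemma and an energy bound that does not depend on the cutoff.\<close>

section \<open>Gradients and the calculus of the classes \<open>Ck_on\<close>\<close>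

lemma grad_eqI: "GDERIV g X :> D \<Longrightarrow> grad g X = D"
proof -
  assume D: "GDERIV g X :> D"
  have "D' = D" if "GDERIV g X :> D'" for D'
  proof -
    have "(\<lambda>h. h \<bullet> D') = (\<lambda>h. h \<bullet> D)"
      using has_derivative_unique[OF that[unfolded gderiv_def] D[unfolded gderiv_def]] .
    then have "\<forall>h. h \<bullet> D' = h \<bullet> D" by meson
    then show ?thesis using vector_eq_ldot[of D' D] by simp
  qed
  then show ?thesis unfolding grad_def using D by blast
qed

lemma GDERIV_grad:
  assumes "g differentiable (at X)" shows "GDERIV g X :> grad g X"
proof -
  obtain f' where f': "(g has_derivative f') (at X)" using assms by (auto simp: differentiable_def)
  then have l: "linear f'" using has_derivative_linear by blast
  \<comment> \<open>A linear functional on a Euclidean space is represented by its adjoint applied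
    to 1.\<close>
  have "f' = (\<lambda>h. h \<bullet> adjoint f' 1)" using adjoint_works[OF l, of _ 1] by auto
  then have "GDERIV g X :> adjoint f' 1" unfolding gderiv_def using f' by simp
  then show ?thesis using grad_eqI by metis
qed

lemma has_derivative_grad:
  "g differentiable (at X) \<Longrightarrow> (g has_derivative (\<lambda>h. h \<bullet> grad g X)) (at X)"
  using GDERIV_grad unfolding gderiv_def by blast

lemma GDERIV_imp_differentiable: "GDERIV g X :> D \<Longrightarrow> g differentiable (at X)"
  unfolding gderiv_def differentiable_def by blast

lemma GDERIV_cong_open:
  assumes "GDERIV g X :> D" "open U" "X \<in> U" "\<And>Z. Z \<in> U \<Longrightarrow> g Z = h Z"
  shows "GDERIV h X :> D"
  using assms has_derivative_transform_within_open unfolding gderiv_def by blast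

text \<open>The two definite descriptions characterise the same vectors, so the values agree even
  where neither function is differentiable.\<close>

lemma grad_cong_open:
  assumes "open U" "X \<in> U" "\<And>Z. Z \<in> U \<Longrightarrow> g Z = h Z"
  shows "grad g X = grad h X"
proof -
  have "GDERIV g X :> D \<longleftrightarrow> GDERIV h X :> D" for D
    using GDERIV_cong_open[of g X D U h] GDERIV_cong_open[of h X D U g] assms by auto
  then show ?thesis unfolding grad_def by presburger
qed

lemma grad_x_eq:
  assumes "g differentiable (at X)" shows "grad_x g X = fst (grad g X)"
proof -
  have "((\<lambda>x. g (x, snd X)) has_derivative (\<lambda>h. (h, 0) \<bullet> grad g X)) (at (fst X))"
    by (rule has_derivative_compose[where f="\<lambda>x. (x, snd X)" and g=g])
      (auto intro!: derivative_eq_intros has_derivative_grad[OF assms])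
  then have "GDERIV (\<lambda>x. g (x, snd X)) (fst X) :> fst (grad g X)"
    unfolding gderiv_def by (simp add: inner_prod_def)
  then show ?thesis unfolding grad_x_def by (rule grad_eqI)
qed

lemma grad_y_eq:
  assumes "g differentiable (at X)" shows "grad_y g X = snd (grad g X)"
proof -
  have "((\<lambda>y. g (fst X, y)) has_derivative (\<lambda>h. (0, h) \<bullet> grad g X)) (at (snd X))"
    by (rule has_derivative_compose[where f="\<lambda>y. (fst X, y)" and g=g])
      (auto intro!: derivative_eq_intros has_derivative_grad[OF assms])
  then have "GDERIV (\<lambda>y. g (fst X, y)) (snd X) :> snd (grad g X)"
    unfolding gderiv_def by (simp add: inner_prod_def)
  then show ?thesis unfolding grad_y_def by (rule grad_eqI)
qed

lemma Ck_on_mono: "Ck_on (Suc k) U g \<Longrightarrow> Ck_on k U g"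
proof (induction k arbitrary: g)
  case 0
  then show ?case
    by (auto intro!: continuous_at_imp_continuous_on differentiable_imp_continuous_within)
next
  case (Suc k)
  then show ?case by (metis Ck_on.simps(2))
qed

lemma Ck_on_cong:
  assumes "open U" "\<And>X. X \<in> U \<Longrightarrow> g X = h X" "Ck_on k U g" shows "Ck_on k U h"
  using assms(2,3)
proof (induction k arbitrary: g h)
  case 0
  then show ?case by (simp cong: continuous_on_cong)
next
  case (Suc k)
  have "grad g X = grad h X" if "X \<in> U" for X
    by (rule grad_cong_open[OF assms(1) that Suc.prems(1)])
  moreover have "h differentiable at X" if "X \<in> U" for X
  proof (rule GDERIV_imp_differentiable, rule GDERIV_cong_open[OF GDERIV_grad assms(1) that])
    show "g differentiable at X" using Suc.prems(2) that by simp
  qed (use Suc.prems in auto)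
  moreover have "Ck_on k U (\<lambda>X. grad h X \<bullet> b)" if "b \<in> Basis" for b
    by (rule Suc.IH[of "\<lambda>X. grad g X \<bullet> b"]) (use Suc.prems calculation(1) that in auto)
  ultimately show ?case by simp
qed

lemma Ck_on_const: "Ck_on k U (\<lambda>X. c)"
proof (induction k arbitrary: c)
  case (Suc k)
  have "grad (\<lambda>X. c) X = 0" for X :: 'a by (rule grad_eqI) (rule GDERIV_const)
  then show ?case using Suc by simp
qed simp

lemma Ck_on_inner: "Ck_on k U (\<lambda>X. X \<bullet> b)"
proof (cases k)
  case (Suc j)
  have "GDERIV (\<lambda>X. X \<bullet> b) X :> b" for X :: 'a
    unfolding gderiv_def by (auto intro!: derivative_eq_intros)
  then have "grad (\<lambda>X. X \<bullet> b) X = b" "(\<lambda>X. X \<bullet> b) differentiable (at X)" for X :: 'a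
    using grad_eqI GDERIV_imp_differentiable by blast+
  then show ?thesis using Suc Ck_on_const[of j U] by simp
qed (auto intro!: continuous_intros)

lemma Ck_on_add:
  assumes "open U" shows "Ck_on k U g \<Longrightarrow> Ck_on k U h \<Longrightarrow> Ck_on k U (\<lambda>X. g X + h X)"
proof (induction k arbitrary: g h)
  case 0
  then show ?case by (auto intro!: continuous_intros)
next
  case (Suc k)
  have *: "grad g X \<bullet> b + grad h X \<bullet> b = grad (\<lambda>X. g X + h X) X \<bullet> b" if "X \<in> U" for X b
    using grad_eqI[OF GDERIV_add[OF GDERIV_grad GDERIV_grad], of g X h] Suc.prems that
    by (simp add: inner_add_left)
  show ?case
    using Suc.prems
    by (auto intro!: differentiable_add Ck_on_cong[OF assms *] Suc.IH)
qed

lemma Ck_on_mult: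
  assumes "open U" shows "Ck_on k U g \<Longrightarrow> Ck_on k U h \<Longrightarrow> Ck_on k U (\<lambda>X. g X * h X)"
proof (induction k arbitrary: g h)
  case 0
  then show ?case by (auto intro!: continuous_intros)
next
  case (Suc k)
  have *: "g X * (grad h X \<bullet> b) + h X * (grad g X \<bullet> b) = grad (\<lambda>X. g X * h X) X \<bullet> b"
    if "X \<in> U" for X b
    using grad_eqI[OF GDERIV_mult[OF GDERIV_grad GDERIV_grad], of g X h] Suc.prems that
    by (simp add: inner_add_left)
  have "Ck_on k U g" "Ck_on k U h" using Suc.prems Ck_on_mono by blast+
  then show ?case
    using Suc.prems
    by (auto intro!: differentiable_mult Ck_on_cong[OF assms *] Ck_on_add[OF assms] Suc.IH)
qed

section \<open>The Hessian\<close>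

text \<open>The derivative of \<open>grad u\<close> at \<open>X\<close> as a linear map: the
  component of \<open>hess u X v\<close> along b is the derivative of the b-th partial derivative in
  direction v. This form is available before symmetry is known; self-adjointness is a separate
  fact.\<close>

definition hess :: "('a::euclidean_space \<Rightarrow> real) \<Rightarrow> 'a \<Rightarrow> 'a \<Rightarrow> 'a" where
  "hess u X v = (\<Sum>b\<in>Basis. (v \<bullet> grad (\<lambda>Z. grad u Z \<bullet> b) X) *\<^sub>R b)"

lemma Ck_on_1_iff:
  "Ck_on 1 U g \<longleftrightarrow> (\<forall>X\<in>U. g differentiable (at X)) \<and> continuous_on U (grad g)"
proof -
  have "continuous_on U (grad g) \<longleftrightarrow> (\<forall>b\<in>Basis. continuous_on U (\<lambda>X. grad g X \<bullet> b))"
    by (subst continuous_on_componentwise) auto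
  then show ?thesis by (auto simp: One_nat_def)
qed

lemma Ck_on_2_imp:
  assumes "Ck_on 2 U u" 
  shows "\<And>X. X \<in> U \<Longrightarrow> u differentiable (at X)"
    and "\<And>X. X \<in> U \<Longrightarrow> (grad u has_derivative hess u X) (at X)"
    and "continuous_on U (grad u)" "continuous_on U (\<lambda>X. hess u X v)"
proof -
  have c: "Ck_on 1 U (\<lambda>X. grad u X \<bullet> b)" if "b \<in> Basis" for b
    using assms that by (auto simp: numeral_2_eq_2)
  show "u differentiable (at X)" if "X \<in> U" for X
    using assms that by (auto simp: numeral_2_eq_2)
  have "Ck_on (Suc 1) U u" using assms by (simp only: numeral_2_eq_2 One_nat_def)
  then have "Ck_on 1 U u" by (rule Ck_on_mono)
  then show "continuous_on U (grad u)" using Ck_on_1_iff by blast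
  show "(grad u has_derivative hess u X) (at X)" if "X \<in> U" for X
    unfolding hess_def
    by (subst has_derivative_componentwise_within)
      (use that c in \<open>auto simp: Ck_on_1_iff inner_sum_left_Basis intro!: has_derivative_grad\<close>)
  show "continuous_on U (\<lambda>X. hess u X v)"
    unfolding hess_def using c[unfolded Ck_on_1_iff] by (auto intro!: continuous_intros)
qed

lemma linear_hess: "linear (hess u X)"
  unfolding hess_def by (auto intro!: linearI simp: inner_add_left sum.distrib scaleR_add_left scaleR_sum_right)

text \<open>The mean value theorem is applied twice: along a to the increment of u over the step in
  direction b, then along b to the resulting difference of gradients. The intermediate point stays
  in the parallelogram, which need not lie in a ball known in advance.\<close>

lemma second_difference:
  assumes U: "open U" "Ck_on 2 U u" and h: "h > 0"
    and sub: "\<And>s t. 0 \<le> s \<Longrightarrow> s \<le> h \<Longrightarrow> 0 \<le> t \<Longrightarrow> t \<le> h \<Longrightarrow> X + s *\<^sub>R a + t *\<^sub>R b \<in> U"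
  shows "\<exists>s t. 0 \<le> s \<and> s \<le> h \<and> 0 \<le> t \<and> t \<le> h \<and>
    u (X + h *\<^sub>R a + h *\<^sub>R b) - u (X + h *\<^sub>R a) - u (X + h *\<^sub>R b) + u X
      = h * (h * (hess u (X + s *\<^sub>R a + t *\<^sub>R b) b \<bullet> a))"
proof -
  note d = has_derivative_grad[OF Ck_on_2_imp(1)[OF U(2)]]
  let ?g = "\<lambda>s. u (X + s *\<^sub>R a + h *\<^sub>R b) - u (X + s *\<^sub>R a)"
  have "DERIV ?g s :> a \<bullet> grad u (X + s *\<^sub>R a + h *\<^sub>R b) - a \<bullet> grad u (X + s *\<^sub>R a)"
    if "0 \<le> s" "s \<le> h" for s
  proof -
    have "((\<lambda>s. u (X + s *\<^sub>R a + c)) has_derivative (\<lambda>k. (k *\<^sub>R a) \<bullet> grad u (X + s *\<^sub>R a + c))) (at s)"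
      if "X + s *\<^sub>R a + c \<in> U" for c
      by (rule has_derivative_compose[where f="\<lambda>s. X + s *\<^sub>R a + c", OF _ d[OF that]])
        (auto intro!: derivative_eq_intros)
    from this[of 0] this[of "h *\<^sub>R b"] show ?thesis
      using sub[of s h] sub[of s 0] that h
      unfolding has_field_derivative_def
      by (auto intro!: derivative_eq_intros simp: algebra_simps fun_eq_iff)
  qed
  then obtain s where s: "0 < s" "s < h"
    "?g h - ?g 0 = (h - 0) * (a \<bullet> grad u (X + s *\<^sub>R a + h *\<^sub>R b) - a \<bullet> grad u (X + s *\<^sub>R a))"
    using MVT2[OF h, of ?g "\<lambda>s. a \<bullet> grad u (X + s *\<^sub>R a + h *\<^sub>R b) - a \<bullet> grad u (X + s *\<^sub>R a)"] by auto
  let ?k = "\<lambda>t. a \<bullet> grad u (X + s *\<^sub>R a + t *\<^sub>R b)"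
  have "DERIV ?k t :> a \<bullet> hess u (X + s *\<^sub>R a + t *\<^sub>R b) b" if "0 \<le> t" "t \<le> h" for t
  proof -
    have U': "X + s *\<^sub>R a + t *\<^sub>R b \<in> U" using sub[of s t] s that by auto
    have "((\<lambda>t. grad u (X + s *\<^sub>R a + t *\<^sub>R b)) has_derivative
        (\<lambda>k. hess u (X + s *\<^sub>R a + t *\<^sub>R b) (k *\<^sub>R b))) (at t)"
      by (rule has_derivative_compose[where f="\<lambda>t. X + s *\<^sub>R a + t *\<^sub>R b", OF _ Ck_on_2_imp(2)[OF U(2) U']])
        (auto intro!: derivative_eq_intros)
    then show ?thesis
      unfolding has_field_derivative_def
      by (auto intro!: derivative_eq_intros simp: linear_cmul[OF linear_hess])
  qed
  then obtain t where t: "0 < t" "t < h"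
    "?k h - ?k 0 = (h - 0) * (a \<bullet> hess u (X + s *\<^sub>R a + t *\<^sub>R b) b)"
    using MVT2[OF h, of ?k "\<lambda>t. a \<bullet> hess u (X + s *\<^sub>R a + t *\<^sub>R b) b"] by auto
  show ?thesis
    using s t by (intro exI[of _ s] exI[of _ t]) (auto simp: inner_commute)
qed

text \<open>The second difference is unchanged when a and b are exchanged, so the two mixed
  derivatives take a common value at points arbitrarily close to \<open>X\<close>; continuity does
  the rest.\<close>

lemma hess_symmetric:
  assumes U: "open U" "Ck_on 2 U u" and X: "X \<in> U"
  shows "hess u X a \<bullet> b = hess u X b \<bullet> a"
proof (rule ccontr)
  assume ne: "\<not> ?thesis"
  \<comment> \<open>Half the gap: two numbers within less than \<open>e\<close> of values that are
    \<open>2 * e\<close> apart cannot coincide.\<close>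
  define e where "e = \<bar>hess u X a \<bullet> b - hess u X b \<bullet> a\<bar> / 2"
  have e: "e > 0" using ne by (simp add: e_def)
  have c: "isCont (\<lambda>Z. hess u Z v \<bullet> w) X" for v w
    using Ck_on_2_imp(4)[OF U(2), of v] U(1) X
    by (intro continuous_intros) (simp add: continuous_on_eq_continuous_at)
  have "eventually (\<lambda>Z. \<bar>hess u Z v \<bullet> w - hess u X v \<bullet> w\<bar> < e) (nhds X)" for v w
    using c[of v w] e unfolding isCont_def tendsto_iff dist_real_def eventually_nhds_conv_at by auto
  moreover have "eventually (\<lambda>Z. Z \<in> U) (nhds X)" using U X eventually_nhds by blast
  ultimately have "eventually (\<lambda>Z. \<bar>hess u Z a \<bullet> b - hess u X a \<bullet> b\<bar> < e \<and>
    \<bar>hess u Z b \<bullet> a - hess u X b \<bullet> a\<bar> < e \<and> Z \<in> U) (nhds X)"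
    by (simp add: eventually_conj_iff)
  then obtain r where r: "r > 0" and rr: "\<And>Z. dist Z X < r \<Longrightarrow> \<bar>hess u Z a \<bullet> b - hess u X a \<bullet> b\<bar> < e \<and>
    \<bar>hess u Z b \<bullet> a - hess u X b \<bullet> a\<bar> < e \<and> Z \<in> U"
    unfolding eventually_nhds_metric by blast
  \<comment> \<open>Small enough for the parallelogram with sides \<open>h\<close> times a and
    \<open>h\<close> times b to lie in the ball of radius \<open>r\<close>.\<close>
  define h where "h = r / (norm a + norm b + 1)"
  have h: "h > 0" using r by (simp add: h_def add_nonneg_pos)
  have near: "dist (X + s *\<^sub>R a + t *\<^sub>R b) X < r" if "0 \<le> s" "s \<le> h" "0 \<le> t" "t \<le> h" for s t
  proof -
    have "dist (X + s *\<^sub>R a + t *\<^sub>R b) X \<le> s * norm a + t * norm b"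
      using norm_triangle_ineq[of "s *\<^sub>R a" "t *\<^sub>R b"] that by (simp add: dist_norm add.assoc)
    also have "\<dots> \<le> h * norm a + h * norm b" using that by (intro add_mono mult_right_mono) auto
    also have "\<dots> < h * (norm a + norm b + 1)" using h by (simp add: algebra_simps)
    also have "\<dots> = r" using h_def by (simp add: add_nonneg_pos less_imp_neq[symmetric])
    finally show ?thesis .
  qed
  have n1: "X + s *\<^sub>R a + t *\<^sub>R b \<in> U" if "0 \<le> s" "s \<le> h" "0 \<le> t" "t \<le> h" for s t
    using rr near that by blast
  have n2: "X + s *\<^sub>R b + t *\<^sub>R a \<in> U" if "0 \<le> s" "s \<le> h" "0 \<le> t" "t \<le> h" for s t
    using n1[of t s] that by (simp add: algebra_simps)
  obtain s t where st: "0 \<le> s" "s \<le> h" "0 \<le> t" "t \<le> h"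
    "u (X + h *\<^sub>R a + h *\<^sub>R b) - u (X + h *\<^sub>R a) - u (X + h *\<^sub>R b) + u X
      = h * (h * (hess u (X + s *\<^sub>R a + t *\<^sub>R b) b \<bullet> a))"
    using second_difference[OF U h n1] by blast
  obtain s' t' where st': "0 \<le> s'" "s' \<le> h" "0 \<le> t'" "t' \<le> h"
    "u (X + h *\<^sub>R b + h *\<^sub>R a) - u (X + h *\<^sub>R b) - u (X + h *\<^sub>R a) + u X
      = h * (h * (hess u (X + s' *\<^sub>R b + t' *\<^sub>R a) a \<bullet> b))"
    using second_difference[OF U h n2] by blast
  have "h * (h * (hess u (X + s *\<^sub>R a + t *\<^sub>R b) b \<bullet> a)) = h * (h * (hess u (X + t' *\<^sub>R a + s' *\<^sub>R b) a \<bullet> b))"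
    using st(5) st'(5) by (simp add: algebra_simps)
  then have eq: "hess u (X + s *\<^sub>R a + t *\<^sub>R b) b \<bullet> a = hess u (X + t' *\<^sub>R a + s' *\<^sub>R b) a \<bullet> b"
    using h by simp
  have "\<bar>hess u (X + s *\<^sub>R a + t *\<^sub>R b) b \<bullet> a - hess u X b \<bullet> a\<bar> < e"
    "\<bar>hess u (X + t' *\<^sub>R a + s' *\<^sub>R b) a \<bullet> b - hess u X a \<bullet> b\<bar> < e"
    using rr near st st' by blast+
  then show False using eq unfolding e_def by (simp add: abs_if split: if_splits)
qed

section \<open>Mollification\<close>

text \<open>\<open>flat 1\<close> is the classical function exp(-1/t), extended by 0. Allowing a
  polynomial in 1/t as a factor makes the family closed under differentiation, so that smoothness of
  the bump follows by an induction over all \<open>q\<close>.\<close>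

definition flat :: "real poly \<Rightarrow> real \<Rightarrow> real" where
  "flat q t = (if t > 0 then poly q (1 / t) * exp (- (1 / t)) else 0)"

lemma flat_tendsto_0: "(flat q \<longlongrightarrow> 0) (at 0)"
proof -
  have "((\<lambda>x::real. \<Sum>i\<le>degree q. coeff q i * (x ^ i / exp x)) \<longlongrightarrow> (\<Sum>i\<le>degree q. coeff q i * 0)) at_top"
    by (intro tendsto_intros tendsto_power_div_exp_0)
  then have "((\<lambda>x. poly q x * exp (- x)) \<longlongrightarrow> 0) at_top"
    by (simp add: poly_altdef sum_distrib_right exp_minus divide_inverse mult.assoc)
  from filterlim_compose[OF this filterlim_inverse_at_top_right]
  have "(flat q \<longlongrightarrow> 0) (at_right 0)"
    by (rule Lim_transform_eventually)
      (auto simp: flat_def inverse_eq_divide eventually_at_filter intro!: always_eventually)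
  moreover have "(flat q \<longlongrightarrow> 0) (at_left 0)"
    by (rule Lim_transform_eventually[OF tendsto_const])
      (auto simp: flat_def eventually_at_filter intro!: always_eventually)
  ultimately show ?thesis by (rule filterlim_split_at[rotated])
qed

lemma DERIV_flat: "DERIV (flat q) t :> flat (monom 1 2 * (q - pderiv q)) t"
proof -
  consider "t > 0" | "t < 0" | "t = 0" by linarith
  then show ?thesis
  proof cases
    case 1
    have "((\<lambda>t. poly q (1 / t) * exp (- (1 / t))) has_real_derivative
       flat (monom 1 2 * (q - pderiv q)) t) (at t)"
    proof -
      have i: "((\<lambda>t. 1 / t) has_real_derivative - (1 / t\<^sup>2)) (at t)"
        using 1 by (auto intro!: derivative_eq_intros simp: power2_eq_square)
      have "((\<lambda>t. poly q (1 / t) * exp (- (1 / t))) has_real_derivative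
        poly (pderiv q) (1 / t) * - (1 / t\<^sup>2) * exp (- (1 / t)) + exp (- (1 / t)) * - (- (1 / t\<^sup>2)) * poly q (1 / t)) (at t)"
        by (intro DERIV_mult DERIV_chain2[OF poly_DERIV i] DERIV_chain2[OF DERIV_exp] DERIV_minus i)
      moreover have "poly (pderiv q) (1 / t) * - (1 / t\<^sup>2) * exp (- (1 / t)) +
          exp (- (1 / t)) * - (- (1 / t\<^sup>2)) * poly q (1 / t) = flat (monom 1 2 * (q - pderiv q)) t"
        using 1 by (simp add: flat_def poly_monom power_one_over algebra_simps)
      ultimately show ?thesis by simp
    qed
    moreover have "eventually (\<lambda>s. poly q (1 / s) * exp (- (1 / s)) = flat q s) (nhds t)"
      using eventually_nhds_in_open[of "{0<..}" t] 1
      by (auto simp: flat_def elim!: eventually_mono)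
    ultimately show ?thesis by (subst DERIV_cong_ev[OF refl _ refl, symmetric])
  next
    case 2
    have "eventually (\<lambda>s. 0 = flat q s) (nhds t)"
      using eventually_nhds_in_open[of "{..<0}" t] 2
      by (auto simp: flat_def elim!: eventually_mono)
    then show ?thesis using 2 DERIV_cong_ev[of t t "\<lambda>s. 0" "flat q" 0] by (auto simp: flat_def)
  next
    case 3
    \<comment> \<open>Division by h multiplies \<open>q\<close> by the indeterminate, so the
      difference quotient at 0 is again a member of the family and tends to 0. At h = 0 both sides
      are 0.\<close>
    have "(flat q (0 + h) - flat q 0) / h = flat (monom 1 1 * q) h" for h
      by (auto simp: flat_def poly_monom)
    then have "((\<lambda>h. (flat q (0 + h) - flat q 0) / h) \<longlongrightarrow> 0) (at 0)"
      using flat_tendsto_0 by presburger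
    then show ?thesis using 3 by (simp add: DERIV_def flat_def)
  qed
qed

lemma Ck_on_flat: "Ck_on k UNIV (\<lambda>X::'a::euclidean_space. flat q (1 - X \<bullet> X))"
proof (induction k arbitrary: q)
  case 0
  have "isCont (flat q) t" for t by (rule DERIV_isCont[OF DERIV_flat])
  then have "continuous_on UNIV (flat q)" by (simp add: continuous_at_imp_continuous_on)
  then show ?case by (auto intro!: continuous_intros continuous_on_compose2[of UNIV "flat q"])
next
  case (Suc k)
  define q' where "q' = monom 1 2 * (q - pderiv q)"
  have "GDERIV (\<lambda>X. 1 - X \<bullet> X) X :> - 2 *\<^sub>R X" for X :: 'a
    unfolding gderiv_def by (auto intro!: derivative_eq_intros simp: inner_commute)
  from GDERIV_DERIV_compose[OF this DERIV_flat]
  have g: "GDERIV (\<lambda>X. flat q (1 - X \<bullet> X)) X :> flat q' (1 - X \<bullet> X) *\<^sub>R (- 2 *\<^sub>R X)" for X :: 'a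
    by (simp add: q'_def)
  have "Ck_on k UNIV (\<lambda>X::'a. flat q' (1 - X \<bullet> X) * (- 2 * (X \<bullet> b)))" for b
    by (intro Ck_on_mult Ck_on_inner Ck_on_const Suc.IH) auto
  then show ?case using GDERIV_imp_differentiable[OF g] grad_eqI[OF g]
    by (simp add: mult.assoc)
qed

text \<open>The mass is normalised over the cube containing the unit ball, because integrals of
  continuous functions and Leibniz' rule are most convenient on boxes.\<close>

lemma ex_bump:
  obtains \<Phi> :: "'a::euclidean_space \<Rightarrow> real"
  where "\<And>k. Ck_on k UNIV \<Phi>" "\<And>X. \<Phi> X \<ge> 0" "\<And>X. norm X \<ge> 1 \<Longrightarrow> \<Phi> X = 0"
    "(\<Phi> has_integral 1) (cbox (- One) One)"
proof -
  define \<Psi> where "\<Psi> = (\<lambda>X::'a. flat 1 (1 - X \<bullet> X))"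
  have S: "Ck_on k UNIV \<Psi>" for k unfolding \<Psi>_def by (rule Ck_on_flat)
  have n: "\<Psi> X \<ge> 0" for X by (simp add: \<Psi>_def flat_def)
  have z: "\<Psi> X = 0" if "norm X \<ge> 1" for X
    using one_le_power[OF that, of 2] by (simp add: \<Psi>_def flat_def dot_square_norm)
  have c: "continuous_on (cbox (- One) One) \<Psi>"
    using S[of 0] continuous_on_subset by fastforce
  then have i: "\<Psi> integrable_on cbox (- One) One" by (rule integrable_continuous)
  define J where "J = integral (cbox (- One) One) \<Psi>"
  have "J \<noteq> 0"
  proof
    assume "J = 0"
    moreover have "(0::'a) \<in> box (- One) One" by (auto simp: mem_box)
    ultimately have "\<Psi> 0 = 0"
      using has_integral_0_cbox_imp_0[OF c _ _ _, of 0] n i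
      by (metis J_def box_subset_cbox empty_iff integrable_integral subsetD)
    then show False by (simp add: \<Psi>_def flat_def)
  qed
  moreover have "J \<ge> 0" using integral_nonneg[OF i] n J_def by auto
  ultimately have J: "J > 0" by simp
  show ?thesis
  proof (rule that[of "\<lambda>X. (1 / J) * \<Psi> X"])
    show "Ck_on k UNIV (\<lambda>X. (1 / J) * \<Psi> X)" for k
      by (intro Ck_on_mult Ck_on_const S) auto
    show "((\<lambda>X. (1 / J) * \<Psi> X) has_integral 1) (cbox (- One) One)"
      using has_integral_mult_right[OF integrable_integral[OF i], of "1 / J"] J
      by (simp add: J_def)
  qed (use n z J in auto)
qed

text \<open>The shift \<open>s\<close> is kept general to serve two purposes: with the identity, the
  derivative falls on a smooth kernel and yields smoothness; with a multiple of the variable, it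
  falls on the mollified function and yields convergence of gradients.\<close>

lemma GDERIV_convolution:
  fixes \<Psi> :: "'a::euclidean_space \<Rightarrow> real"
  assumes w: "continuous_on UNIV w" and s: "continuous_on UNIV s" and S: "Ck_on 1 UNIV \<Psi>"
  shows "GDERIV (\<lambda>X. integral (cbox a b) (\<lambda>Y. w Y * \<Psi> (X - s Y))) X :>
     integral (cbox a b) (\<lambda>Y. w Y *\<^sub>R grad \<Psi> (X - s Y))"
    and "integral (cbox a b) (\<lambda>Y. w Y *\<^sub>R grad \<Psi> (X - s Y)) \<bullet> e =
      integral (cbox a b) (\<lambda>Y. w Y * (grad \<Psi> (X - s Y) \<bullet> e))"
proof -
  have d: "(\<Psi> has_derivative (\<lambda>h. h \<bullet> grad \<Psi> Z)) (at Z)" for Z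
    using S[unfolded Ck_on_1_iff] has_derivative_grad by blast
  have g: "continuous_on UNIV (grad \<Psi>)" using S[unfolded Ck_on_1_iff] by simp
  have c: "continuous_on UNIV \<Psi>" using S Ck_on_mono[of 0 UNIV \<Psi>] by (simp add: One_nat_def)
  have i: "(\<lambda>Y. w Y *\<^sub>R grad \<Psi> (X - s Y)) integrable_on cbox a b"
    by (intro integrable_continuous continuous_intros continuous_on_compose2[OF g]
        continuous_on_subset[OF w] continuous_on_subset[OF s]) auto
  show "integral (cbox a b) (\<lambda>Y. w Y *\<^sub>R grad \<Psi> (X - s Y)) \<bullet> e =
      integral (cbox a b) (\<lambda>Y. w Y * (grad \<Psi> (X - s Y) \<bullet> e))"
    using integral_linear[OF i bounded_linear_inner_left[of e]] by (simp add: o_def)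
  have "((\<lambda>X. integral (cbox a b) (\<lambda>Y. w Y * \<Psi> (X - s Y))) has_derivative
    integral (cbox a b) (\<lambda>Y. w Y *\<^sub>R blinfun_inner_left (grad \<Psi> (X - s Y)))) (at X within UNIV)"
  proof (rule leibniz_rule[where fx="\<lambda>X Y. w Y *\<^sub>R blinfun_inner_left (grad \<Psi> (X - s Y))"])
    show "((\<lambda>X. w Y * \<Psi> (X - s Y)) has_derivative
        blinfun_apply (w Y *\<^sub>R blinfun_inner_left (grad \<Psi> (X - s Y)))) (at X within UNIV)" for X Y
    proof -
      have "((\<lambda>X. \<Psi> (X - s Y)) has_derivative (\<lambda>h. h \<bullet> grad \<Psi> (X - s Y))) (at X)"
        by (rule has_derivative_compose[where f="\<lambda>X. X - s Y" and g=\<Psi>, OF _ d])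
          (auto intro!: derivative_eq_intros)
      from has_derivative_mult_right[OF this, of "w Y"] show ?thesis
        by (simp add: scaleR_blinfun.rep_eq inner_commute)
    qed
    show "(\<lambda>Y. w Y * \<Psi> (X - s Y)) integrable_on cbox a b" for X
      by (intro integrable_continuous continuous_intros continuous_on_compose2[OF c]
          continuous_on_subset[OF w] continuous_on_subset[OF s]) auto
    show "continuous_on (UNIV \<times> cbox a b) (\<lambda>(X, Y). w Y *\<^sub>R blinfun_inner_left (grad \<Psi> (X - s Y)))"
      unfolding case_prod_unfold
      by (intro continuous_intros continuous_on_compose2[OF w] continuous_on_compose2[OF g]
          continuous_on_compose2[OF s] bounded_linear.continuous_on[OF bounded_linear_blinfun_inner_left]) auto
  qed auto
  moreover have "integral (cbox a b) (\<lambda>Y. w Y *\<^sub>R blinfun_inner_left (grad \<Psi> (X - s Y)))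
      = blinfun_inner_left (integral (cbox a b) (\<lambda>Y. w Y *\<^sub>R grad \<Psi> (X - s Y)))"
    using integral_linear[OF i bounded_linear_blinfun_inner_left]
    by (simp add: o_def blinfun.bilinear_simps linear_simps(5)[OF bounded_linear_blinfun_inner_left])
  ultimately show "GDERIV (\<lambda>X. integral (cbox a b) (\<lambda>Y. w Y * \<Psi> (X - s Y))) X :>
     integral (cbox a b) (\<lambda>Y. w Y *\<^sub>R grad \<Psi> (X - s Y))"
    unfolding gderiv_def by (simp add: inner_commute)
qed

lemma Ck_on_convolution:
  fixes \<Psi> :: "'a::euclidean_space \<Rightarrow> real"
  assumes \<xi>: "continuous_on UNIV \<xi>" and "\<And>j. Ck_on j UNIV \<Psi>"
  shows "Ck_on k UNIV (\<lambda>X. integral (cbox a b) (\<lambda>Y. \<xi> Y * \<Psi> (X - Y)))"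
  using assms(2)
proof (induction k arbitrary: \<Psi>)
  case 0
  note G = GDERIV_convolution(1)[OF \<xi> continuous_on_id 0]
  show ?case
    using differentiable_imp_continuous_within[OF GDERIV_imp_differentiable[OF G]]
    by (simp add: continuous_on_eq_continuous_within)
next
  case (Suc k)
  note G = GDERIV_convolution[OF \<xi> continuous_on_id Suc.prems]
  have "Ck_on j UNIV (\<lambda>X. grad \<Psi> X \<bullet> e)" if "e \<in> Basis" for j e
    using Suc.prems[of "Suc j"] that by simp
  then have "Ck_on k UNIV (\<lambda>X. integral (cbox a b) (\<lambda>Y. \<xi> Y * (grad \<Psi> (X - Y) \<bullet> e)))" if "e \<in> Basis" for e
    using Suc.IH[of "\<lambda>X. grad \<Psi> X \<bullet> e"] that by simp
  then show ?case
    using GDERIV_imp_differentiable[OF G(1)] grad_eqI[OF G(1)] by (simp add: G(2))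
qed

lemma Ck_on_scale: "Ck_on k UNIV g \<Longrightarrow> Ck_on k UNIV (\<lambda>X. g (c *\<^sub>R X))"
proof (induction k arbitrary: g)
  case 0
  then show ?case by (auto intro!: continuous_intros continuous_on_compose2[of UNIV g])
next
  case (Suc k)
  have "GDERIV (\<lambda>X. g (c *\<^sub>R X)) X :> c *\<^sub>R grad g (c *\<^sub>R X)" for X
  proof -
    have "(g has_derivative (\<lambda>h. h \<bullet> grad g (c *\<^sub>R X))) (at (c *\<^sub>R X))"
      using Suc.prems has_derivative_grad by auto
    from has_derivative_compose[where f="\<lambda>X. c *\<^sub>R X" and g=g, OF has_derivative_scaleR_right[OF has_derivative_ident] this]
    show ?thesis unfolding gderiv_def by simp
  qed
  note G = GDERIV_imp_differentiable[OF this] grad_eqI[OF this]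
  have "Ck_on k UNIV (\<lambda>X. c * (grad g (c *\<^sub>R X) \<bullet> b))" if "b \<in> Basis" for b
    by (rule Ck_on_mult[OF open_UNIV Ck_on_const Suc.IH]) (use Suc.prems that in simp)
  then show ?case using G by simp
qed

lemma grad_zero_outside:
  assumes "closed K" "\<And>X. X \<notin> K \<Longrightarrow> g X = 0" "X \<notin> K" shows "grad g X = 0"
proof (rule grad_eqI, rule GDERIV_cong_open[of "\<lambda>_. 0"])
  show "open (- K)" using assms(1) by auto
qed (use assms GDERIV_const in auto)

text \<open>Substitution of Z = (X - Y) / e. The affine image of one box is not the other box, but
  the product of the two functions vanishes outside either of them. The left form shows the limit as
  e tends to 0, the right form shows smoothness in \<open>X\<close>.\<close>

lemma convolution_rescale:
  fixes \<xi> \<Phi> :: "'a::euclidean_space \<Rightarrow> real"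
  assumes e: "e > 0" and \<xi>: "continuous_on UNIV \<xi>" "\<And>Y. Y \<notin> cbox a b \<Longrightarrow> \<xi> Y = 0"
    and \<Phi>: "continuous_on UNIV \<Phi>" "\<And>Z. Z \<notin> cbox c d \<Longrightarrow> \<Phi> Z = 0"
  shows "integral (cbox c d) (\<lambda>Z. \<Phi> Z * \<xi> (X - e *\<^sub>R Z)) =
    integral (cbox a b) (\<lambda>Y. \<xi> Y * ((1 / e ^ DIM('a)) * \<Phi> ((1 / e) *\<^sub>R (X - Y))))"
proof -
  let ?f = "\<lambda>Y. \<xi> Y * \<Phi> ((1 / e) *\<^sub>R (X - Y))"
  let ?S = "(\<lambda>x. (1 / - e) *\<^sub>R x + - ((1 / - e) *\<^sub>R X)) ` cbox a b"
  have i: "?f integrable_on cbox a b"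
    by (intro integrable_continuous continuous_intros continuous_on_compose2[OF \<Phi>(1)]
        continuous_on_subset[OF \<xi>(1)]) auto
  from has_integral_affinity[OF integrable_integral[OF i], of "- e" X]
  have "((\<lambda>Z. ?f ((- e) *\<^sub>R Z + X)) has_integral (1 / e ^ DIM('a)) * integral (cbox a b) ?f) ?S"
    using e by simp
  moreover have "(\<lambda>Z. ?f ((- e) *\<^sub>R Z + X)) = (\<lambda>Z. \<Phi> Z * \<xi> (X - e *\<^sub>R Z))"
    using e by (simp add: fun_eq_iff)
  ultimately have A: "((\<lambda>Z. \<Phi> Z * \<xi> (X - e *\<^sub>R Z)) has_integral (1 / e ^ DIM('a)) * integral (cbox a b) ?f) ?S"
    by metis
  have eq: "(\<lambda>Z. if Z \<in> ?S then \<Phi> Z * \<xi> (X - e *\<^sub>R Z) else 0) =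
     (\<lambda>Z. if Z \<in> cbox c d then \<Phi> Z * \<xi> (X - e *\<^sub>R Z) else 0)"
  proof -
    have "\<xi> (X - e *\<^sub>R Z) = 0" if "Z \<notin> ?S" for Z
    proof (rule \<xi>(2), rule notI)
      assume "X - e *\<^sub>R Z \<in> cbox a b"
      moreover have "Z = (1 / - e) *\<^sub>R (X - e *\<^sub>R Z) + - ((1 / - e) *\<^sub>R X)"
        using e by (simp add: scaleR_diff_right)
      ultimately show False using that by blast
    qed
    then show ?thesis using \<Phi>(2) by auto
  qed
  have "((\<lambda>Z. \<Phi> Z * \<xi> (X - e *\<^sub>R Z)) has_integral (1 / e ^ DIM('a)) * integral (cbox a b) ?f) (cbox c d)"
    by (subst has_integral_restrict_UNIV[symmetric], subst eq[symmetric],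
        subst has_integral_restrict_UNIV, rule A)
  then have "integral (cbox c d) (\<lambda>Z. \<Phi> Z * \<xi> (X - e *\<^sub>R Z)) = (1 / e ^ DIM('a)) * integral (cbox a b) ?f"
    by (rule integral_unique)
  also have "\<dots> = integral (cbox a b) (\<lambda>Y. (1 / e ^ DIM('a)) * ?f Y)"
    by (rule integral_mult_right[symmetric])
  also have "(\<lambda>Y. (1 / e ^ DIM('a)) * ?f Y) =
      (\<lambda>Y. \<xi> Y * ((1 / e ^ DIM('a)) * \<Phi> ((1 / e) *\<^sub>R (X - Y))))"
    by (intro ext) (rule mult.left_commute)
  finally show ?thesis .
qed

lemma mollified_limit:
  fixes g :: "'a::euclidean_space \<Rightarrow> real"
  assumes g: "continuous_on UNIV g" "\<And>X. \<bar>g X\<bar> \<le> B"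
    and \<Phi>: "continuous_on UNIV \<Phi>" "\<And>X. \<Phi> X \<ge> 0" "(\<Phi> has_integral 1) (cbox c d)"
    and e: "e \<longlonglongrightarrow> 0"
  shows "(\<lambda>n. integral (cbox c d) (\<lambda>Z. \<Phi> Z * g (X - e n *\<^sub>R Z))) \<longlonglongrightarrow> g X"
    and "\<bar>integral (cbox c d) (\<lambda>Z. \<Phi> Z * g (X - s *\<^sub>R Z))\<bar> \<le> B"
proof -
  have i: "(\<lambda>Z. \<Phi> Z * g (X - s *\<^sub>R Z)) integrable_on cbox c d" for s
    by (intro integrable_continuous continuous_intros continuous_on_compose2[OF g(1)]
        continuous_on_subset[OF \<Phi>(1)]) auto
  have j: "(\<lambda>Z. \<Phi> Z * B) integrable_on cbox c d"
    by (intro integrable_continuous continuous_intros continuous_on_subset[OF \<Phi>(1)]) auto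
  have b: "norm (\<Phi> Z * g Y) \<le> \<Phi> Z * B" for Z Y
    using \<Phi>(2) g(2) by (simp add: abs_mult mult_left_mono)
  have "isCont g X" using g(1) by (simp add: continuous_on_eq_continuous_at)
  then have l: "(\<lambda>n. \<Phi> Z * g (X - e n *\<^sub>R Z)) \<longlonglongrightarrow> \<Phi> Z * g X" for Z
    by (intro tendsto_mult tendsto_const isCont_tendsto_compose[where g=g])
      (auto intro!: tendsto_eq_intros e)
  have "(\<lambda>n. integral (cbox c d) (\<lambda>Z. \<Phi> Z * g (X - e n *\<^sub>R Z))) \<longlonglongrightarrow> integral (cbox c d) (\<lambda>Z. \<Phi> Z * g X)"
    by (rule dominated_convergence(2)[OF i j b l])
  also have "integral (cbox c d) (\<lambda>Z. \<Phi> Z * g X) = g X"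
    using has_integral_mult_left[OF \<Phi>(3), of "g X"] by (intro integral_unique) simp
  finally show "(\<lambda>n. integral (cbox c d) (\<lambda>Z. \<Phi> Z * g (X - e n *\<^sub>R Z))) \<longlonglongrightarrow> g X" .
  have "integral (cbox c d) (\<lambda>Z. \<Phi> Z * B) = B"
    using has_integral_mult_left[OF \<Phi>(3), of B] by (intro integral_unique) simp
  then show "\<bar>integral (cbox c d) (\<lambda>Z. \<Phi> Z * g (X - s *\<^sub>R Z))\<bar> \<le> B"
    using integral_norm_bound_integral[OF i j b, of s] by (simp only: real_norm_def)
qed

lemma bounded_of_compact_support:
  assumes "continuous_on UNIV (g :: 'a::euclidean_space \<Rightarrow> 'b::real_normed_vector)" "compact K" "\<And>X. X \<notin> K \<Longrightarrow> g X = 0"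
  obtains B where "B \<ge> 0" "\<And>X. norm (g X) \<le> B"
proof -
  have "bounded (g ` K)"
    using assms by (intro compact_imp_bounded compact_continuous_image) (auto intro: continuous_on_subset)
  then obtain B where "\<And>X. X \<in> K \<Longrightarrow> norm (g X) \<le> B" by (auto simp: bounded_iff)
  then have "norm (g X) \<le> max 0 B" for X
    using assms(3)[of X] max.coboundedI2[of "norm (g X)" B 0] by (cases "X \<in> K") simp_all
  then show ?thesis by (intro that[of "max 0 B"]) auto
qed

text \<open>Carries identities and inequalities from smooth to C^1 test functions. The common
  compact support and the uniform bounds on values and gradients are what dominated convergence
  needs afterwards.\<close>

lemma C1_approx_test_fun:
  fixes \<xi> :: "'a::euclidean_space \<Rightarrow> real"
  assumes "open V" "compact K" "K \<subseteq> V" and \<xi>: "Ck_on 1 UNIV \<xi>" "\<And>X. X \<notin> K \<Longrightarrow> \<xi> X = 0"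
  obtains \<zeta> :: "nat \<Rightarrow> 'a \<Rightarrow> real" and K' B where "compact K'" "K' \<subseteq> V" "\<And>n. test_fun V (\<zeta> n)"
    "\<And>n X. X \<notin> K' \<Longrightarrow> \<zeta> n X = 0" "\<And>n X. \<bar>\<zeta> n X\<bar> \<le> B" "\<And>n X. norm (grad (\<zeta> n) X) \<le> B"
    "\<And>X. (\<lambda>n. \<zeta> n X) \<longlonglongrightarrow> \<xi> X" "\<And>X. (\<lambda>n. grad (\<zeta> n) X) \<longlonglongrightarrow> grad \<xi> X"
proof -
  obtain \<Phi> :: "'a \<Rightarrow> real" where \<Phi>: "\<And>k. Ck_on k UNIV \<Phi>" "\<And>X. \<Phi> X \<ge> 0" "\<And>X. norm X \<ge> 1 \<Longrightarrow> \<Phi> X = 0"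
    "(\<Phi> has_integral 1) (cbox (- One) One)"
    using ex_bump by blast
  have \<Phi>c: "continuous_on UNIV \<Phi>" using \<Phi>(1)[of 0] by simp
  have \<Phi>0: "\<Phi> Z = 0" if "Z \<notin> cbox (- One) One" for Z
  proof (rule \<Phi>(3), rule ccontr)
    assume "\<not> 1 \<le> norm Z"
    then have "\<bar>Z \<bullet> b\<bar> \<le> 1" if "b \<in> Basis" for b using Basis_le_norm[OF that, of Z] by linarith
    then show False using that by (auto simp: mem_box abs_le_iff)
  qed
  have c: "continuous_on UNIV \<xi>" using \<xi>(1) Ck_on_mono[of 0 UNIV \<xi>] by (simp add: One_nat_def)
  have cg: "continuous_on UNIV (grad \<xi>)" using \<xi>(1)[unfolded Ck_on_1_iff] by simp
  have "\<exists>e>0. \<forall>X\<in>K. \<forall>Y\<in>-V. e \<le> dist X Y"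
    using separate_compact_closed[of K "- V"] assms(1-3) by auto
  then obtain e where e: "e > 0" "\<And>X Y. X \<in> K \<Longrightarrow> Y \<notin> V \<Longrightarrow> e \<le> dist X Y" by auto
  \<comment> \<open>The support \<open>K\<close> thickened by half its distance \<open>e\<close> to
    the complement of \<open>V\<close>; all mollification scales \<open>s n\<close> stay below
    \<open>e / 2\<close>.\<close>
  define K' where "K' = (\<lambda>(x, y). x + y) ` (K \<times> cball 0 (e / 2))"
  have K': "compact K'" unfolding K'_def case_prod_unfold
    by (intro compact_continuous_image compact_Times assms continuous_intros) auto
  have K'V: "K' \<subseteq> V"
  proof
    fix Y assume "Y \<in> K'"
    then obtain x y where "x \<in> K" "norm y \<le> e / 2" "Y = x + y" by (auto simp: K'_def)
    then have "x \<in> K" "dist x Y < e" using e(1) by (auto simp: dist_norm)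
    then show "Y \<in> V" using e(2) by force
  qed
  obtain a where a: "K \<subseteq> cbox (- a) a"
    using bounded_subset_cbox_symmetric[OF compact_imp_bounded[OF assms(2)]] by blast
  have \<xi>a: "\<xi> Y = 0" if "Y \<notin> cbox (- a) a" for Y using \<xi>(2) a that by blast
  define s where "s n = e / 2 * inverse (real (Suc n))" for n
  have s: "s n > 0" "s n \<le> e / 2" for n
    using e(1) by (auto simp: s_def mult_le_cancel_left1 inverse_le_1_iff)
  have s0: "s \<longlonglongrightarrow> 0" unfolding s_def using tendsto_mult_right_zero[OF LIMSEQ_inverse_real_of_nat] by blast
  define \<zeta> where "\<zeta> n X = integral (cbox (- One) One) (\<lambda>Z. \<Phi> Z * \<xi> (X - s n *\<^sub>R Z))" for n X
  note G = GDERIV_convolution[OF \<Phi>c _ \<xi>(1), of "\<lambda>Z. s n *\<^sub>R Z" "- One" One for n, folded \<zeta>_def]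
  have cs: "continuous_on UNIV (\<lambda>Z::'a. s n *\<^sub>R Z)" for n by (intro continuous_intros)
  have g: "grad (\<zeta> n) X \<bullet> b = integral (cbox (- One) One) (\<lambda>Z. \<Phi> Z * (grad \<xi> (X - s n *\<^sub>R Z) \<bullet> b))" for n X b
    using grad_eqI[OF G(1)[OF cs]] G(2)[OF cs] by (simp add: \<zeta>_def[abs_def])
  obtain B1 where B1: "B1 \<ge> 0" "\<And>X. norm (\<xi> X) \<le> B1" using bounded_of_compact_support[OF c assms(2) \<xi>(2)] by metis
  obtain B2 where B2: "B2 \<ge> 0" "\<And>X. norm (grad \<xi> X) \<le> B2"
    using bounded_of_compact_support[OF cg assms(2) grad_zero_outside[OF compact_imp_closed[OF assms(2)] \<xi>(2)]] by metis
  have B2': "\<bar>grad \<xi> X \<bullet> b\<bar> \<le> B2" if "b \<in> Basis" for X b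
    using Basis_le_norm[OF that] B2(2) order_trans by blast
  have cb: "continuous_on UNIV (\<lambda>X. grad \<xi> X \<bullet> b)" for b by (intro continuous_intros cg)
  have supp: "\<zeta> n X = 0" if "X \<notin> K'" for n X
  proof -
    have "\<Phi> Z * \<xi> (X - s n *\<^sub>R Z) = 0" for Z
    proof (cases "norm Z \<ge> 1")
      case False
      have "X - s n *\<^sub>R Z \<notin> K"
      proof
        assume "X - s n *\<^sub>R Z \<in> K"
        moreover have "norm (s n *\<^sub>R Z) \<le> e / 2"
          using mult_mono[of "s n" "e / 2" "norm Z" 1] s[of n] False e(1) by simp
        ultimately have "(X - s n *\<^sub>R Z) + s n *\<^sub>R Z \<in> K'" unfolding K'_def by force
        then show False using that by simp
      qed
      then show ?thesis using \<xi>(2) by simp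
    qed (simp add: \<Phi>(3))
    then have "(\<lambda>Z. \<Phi> Z * \<xi> (X - s n *\<^sub>R Z)) = (\<lambda>_. 0)" by blast
    then show ?thesis unfolding \<zeta>_def by simp
  qed
  show ?thesis
  \<comment> \<open>One constant for both bounds: \<open>B1\<close> for the values, and
    \<open>B2\<close> for each of the components of the gradient, whose norm is at most the sum of
    their absolute values.\<close>
  proof (rule that[of K' \<zeta> "B1 + DIM('a) * B2"])
    show "test_fun V (\<zeta> n)" for n
    proof -
      have "\<zeta> n X = integral (cbox (- a) a) (\<lambda>Y. \<xi> Y * ((1 / s n ^ DIM('a)) * \<Phi> ((1 / s n) *\<^sub>R (X - Y))))" for X
        unfolding \<zeta>_def by (rule convolution_rescale[OF s(1) c \<xi>a \<Phi>c \<Phi>0])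
      moreover have "Ck_on k UNIV (\<lambda>X. integral (cbox (- a) a) (\<lambda>Y. \<xi> Y * (\<lambda>W. (1 / s n ^ DIM('a)) * \<Phi> ((1 / s n) *\<^sub>R W)) (X - Y)))" for k
        by (intro Ck_on_convolution c Ck_on_mult Ck_on_const Ck_on_scale \<Phi>(1)) auto
      ultimately have "Ck_on k UNIV (\<zeta> n)" for k by presburger
      moreover have "closure {X. \<zeta> n X \<noteq> 0} \<subseteq> K'"
        using supp[of _ n] by (intro closure_minimal compact_imp_closed K') auto
      ultimately show ?thesis
        unfolding test_fun_def using K' K'V compact_closure[of "{X. \<zeta> n X \<noteq> 0}"]
        by (metis (no_types, lifting) bounded_subset closure_subset compact_imp_bounded order_trans)
    qed
    show "(\<lambda>n. \<zeta> n X) \<longlonglongrightarrow> \<xi> X" for X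
      unfolding \<zeta>_def using B1 by (intro mollified_limit c \<Phi>c \<Phi> s0) auto
    show "\<bar>\<zeta> n X\<bar> \<le> B1 + DIM('a) * B2" for n X
    proof -
      have "\<bar>\<zeta> n X\<bar> \<le> B1" unfolding \<zeta>_def using B1 by (intro mollified_limit(2) c \<Phi>c \<Phi> s0) auto
      then show ?thesis using B2(1) by (simp add: add_increasing2)
    qed
    show "(\<lambda>n. grad (\<zeta> n) X) \<longlonglongrightarrow> grad \<xi> X" for X
      by (subst tendsto_componentwise_iff)
        (auto simp: g intro!: mollified_limit(1)[where g="\<lambda>X. grad \<xi> X \<bullet> b" for b] cb B2' \<Phi>c \<Phi> s0)
    show "norm (grad (\<zeta> n) X) \<le> B1 + DIM('a) * B2" for n X
    proof -
      have "norm (grad (\<zeta> n) X) \<le> (\<Sum>b\<in>Basis. \<bar>grad (\<zeta> n) X \<bullet> b\<bar>)" by (rule norm_le_l1)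
      also have "\<dots> \<le> (\<Sum>b\<in>(Basis::'a set). B2)"
        by (intro sum_mono) (auto simp: g intro!: mollified_limit(2)[where g="\<lambda>X. grad \<xi> X \<bullet> b" for b] cb B2' \<Phi>c \<Phi> s0)
      finally show ?thesis using B1(1) by simp
    qed
  qed (use K' K'V supp in auto)
qed

section \<open>Measurability and the structural assumptions\<close>

text \<open>The Lebesgue measure of the product space is the completion of a product of Borel
  measures. A null set of x is therefore first enlarged to a Borel null set, whose cylinder is null
  for that product.\<close>

lemma AE_fst:
  assumes "AE x in (lebesgue :: 'a::euclidean_space measure). P x"
  shows "AE X in (lebesgue :: ('a \<times> 'b::euclidean_space) measure). P (fst X)"
proof -
  obtain N where N: "{x. \<not> P x} \<subseteq> N" "N \<in> null_sets (lborel :: 'a measure)"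
    using assms unfolding AE_completion_iff by (auto simp: eventually_ae_filter)
  have "N \<times> UNIV \<in> null_sets (lborel \<Otimes>\<^sub>M (lborel :: 'b measure))"
    using N(2) by (auto simp: null_sets_def lborel.emeasure_pair_measure_Times)
  then have "AE X in (lborel :: ('a \<times> 'b) measure). P (fst X)"
    unfolding lborel_prod by (rule AE_I') (use N(1) in auto)
  then show ?thesis by (rule AE_completion)
qed

lemma borel_measurable_fst_lebesgue:
  fixes g :: "'a::euclidean_space \<Rightarrow> real"
  assumes "g \<in> borel_measurable lebesgue"
  shows "(\<lambda>X::'a \<times> 'b::euclidean_space. g (fst X)) \<in> borel_measurable lebesgue"
proof -
  obtain g' where g': "g' \<in> borel_measurable lborel" "AE x in lborel. g x = g' x"
    using completion_ex_borel_measurable_real[OF assms] by blast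
  have a: "AE X in (lebesgue :: ('a \<times> 'b) measure). g' (fst X) = g (fst X)"
    using AE_fst[OF AE_completion[OF g'(2)]] by (simp add: eq_commute)
  have m: "(\<lambda>X::'a \<times> 'b. g' (fst X)) \<in> borel_measurable lebesgue"
  proof -
    have "fst \<in> borel_measurable (borel :: ('a \<times> 'b) measure)"
      by (intro borel_measurable_continuous_onI continuous_intros)
    from measurable_compose[OF this, of g' borel] show ?thesis
      using g'(1) by (intro measurable_completion) simp
  qed
  show ?thesis by (rule borel_measurable_AE[OF m a])
qed

lemma AE_sections:
  assumes "AE X in (lebesgue :: ('a::euclidean_space \<times> 'b::euclidean_space) measure). P (fst X) (snd X)"
  shows "AE x in lebesgue. AE y in lebesgue. P x y"
proof -
  have "AE X in lborel \<Otimes>\<^sub>M lborel. P (fst X) (snd X)"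
    using assms by (simp only: AE_completion_iff lborel_prod)
  from lborel_pair.AE_pair[OF this] show ?thesis by (simp add: AE_completion_iff)
qed

text \<open>
  A bounded Lebesgue measurable function that is continuous in its last argument is recovered, for
  almost every \<open>x\<close>, as the limit of averages of a Borel representative.
\<close>

lemma caratheodory_borel:
  fixes f :: "'a::euclidean_space \<Rightarrow> real \<Rightarrow> real"
  assumes f: "Linf_on UNIV (\<lambda>(x, s). f x s)" and c: "\<And>x. continuous_on UNIV (f x)"
  obtains F C where "(\<lambda>(x, s). F x s) \<in> borel_measurable borel"
    "AE x in lebesgue. \<forall>s. F x s = f x s" "AE x in lebesgue. \<forall>s. \<bar>f x s\<bar> \<le> C"
proof -
  have fm: "(\<lambda>(x, s). f x s) \<in> borel_measurable lebesgue"
    using f by (simp add: Linf_on_def lebesgue_on_UNIV_eq)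
  obtain C0 where C0: "AE X in lebesgue. norm (case X of (x, s) \<Rightarrow> f x s) \<le> C0"
    using f unfolding Linf_on_def lebesgue_on_UNIV_eq by blast
  define C where "C = max 0 C0"
  obtain g0 where g0: "g0 \<in> borel_measurable lborel" "AE X in lborel. (case X of (x, s) \<Rightarrow> f x s) = g0 X"
    using completion_ex_borel_measurable_real[OF fm] by blast
  \<comment> \<open>Truncation bounds the representative everywhere, so that the averages below
    exist and are dominated for every x.\<close>
  define g where "g X = max (- C) (min C (g0 X))" for X
  have gm[measurable]: "g \<in> borel_measurable borel" using g0(1) unfolding g_def[abs_def] by simp
  have gC: "\<bar>g X\<bar> \<le> C" for X by (auto simp: g_def C_def)
  have "AE X in lebesgue. \<bar>f (fst X) (snd X)\<bar> \<le> C \<and> f (fst X) (snd X) = g X"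
    using C0 AE_completion[OF g0(2)] by eventually_elim (auto simp: g_def C_def)
  then have ae: "AE x in lebesgue. AE s in lebesgue. \<bar>f x s\<bar> \<le> C \<and> f x s = g (x, s)"
    using AE_sections[of "\<lambda>x s. \<bar>f x s\<bar> \<le> C \<and> f x s = g (x, s)"] by simp
  \<comment> \<open>The average of \<open>g\<close> over the interval from s to s + 1/(n+1),
    rescaled to the unit interval. The limit \<open>lim\<close> is defined for all arguments and
    preserves Borel measurability; it equals \<open>f x s\<close> only for almost every x.\<close>
  define F where "F x s = lim (\<lambda>n. LINT r|lborel. indicator {0..1} r * g (x, s + inverse (real (Suc n)) * r))" for x s
  show ?thesis
  proof (rule that[of F C])
    have "(\<lambda>X. LINT r|lborel. indicator {0..1} r * g (fst X, snd X + inverse (real (Suc n)) * r)) \<in> borel_measurable borel" for n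
    proof (rule lborel.borel_measurable_lebesgue_integral)
      have "(\<lambda>Y::('a \<times> real) \<times> real. (fst (fst Y), snd (fst Y) + inverse (real (Suc n)) * snd Y)) \<in> borel_measurable borel"
        by (intro borel_measurable_continuous_onI continuous_intros)
      from measurable_compose[OF this gm]
      have "(\<lambda>Y. g (fst (fst Y), snd (fst Y) + inverse (real (Suc n)) * snd Y)) \<in> borel_measurable borel" .
      moreover have "(\<lambda>Y::('a \<times> real) \<times> real. indicator {0..1} (snd Y) :: real) \<in> borel_measurable borel"
        by (rule measurable_compose[of snd borel borel]) (auto intro!: borel_measurable_continuous_onI continuous_intros)
      ultimately have "(\<lambda>Y. indicator {0..1} (snd Y) * g (fst (fst Y), snd (fst Y) + inverse (real (Suc n)) * snd Y)) \<in> borel_measurable (borel :: (('a \<times> real) \<times> real) measure)"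
        by (intro borel_measurable_times)
      then show "(\<lambda>(X, r). indicator {0..1} r * g (fst X, snd X + inverse (real (Suc n)) * r)) \<in> borel_measurable (borel \<Otimes>\<^sub>M lborel)"
        by (simp add: case_prod_unfold borel_prod[symmetric] cong: measurable_cong_sets)
    qed
    then show "(\<lambda>(x, s). F x s) \<in> borel_measurable borel"
      unfolding F_def case_prod_unfold by (rule borel_measurable_lim_metric)
    show "AE x in lebesgue. \<forall>s. \<bar>f x s\<bar> \<le> C" using ae
    proof eventually_elim
      case (elim x)
      \<comment> \<open>A closed set of full measure is the whole line, so a bound for almost every
        s is one for every s.\<close>
      have "closed {s. \<bar>f x s\<bar> \<le> C}" by (intro closed_Collect_le continuous_intros c)
      moreover have "AE s in lebesgue. s \<in> {s. \<bar>f x s\<bar> \<le> C}"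
        using elim by (rule eventually_mono) auto
      ultimately show ?case using mem_closed_if_AE_lebesgue by blast
    qed
    show "AE x in lebesgue. \<forall>s. F x s = f x s" using ae
    proof eventually_elim
      case (elim x)
      show ?case
      proof
        fix s
        let ?q = "\<lambda>n r. indicator {0..1} r * g (x, s + inverse (real (Suc n)) * r) :: real"
        have 1: "AE r in lborel. f x (s + inverse (real (Suc n)) * r) = g (x, s + inverse (real (Suc n)) * r)" for n
        proof -
          have "AE t in lborel. f x t = g (x, t)" using elim by (simp add: AE_completion_iff)
          then obtain N where N: "{t. f x t \<noteq> g (x, t)} \<subseteq> N" "N \<in> null_sets lborel"
            by (auto simp: eventually_ae_filter)
          have "AE t in lborel. t \<notin> N" using N(2) AE_not_in by blast
          then have "AE r in lborel. s + inverse (real (Suc n)) * r \<notin> N"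
          proof (intro AE_borel_affine)
            show "Measurable.pred borel (\<lambda>t. t \<notin> N)" using null_setsD2[OF N(2)] by simp
          qed auto
          then show ?thesis by eventually_elim (use N(1) in auto)
        qed
        have "(\<lambda>n. integral\<^sup>L lborel (?q n)) \<longlonglongrightarrow> (LINT r|lborel. indicator {0..1::real} r * f x s)"
        proof (rule integral_dominated_convergence[where M=lborel and s="?q" and f="\<lambda>r. indicator {0..1} r * f x s"
              and w="\<lambda>r::real. C * indicator {0..1} r"])
          show "AE r in lborel. (\<lambda>n. ?q n r) \<longlonglongrightarrow> indicator {0..1} r * f x s"
          proof -
            have "AE r in lborel. \<forall>n. f x (s + inverse (real (Suc n)) * r) = g (x, s + inverse (real (Suc n)) * r)"
              using 1 by (simp add: AE_all_countable)
            then show ?thesis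
            proof eventually_elim
              case (elim r)
              have "(\<lambda>n. s + inverse (real (Suc n)) * r) \<longlonglongrightarrow> s + 0 * r"
                by (intro tendsto_intros LIMSEQ_inverse_real_of_nat)
              then have "(\<lambda>n. f x (s + inverse (real (Suc n)) * r)) \<longlonglongrightarrow> f x s"
                using c[of x] isCont_tendsto_compose[of s "f x"] by (simp add: continuous_on_eq_continuous_at)
              then show ?case using elim by (intro tendsto_intros) simp
            qed
          qed
          show "AE r in lborel. norm (?q n r) \<le> C * indicator {0..1} r" for n
            using gC by (auto simp: indicator_def)
        qed auto
        then show "F x s = f x s" unfolding F_def by (subst limI) auto
      qed
    qed
  qed
qed

text \<open>A derivative need not be continuous, and a function is not controlled by an almost
  everywhere bound on its derivative in general. Here the derivative exists at every point, so the
  fundamental theorem holds for the gauge integral, which ignores the null set where the bound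
  fails. This gives a Lipschitz constant, and the difference quotients then bound the derivative
  everywhere.\<close>

lemma deriv_bound_of_AE_bound:
  fixes h :: "real \<Rightarrow> real"
  assumes d: "\<And>s. h differentiable (at s)" and b: "AE s in lebesgue. \<bar>deriv h s\<bar> \<le> C"
  shows "\<bar>h t - h s\<bar> \<le> C * \<bar>t - s\<bar>" "\<bar>deriv h s\<bar> \<le> C"
proof -
  have D: "DERIV h s :> deriv h s" for s
    using d by (simp add: DERIV_deriv_iff_real_differentiable)
  obtain N where N: "{s. \<not> \<bar>deriv h s\<bar> \<le> C} \<subseteq> N" "N \<in> null_sets lebesgue"
    using b unfolding eventually_ae_filter by auto
  \<comment> \<open>For negative \<open>C\<close> the empty set would have full measure.\<close>
  have C: "0 \<le> C"
  proof (rule ccontr)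
    assume "\<not> 0 \<le> C"
    then have "AE s in (lebesgue :: real measure). s \<in> {}" using b by (auto elim!: eventually_mono)
    from mem_closed_if_AE_lebesgue[OF closed_empty this] show False by blast
  qed
  have L: "\<bar>h t - h s\<bar> \<le> C * (t - s)" if "s \<le> t" for s t
  proof -
    have "(deriv h has_integral h t - h s) {s..t}"
      by (rule fundamental_theorem_of_calculus[OF that])
        (simp add: D has_field_derivative_at_within flip: has_real_derivative_iff_has_vector_derivative)
    then have "((\<lambda>x. if \<bar>deriv h x\<bar> \<le> C then deriv h x else 0) has_integral h t - h s) {s..t}"
      by (rule has_integral_spike[rotated 2, of _ _ _ N])
        (use N in \<open>auto simp: negligible_iff_null_sets\<close>)
    from has_integral_bound_real[OF C _ this, of "{}"] that C show ?thesis by simp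
  qed
  show L': "\<bar>h t - h s\<bar> \<le> C * \<bar>t - s\<bar>" for s t
    using L[of s t] L[of t s] by (cases "s \<le> t") (auto simp: abs_minus_commute)
  have l: "(\<lambda>k. (h (s + k) - h s) / k) \<midarrow>0\<rightarrow> deriv h s" using D by (simp add: DERIV_def)
  have e: "\<forall>\<^sub>F k in at 0. norm ((h (s + k) - h s) / k) \<le> C"
    using L'[of "s + k" s for k] by (auto simp: eventually_at_filter divide_le_eq)
  show "\<bar>deriv h s\<bar> \<le> C"
    using Lim_norm_ubound[OF _ l e] by simp
qed

text \<open>The quantifier over s stands inside the almost everywhere statement in x, which is what
  makes it usable at s = u(X). The representative \<open>F'\<close> is a limit of difference
  quotients of \<open>F\<close> with step 1/(n+1), so its measurability does not rest on continuity
  of the derivative in s.\<close>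

lemma structural_f:
  fixes f :: "'a::euclidean_space \<Rightarrow> real \<Rightarrow> real"
  assumes f: "Linf_on UNIV (\<lambda>(x, s). f x s)" and d: "\<forall>x s. f x differentiable (at s)"
    and fu: "Linf_on UNIV (\<lambda>(x, s). deriv (f x) s)"
  obtains F F' C where "(\<lambda>(x, s). F x s) \<in> borel_measurable borel" "(\<lambda>(x, s). F' x s) \<in> borel_measurable borel"
    "AE x in lebesgue. \<forall>s. F x s = f x s \<and> F' x s = deriv (f x) s \<and> \<bar>f x s\<bar> \<le> C \<and> \<bar>deriv (f x) s\<bar> \<le> C"
proof -
  have c: "continuous_on UNIV (f x)" for x
    using d by (intro continuous_at_imp_continuous_on ballI differentiable_imp_continuous_within) auto
  obtain F C1 where F: "(\<lambda>(x, s). F x s) \<in> borel_measurable borel"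
    "AE x in lebesgue. \<forall>s. F x s = f x s" "AE x in lebesgue. \<forall>s. \<bar>f x s\<bar> \<le> C1"
    using caratheodory_borel[OF f c] by blast
  obtain C2 where "AE X in lebesgue. norm (case X of (x, s) \<Rightarrow> deriv (f x) s) \<le> C2"
    using fu unfolding Linf_on_def lebesgue_on_UNIV_eq by blast
  then have "AE x in lebesgue. AE s in lebesgue. \<bar>deriv (f x) s\<bar> \<le> C2"
    using AE_sections[of "\<lambda>x s. \<bar>deriv (f x) s\<bar> \<le> C2"] by (simp add: case_prod_unfold)
  then have C2: "AE x in lebesgue. \<forall>s. \<bar>deriv (f x) s\<bar> \<le> C2"
  proof eventually_elim
    case (elim x)
    show ?case using deriv_bound_of_AE_bound(2)[of "f x", OF _ elim] d by blast
  qed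
  define F' where "F' x s = lim (\<lambda>n. (F x (s + inverse (real (Suc n))) - F x s) / inverse (real (Suc n)))" for x s
  show ?thesis
  proof (rule that[of F F' "max C1 C2"])
    show "(\<lambda>(x, s). F x s) \<in> borel_measurable borel" by (rule F)
    have m: "(\<lambda>X. F (fst X) (snd X)) \<in> borel_measurable borel" using F(1) by (simp add: case_prod_unfold)
    have "(\<lambda>X. F (fst X) (snd X + inverse (real (Suc n)))) \<in> borel_measurable borel" for n
    proof -
      have "(\<lambda>X::'a \<times> real. (fst X, snd X + inverse (real (Suc n)))) \<in> borel_measurable borel"
        by (intro borel_measurable_continuous_onI continuous_intros)
      from measurable_compose[OF this m] show ?thesis by simp
    qed
    then show "(\<lambda>(x, s). F' x s) \<in> borel_measurable borel"
      unfolding F'_def case_prod_unfold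
      using m
      by (intro borel_measurable_lim_metric borel_measurable_divide borel_measurable_diff borel_measurable_const)
    show "AE x in lebesgue. \<forall>s. F x s = f x s \<and> F' x s = deriv (f x) s \<and> \<bar>f x s\<bar> \<le> max C1 C2 \<and> \<bar>deriv (f x) s\<bar> \<le> max C1 C2"
      using F(2,3) C2
    proof eventually_elim
      case (elim x)
      have "F' x s = deriv (f x) s" for s
      proof -
        have "(\<lambda>k. (f x (s + k) - f x s) / k) \<midarrow>0\<rightarrow> deriv (f x) s"
          using d by (simp add: DERIV_deriv_iff_real_differentiable flip: DERIV_def)
        moreover have "filterlim (\<lambda>n. inverse (real (Suc n))) (at 0) sequentially"
          unfolding filterlim_at using LIMSEQ_inverse_real_of_nat by auto
        ultimately have "(\<lambda>n. (f x (s + inverse (real (Suc n))) - f x s) / inverse (real (Suc n))) \<longlonglongrightarrow> deriv (f x) s"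
          by (rule filterlim_compose)
        then show ?thesis using elim(1) limI unfolding F'_def by simp
      qed
      then show ?case using elim by (auto simp: le_max_iff_disj)
    qed
  qed
qed

lemma borel_measurable_lebesgue_on_AE:
  fixes g h :: "'a::euclidean_space \<Rightarrow> real"
  assumes "U \<in> sets lebesgue" "g \<in> borel_measurable (lebesgue_on U)" "AE X in lebesgue. g X = h X"
  shows "h \<in> borel_measurable (lebesgue_on U)"
proof -
  have "(\<lambda>X. if X \<in> U then g X else 0) \<in> borel_measurable lebesgue"
    using assms(1,2) by (simp add: borel_measurable_if)
  moreover have "AE X in lebesgue. (if X \<in> U then g X else 0) = (if X \<in> U then h X else 0)"
    using assms(3) by eventually_elim auto
  ultimately have "(\<lambda>X. if X \<in> U then h X else 0) \<in> borel_measurable lebesgue"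
    by (rule borel_measurable_AE)
  then show ?thesis using assms(1) by (simp add: borel_measurable_if)
qed

text \<open>A Lebesgue measurable function composed with a measurable map may fail to be measurable.
  The Borel function \<open>F\<close> composes, and it agrees with \<open>h\<close> for almost every
  x whatever the value of u.\<close>

lemma borel_measurable_superposition:
  fixes u :: "'a::euclidean_space \<times> 'b::euclidean_space \<Rightarrow> real" and F h :: "'a \<Rightarrow> real \<Rightarrow> real"
  assumes U: "open U" and u: "continuous_on U u" and F: "(\<lambda>(x, s). F x s) \<in> borel_measurable borel"
    and ae: "AE x in lebesgue. \<forall>s. F x s = h x s"
  shows "(\<lambda>X. h (fst X) (u X)) \<in> borel_measurable (lebesgue_on U)"
proof (rule borel_measurable_lebesgue_on_AE)
  show "U \<in> sets lebesgue" using U by (simp add: sets_completionI_sets)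
  have [measurable]: "u \<in> borel_measurable (lebesgue_on U)"
    using u U by (intro continuous_imp_measurable_on_sets_lebesgue) auto
  have [measurable]: "fst \<in> borel_measurable (lebesgue_on U)"
    using U by (intro continuous_imp_measurable_on_sets_lebesgue continuous_intros) auto
  show "(\<lambda>X. F (fst X) (u X)) \<in> borel_measurable (lebesgue_on U)"
    using measurable_compose[of "\<lambda>X. (fst X, u X)" "lebesgue_on U" borel "\<lambda>(x, s). F x s" borel] F by simp
  show "AE X in lebesgue. F (fst X) (u X) = h (fst X) (u X)"
    using AE_fst[OF ae] by eventually_elim auto
qed

section \<open>Integrals of directional derivatives\<close>

lemma lebesgue_translation:
  fixes g :: "'a::euclidean_space \<Rightarrow> real"
  assumes "g \<in> borel_measurable lebesgue"
  shows "(\<lambda>X. g (X + a)) \<in> borel_measurable lebesgue"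
    and "integrable lebesgue (\<lambda>X. g (X + a)) \<longleftrightarrow> integrable lebesgue g"
    and "(LINT X|lebesgue. g (X + a)) = (LINT X|lebesgue. g X)"
proof -
  have T: "(\<lambda>x. a + (\<Sum>j\<in>Basis. (1 * (x \<bullet> j)) *\<^sub>R j)) = (\<lambda>X. X + a)"
    by (auto simp: euclidean_representation)
  have m: "(\<lambda>X. X + a) \<in> lebesgue \<rightarrow>\<^sub>M lebesgue"
    using lebesgue_affine_measurable[of "\<lambda>_. 1" a] unfolding T by simp
  have e: "lebesgue = distr lebesgue lebesgue (\<lambda>X::'a. X + a)"
    using lebesgue_affine_euclidean[of "\<lambda>_. 1" a] unfolding T by (simp add: density_1)
  show "(\<lambda>X. g (X + a)) \<in> borel_measurable lebesgue" using measurable_compose[OF m assms] .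
  show "integrable lebesgue (\<lambda>X. g (X + a)) \<longleftrightarrow> integrable lebesgue g"
    by (subst (2) e) (simp add: integrable_distr_eq[OF m assms])
  show "(LINT X|lebesgue. g (X + a)) = (LINT X|lebesgue. g X)"
    by (subst (2) e) (simp add: integral_distr[OF m assms])
qed

text \<open>By translation invariance every difference quotient of \<open>g\<close> has integral 0,
  and the mean value theorem dominates the quotients by \<open>C\<close> on a fixed compact set. The
  mean value theorem uses points of the whole segment, so the almost everywhere assumption has to
  cover the full line through \<open>X\<close>.\<close>

lemma integral_directional_derivative:
  fixes g g' :: "'a::euclidean_space \<Rightarrow> real"
  assumes g: "g \<in> borel_measurable lebesgue" and K: "compact K"
    and supp: "\<And>X. X \<notin> K \<Longrightarrow> g X = 0" "\<And>X. X \<notin> K \<Longrightarrow> g' X = 0"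
    and ae: "AE X in lebesgue. \<bar>g X\<bar> \<le> C \<and>
      (\<forall>t. ((\<lambda>t. g (X + t *\<^sub>R e)) has_real_derivative g' (X + t *\<^sub>R e)) (at t) \<and> \<bar>g' (X + t *\<^sub>R e)\<bar> \<le> C)"
  shows "integrable lebesgue g'" "(LINT X|lebesgue. g' X) = 0"
proof -
  define s where "s n = inverse (real (Suc n))" for n
  have s: "s n > 0" "s n \<le> 1" for n by (auto simp: s_def inverse_le_1_iff)
  define q where "q n X = (g (X + s n *\<^sub>R e) - g X) / s n" for n X
  \<comment> \<open>All points from which \<open>K\<close> is reached by a step of length parameter
    at most 1 along \<open>e\<close>; it carries all the difference quotients.\<close>
  define K1 where "K1 = (\<lambda>(x, r). x - r *\<^sub>R e) ` (K \<times> {0..1})"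
  have K1: "compact K1" unfolding K1_def case_prod_unfold
    by (intro compact_continuous_image compact_Times K continuous_intros) auto
  have qm: "q n \<in> borel_measurable lebesgue" for n
  proof -
    have "(\<lambda>X. (g (X + s n *\<^sub>R e) - g X) / s n) \<in> borel_measurable lebesgue"
      by (intro borel_measurable_divide borel_measurable_diff lebesgue_translation(1)[OF g] g borel_measurable_const)
    then show ?thesis by (simp add: q_def[abs_def])
  qed
  have K1m: "K1 \<in> lmeasurable" using K1 lmeasurable_compact by blast
  have Km: "K \<in> lmeasurable" using K lmeasurable_compact by blast
  have gi: "integrable lebesgue g"
  proof (rule Bochner_Integration.integrable_bound)
    show "integrable lebesgue (\<lambda>X. C * indicator K X :: real)"
      using Km by (intro integrable_mult_right integrable_real_indicator) (auto simp: fmeasurable_def)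
    show "AE X in lebesgue. norm (g X) \<le> norm (C * indicator K X)"
      using ae by eventually_elim (use supp(1) in \<open>auto simp: indicator_def abs_le_iff\<close>)
  qed (rule g)
  have lim: "AE X in lebesgue. (\<lambda>n. q n X) \<longlonglongrightarrow> g' X" using ae
  proof eventually_elim
    case (elim X)
    have "((\<lambda>t. g (X + t *\<^sub>R e)) has_real_derivative g' (X + 0 *\<^sub>R e)) (at 0)" using elim by blast
    then have "(\<lambda>k. (g (X + k *\<^sub>R e) - g X) / k) \<midarrow>0\<rightarrow> g' X" by (simp add: DERIV_def)
    moreover have "filterlim s (at 0) sequentially"
      unfolding filterlim_at s_def using LIMSEQ_inverse_real_of_nat by auto
    ultimately show ?case unfolding q_def by (rule filterlim_compose)
  qed
  have bound: "AE X in lebesgue. norm (q n X) \<le> C * indicator K1 X" for n using ae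
  proof eventually_elim
    case (elim X)
    show ?case
    proof (cases "X \<in> K1")
      case True
      have D: "((\<lambda>t. g (X + t *\<^sub>R e)) has_real_derivative g' (X + t *\<^sub>R e)) (at t)" for t
        using elim by blast
      from MVT2[OF s(1) D] obtain z where
        "g (X + s n *\<^sub>R e) - g (X + 0 *\<^sub>R e) = (s n - 0) * g' (X + z *\<^sub>R e)" by blast
      then have "g (X + s n *\<^sub>R e) - g X = s n * g' (X + z *\<^sub>R e)" by simp
      then show ?thesis using True elim s(1)[of n] by (simp add: q_def)
    next
      case False
      have "X \<notin> K" using False by (force simp: K1_def)
      moreover have "X + s n *\<^sub>R e \<notin> K"
      proof
        assume "X + s n *\<^sub>R e \<in> K"
        then have "(X + s n *\<^sub>R e) - s n *\<^sub>R e \<in> K1" using s[of n] unfolding K1_def by force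
        then show False using False by simp
      qed
      ultimately show ?thesis using supp False by (simp add: q_def)
    qed
  qed
  have "(\<lambda>X. lim (\<lambda>n. q n X)) \<in> borel_measurable lebesgue" by (intro borel_measurable_lim_metric qm)
  moreover have "AE X in lebesgue. lim (\<lambda>n. q n X) = g' X" using lim by eventually_elim (rule limI)
  ultimately have g'm: "g' \<in> borel_measurable lebesgue" by (rule borel_measurable_AE)
  have w: "integrable lebesgue (\<lambda>X. C * indicator K1 X :: real)"
    using K1m by (intro integrable_mult_right integrable_real_indicator) (auto simp: fmeasurable_def)
  show "integrable lebesgue g'" by (rule integrable_dominated_convergence[OF g'm qm w lim bound])
  have "(\<lambda>n. LINT X|lebesgue. q n X) \<longlonglongrightarrow> (LINT X|lebesgue. g' X)"
    by (rule integral_dominated_convergence[OF g'm qm w lim bound])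
  moreover have "(LINT X|lebesgue. q n X) = 0" for n
  proof -
    have "integrable lebesgue (\<lambda>X. g (X + s n *\<^sub>R e))" using lebesgue_translation(2)[OF g] gi by blast
    then show ?thesis
      by (simp add: q_def Bochner_Integration.integral_diff[OF _ gi] lebesgue_translation(3)[OF g])
  qed
  ultimately show "(LINT X|lebesgue. g' X) = 0" by (simp add: LIMSEQ_const_iff)
qed

section \<open>Orthonormal eigenbases\<close>

text \<open>A maximiser of the quadratic form on the unit sphere of \<open>T\<close> is an
  eigenvector: if the residual \<open>r\<close> were not 0, a small step from v along
  \<open>r\<close> would raise the Rayleigh quotient. Self-adjointness is asked on \<open>T\<close>
  alone since the shape operator acts on the tangent space.\<close>

lemma selfadjoint_eigenvector:
  fixes A :: "'a::euclidean_space \<Rightarrow> 'a"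
  assumes A: "linear A" and T: "subspace T" "\<And>v. v \<in> T \<Longrightarrow> A v \<in> T"
    and sa: "\<And>v w. v \<in> T \<Longrightarrow> w \<in> T \<Longrightarrow> A v \<bullet> w = v \<bullet> A w" and ne: "T \<noteq> {0}"
  obtains v l where "v \<in> T" "norm v = 1" "A v = l *\<^sub>R v"
proof -
  have "0 \<in> T" using T(1) subspace_0 by blast
  then obtain t where t: "t \<in> T" "t \<noteq> 0" using ne by blast
  let ?S = "T \<inter> sphere 0 1"
  have "t /\<^sub>R norm t \<in> ?S" using t T(1) by (simp add: subspace_scale)
  then have "?S \<noteq> {}" by blast
  moreover have "compact ?S" using closed_subspace[OF T(1)] by (simp add: closed_Int_compact)
  moreover have "continuous_on ?S (\<lambda>v. A v \<bullet> v)"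
    using A by (intro continuous_intros linear_continuous_on) (simp add: linear_conv_bounded_linear)
  ultimately obtain v where v: "v \<in> ?S" "\<And>w. w \<in> ?S \<Longrightarrow> A w \<bullet> w \<le> A v \<bullet> v"
    using continuous_attains_sup[of ?S "\<lambda>v. A v \<bullet> v"] by blast
  define l where "l = A v \<bullet> v"
  have vT: "v \<in> T" "norm v = 1" using v(1) by auto
  have q: "A w \<bullet> w \<le> l * (w \<bullet> w)" if "w \<in> T" for w
  proof (cases "w = 0")
    case False
    then have "w /\<^sub>R norm w \<in> ?S" using that T(1) by (simp add: subspace_scale)
    then have "A (w /\<^sub>R norm w) \<bullet> (w /\<^sub>R norm w) \<le> l" using v(2) l_def by blast
    then have "(A w \<bullet> w) / (norm w)\<^sup>2 \<le> l"
      by (simp add: linear_cmul[OF A] power2_eq_square divide_inverse mult_ac)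
    then show ?thesis using False by (simp add: divide_le_eq dot_square_norm)
  qed (simp add: linear_0[OF A])
  define r where "r = A v - l *\<^sub>R v"
  have r: "r \<in> T" using r_def vT T by (simp add: subspace_diff subspace_scale)
  have rv: "r \<bullet> v = 0" using vT by (simp add: r_def l_def inner_diff_left dot_square_norm)
  have rr: "A v \<bullet> r = r \<bullet> r" using rv by (simp add: r_def inner_diff_left inner_commute)
  have "r = 0"
  proof (rule ccontr)
    assume "r \<noteq> 0"
    define R where "R = r \<bullet> r"
    have R: "R > 0" using \<open>r \<noteq> 0\<close> by (simp add: R_def)
    \<comment> \<open>Maximality gives \<open>2 * R \<le> s * (l * R - A r \<bullet> r)\<close>;
      this choice keeps the right side at most \<open>R\<close>, a contradiction.\<close>
    define s where "s = R / (\<bar>l * R - A r \<bullet> r\<bar> + 1)"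
    have s: "s > 0" using R by (simp add: s_def add_nonneg_pos)
    have "v + s *\<^sub>R r \<in> T" using vT r T(1) by (simp add: subspace_add subspace_scale)
    moreover have "(v + s *\<^sub>R r) \<bullet> (v + s *\<^sub>R r) = 1 + s\<^sup>2 * R"
      using vT rv by (simp add: inner_add_left inner_add_right inner_commute[of v r] R_def power2_eq_square)
        (simp add: dot_square_norm)
    moreover have "A (v + s *\<^sub>R r) \<bullet> (v + s *\<^sub>R r) = l + 2 * s * R + s\<^sup>2 * (A r \<bullet> r)"
    proof -
      have "A r \<bullet> v = R" using sa[OF r vT(1)] rr by (simp add: R_def inner_commute)
      then show ?thesis
        using rr by (simp add: linear_add[OF A] linear_cmul[OF A] inner_add_left inner_add_right
            l_def R_def power2_eq_square algebra_simps)
    qed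
    ultimately have "l + 2 * s * R + s\<^sup>2 * (A r \<bullet> r) \<le> l * (1 + s\<^sup>2 * R)" using q by metis
    then have "s * (2 * R) \<le> s * (s * (l * R - A r \<bullet> r))" by (simp add: algebra_simps power2_eq_square)
    then have "2 * R \<le> s * (l * R - A r \<bullet> r)" using s by simp
    also have "\<dots> \<le> s * (\<bar>l * R - A r \<bullet> r\<bar> + 1)" using s by (intro mult_left_mono) auto
    also have "\<dots> = R" by (simp add: s_def add_nonneg_pos less_imp_neq[symmetric])
    finally show False using R by simp
  qed
  then show ?thesis using that[of v l] vT r_def by simp
qed

text \<open>Induction on the dimension: the complement inside \<open>T\<close> of an eigenvector v
  is invariant again, since A w . v = w . A v is a multiple of w . v = 0.\<close>

lemma selfadjoint_eigenbasis:
  fixes A :: "'a::euclidean_space \<Rightarrow> 'a"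
  assumes A: "linear A" and "subspace T" "\<And>v. v \<in> T \<Longrightarrow> A v \<in> T"
    and "\<And>v w. v \<in> T \<Longrightarrow> w \<in> T \<Longrightarrow> A v \<bullet> w = v \<bullet> A w"
  obtains B where "B \<subseteq> T" "pairwise orthogonal B" "\<And>b. b \<in> B \<Longrightarrow> norm b = 1" "span B = T"
    "\<And>b. b \<in> B \<Longrightarrow> \<exists>l. A b = l *\<^sub>R b"
proof -
  have "\<exists>B \<subseteq> T. pairwise orthogonal B \<and> (\<forall>b\<in>B. norm b = 1) \<and> span B = T \<and> (\<forall>b\<in>B. \<exists>l. A b = l *\<^sub>R b)"
    using assms(2-)
  proof (induction "dim T" arbitrary: T rule: less_induct)
    case less
    show ?case
    proof (cases "T = {0}")
      case True
      then show ?thesis by (intro exI[of _ "{}"]) auto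
    next
      case False
      obtain v l where v: "v \<in> T" "norm v = 1" "A v = l *\<^sub>R v"
        using selfadjoint_eigenvector[OF A less.prems False] by metis
      define T' where "T' = {w \<in> T. w \<bullet> v = 0}"
      have T': "subspace T'"
        using less.prems(1) by (auto simp: T'_def subspace_def inner_add_left)
      have sub: "T' \<subseteq> T" by (auto simp: T'_def)
      have "v \<notin> T'" using v(2) by (auto simp: T'_def dot_square_norm)
      then have "T' \<subset> T" using sub v(1) by blast
      then have d: "dim T' < dim T"
        by (intro dim_psubset) (simp add: span_eq_iff[THEN iffD2, OF T'] span_eq_iff[THEN iffD2, OF less.prems(1)])
      have m: "A w \<in> T'" if "w \<in> T'" for w
        using that less.prems(2)[of w] less.prems(3)[of w v] v by (simp add: T'_def)
      have s: "A w \<bullet> z = w \<bullet> A z" if "w \<in> T'" "z \<in> T'" for w z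
        using that sub less.prems(3) by blast
      obtain B where B: "B \<subseteq> T'" "pairwise orthogonal B" "\<forall>b\<in>B. norm b = 1" "span B = T'"
        "\<forall>b\<in>B. \<exists>l. A b = l *\<^sub>R b"
        using less.hyps[OF d T' m s] by blast
      have "span (insert v B) = T"
      proof
        show "span (insert v B) \<subseteq> T"
          using B(1) sub v(1) less.prems(1) by (intro span_minimal) auto
        show "T \<subseteq> span (insert v B)"
        proof
          fix w assume w: "w \<in> T"
          have "w - (w \<bullet> v) *\<^sub>R v \<in> T'"
            using w v less.prems(1)
            by (auto simp: T'_def inner_diff_left dot_square_norm subspace_diff subspace_scale)
          then have "w - (w \<bullet> v) *\<^sub>R v \<in> span (insert v B)" using B(4) span_mono[of B "insert v B"] by blast
          moreover have "(w \<bullet> v) *\<^sub>R v \<in> span (insert v B)" by (simp add: span_base span_scale)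
          ultimately show "w \<in> span (insert v B)" using span_add by fastforce
        qed
      qed
      moreover have "pairwise orthogonal (insert v B)"
        using B(1,2) by (auto simp: pairwise_insert T'_def orthogonal_def inner_commute)
      ultimately show ?thesis using B v sub by (intro exI[of _ "insert v B"]) auto
    qed
  qed
  then show ?thesis using that by blast
qed

lemma orthonormal_props:
  fixes B :: "'a::euclidean_space set"
  assumes "pairwise orthogonal B" "\<And>b. b \<in> B \<Longrightarrow> norm b = 1"
  shows "finite B" "independent B"
proof -
  have "0 \<notin> B" using assms(2) by force
  then show "independent B" using assms(1) pairwise_orthogonal_independent by blast
  then show "finite B" using independent_imp_finite by blast
qed

lemma orthonormal_expansion:
  fixes B :: "'a::euclidean_space set"
  assumes B: "pairwise orthogonal B" "\<And>b. b \<in> B \<Longrightarrow> norm b = 1" and x: "x \<in> span B"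
  shows "x = (\<Sum>b\<in>B. (x \<bullet> b) *\<^sub>R b)"
proof -
  note fin = orthonormal_props(1)[OF B]
  have "(\<Sum>b\<in>B. (x \<bullet> b) *\<^sub>R b) = x"
  proof (rule orthonormal_basis_expand[OF _ _ x fin])
    show "pairwise orthogonal B" by (rule B)
    show "\<And>b. b \<in> B \<Longrightarrow> norm b = 1" by (rule B)
  qed
  then show ?thesis by simp
qed

lemma orthonormal_parseval:
  fixes B :: "'a::euclidean_space set"
  assumes B: "pairwise orthogonal B" "\<And>b. b \<in> B \<Longrightarrow> norm b = 1" and x: "x \<in> span B"
  shows "(norm x)\<^sup>2 = (\<Sum>b\<in>B. (x \<bullet> b)\<^sup>2)"
proof -
  have "x \<bullet> x = x \<bullet> (\<Sum>b\<in>B. (x \<bullet> b) *\<^sub>R b)" using orthonormal_expansion[OF B x] by simp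
  then show ?thesis by (simp add: inner_sum_right power2_eq_square dot_square_norm)
qed

text \<open>The Hilbert-Schmidt norm does not depend on the basis: after expansion in the standard
  basis, symmetry turns the inner sum into Parseval's identity for \<open>H e\<close>.\<close>

lemma hilbert_schmidt_orthonormal:
  fixes H :: "'a::euclidean_space \<Rightarrow> 'a"
  assumes B: "pairwise orthogonal B" "\<And>b. b \<in> B \<Longrightarrow> norm b = 1" "span B = UNIV"
    and sym: "\<And>v w. H v \<bullet> w = H w \<bullet> v"
  shows "(\<Sum>b\<in>B. (norm (H b))\<^sup>2) = (\<Sum>e\<in>Basis. (norm (H e))\<^sup>2)"
proof -
  have "(\<Sum>b\<in>B. (norm (H b))\<^sup>2) = (\<Sum>b\<in>B. \<Sum>e\<in>Basis. (H b \<bullet> e)\<^sup>2)"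
    by (simp add: norm_eq_sqrt_inner euclidean_inner[of "H _" "H _"] power2_eq_square sum_nonneg)
  also have "\<dots> = (\<Sum>e\<in>Basis. \<Sum>b\<in>B. (H e \<bullet> b)\<^sup>2)"
    by (subst sum.swap) (simp add: sym)
  also have "\<dots> = (\<Sum>e\<in>Basis. (norm (H e))\<^sup>2)"
    using orthonormal_parseval[OF B(1,2)] B(3) by simp
  finally show ?thesis .
qed

text \<open>The left side has the shape of \<open>curvature_norm\<close>, a sum over eigenvalues
  without repetition weighted by multiplicities. Each eigenspace is spanned by the basis vectors
  that share its eigenvalue, so grouping \<open>B\<close> by eigenvalue gives the right
  side.\<close>

lemma eigenspace_dims:
  fixes A :: "'a::euclidean_space \<Rightarrow> 'a"
  assumes A: "linear A" and B: "pairwise orthogonal B" "\<And>b. b \<in> B \<Longrightarrow> norm b = 1" "span B = T"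
    "\<And>b. b \<in> B \<Longrightarrow> \<exists>l. A b = l *\<^sub>R b"
  shows "(\<Sum>\<kappa>\<in>{\<kappa>. \<exists>v\<in>T. A v = \<kappa> *\<^sub>R v \<and> v \<noteq> 0}. real (dim {v \<in> T. A v = \<kappa> *\<^sub>R v}) * \<kappa>\<^sup>2) =
    (\<Sum>b\<in>B. (norm (A b))\<^sup>2)"
proof -
  obtain l where l: "\<And>b. b \<in> B \<Longrightarrow> A b = l b *\<^sub>R b" using B(4) by metis
  note fin = orthonormal_props(1)[OF B(1,2)] and ind = orthonormal_props(2)[OF B(1,2)]
  have E: "{v \<in> T. A v = \<kappa> *\<^sub>R v} = span {b \<in> B. l b = \<kappa>}" for \<kappa>
  proof
    show "span {b \<in> B. l b = \<kappa>} \<subseteq> {v \<in> T. A v = \<kappa> *\<^sub>R v}"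
    proof (rule span_minimal)
      show "{b \<in> B. l b = \<kappa>} \<subseteq> {v \<in> T. A v = \<kappa> *\<^sub>R v}" using B(3) l by (auto simp: span_base)
      show "subspace {v \<in> T. A v = \<kappa> *\<^sub>R v}"
        using B(3) subspace_span[of B] linear_0[OF A]
        by (auto simp: subspace_def linear_add[OF A] linear_cmul[OF A] scaleR_add_right)
    qed
    show "{v \<in> T. A v = \<kappa> *\<^sub>R v} \<subseteq> span {b \<in> B. l b = \<kappa>}"
    proof clarify
      fix v assume v: "v \<in> T" "A v = \<kappa> *\<^sub>R v"
      have ex: "v = (\<Sum>b\<in>B. (v \<bullet> b) *\<^sub>R b)" using orthonormal_expansion[OF B(1,2)] v(1) B(3) by blast
      have "(v \<bullet> b) = 0" if b: "b \<in> B" "l b \<noteq> \<kappa>" for b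
      proof -
        have ortho: "c \<bullet> b = (if c = b then 1 else 0)" if "c \<in> B" for c
          using B(1,2) that b(1) by (auto simp: pairwise_def orthogonal_def dot_square_norm)
        have "A v = (\<Sum>c\<in>B. (v \<bullet> c) *\<^sub>R (l c *\<^sub>R c))"
          using l by (subst ex) (simp add: linear_sum[OF A] linear_cmul[OF A])
        then have "A v \<bullet> b = (\<Sum>c\<in>B. (v \<bullet> c) * l c * (c \<bullet> b))" by (simp add: inner_sum_left mult.assoc)
        also have "\<dots> = (\<Sum>c\<in>B. if c = b then (v \<bullet> b) * l b else 0)"
          by (rule sum.cong) (auto simp: ortho)
        also have "\<dots> = (v \<bullet> b) * l b" using fin b(1) by simp
        finally show ?thesis using v(2) b(2) by simp
      qed
      then have "v = (\<Sum>b\<in>{b\<in>B. l b = \<kappa>}. (v \<bullet> b) *\<^sub>R b)"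
        by (subst ex, intro sum.mono_neutral_cong_right) (auto simp: fin)
      then show "v \<in> span {b \<in> B. l b = \<kappa>}"
        by (metis (mono_tags, lifting) span_base span_scale span_sum)
    qed
  qed
  have d: "dim {v \<in> T. A v = \<kappa> *\<^sub>R v} = card {b \<in> B. l b = \<kappa>}" for \<kappa>
    unfolding E by (rule dim_span_eq_card_independent, rule independent_mono[OF ind]) auto
  have K: "{\<kappa>. \<exists>v\<in>T. A v = \<kappa> *\<^sub>R v \<and> v \<noteq> 0} = l ` B"
  proof (intro set_eqI iffI)
    fix \<kappa> assume "\<kappa> \<in> {\<kappa>. \<exists>v\<in>T. A v = \<kappa> *\<^sub>R v \<and> v \<noteq> 0}"
    then obtain v where "v \<in> {v \<in> T. A v = \<kappa> *\<^sub>R v}" "v \<noteq> 0" by blast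
    then have "v \<in> span {b \<in> B. l b = \<kappa>}" "v \<noteq> 0" using E by auto
    then have "{b \<in> B. l b = \<kappa>} \<noteq> {}" by (metis (no_types, lifting) span_empty singletonD)
    then show "\<kappa> \<in> l ` B" by blast
  next
    fix \<kappa> assume "\<kappa> \<in> l ` B"
    then obtain b where b: "b \<in> B" "\<kappa> = l b" by blast
    moreover have "b \<noteq> 0" using B(2)[OF b(1)] by auto
    ultimately show "\<kappa> \<in> {\<kappa>. \<exists>v\<in>T. A v = \<kappa> *\<^sub>R v \<and> v \<noteq> 0}"
      using l B(3) by (auto intro!: bexI[of _ b] simp: span_base)
  qed
  have "(\<Sum>\<kappa>\<in>l ` B. real (dim {v \<in> T. A v = \<kappa> *\<^sub>R v}) * \<kappa>\<^sup>2) = (\<Sum>\<kappa>\<in>l ` B. \<Sum>b\<in>{b\<in>B. l b = \<kappa>}. (l b)\<^sup>2)"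
    unfolding d by (rule sum.cong) auto
  also have "\<dots> = (\<Sum>b\<in>B. (l b)\<^sup>2)" by (rule sum.image_gen[OF fin, symmetric])
  also have "\<dots> = (\<Sum>b\<in>B. (norm (A b))\<^sup>2)" using l B(2) by (intro sum.cong) auto
  finally show ?thesis unfolding K .
qed

section \<open>Curvature of level sets\<close>

lemma ortho_complement_basis:
  fixes \<nu> :: "'a::euclidean_space"
  assumes \<nu>: "norm \<nu> = 1" and B: "pairwise orthogonal B" "\<And>b. b \<in> B \<Longrightarrow> norm b = 1" "span B = {v. v \<bullet> \<nu> = 0}"
  shows "pairwise orthogonal (insert \<nu> B)" "span (insert \<nu> B) = UNIV" "\<nu> \<notin> B"
proof -
  have b: "b \<bullet> \<nu> = 0" if "b \<in> B" for b using B(3) span_base[OF that] by auto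
  show "pairwise orthogonal (insert \<nu> B)"
    using B(1) b by (auto simp: pairwise_insert orthogonal_def inner_commute)
  show "\<nu> \<notin> B" using b \<nu> by (metis dot_square_norm one_power2 zero_neq_one)
  have "w \<in> span (insert \<nu> B)" for w
  proof -
    have "w - (w \<bullet> \<nu>) *\<^sub>R \<nu> \<in> span B" using \<nu> by (simp add: B(3) inner_diff_left dot_square_norm)
    then have "w - (w \<bullet> \<nu>) *\<^sub>R \<nu> \<in> span (insert \<nu> B)" using span_mono[of B "insert \<nu> B"] by blast
    moreover have "(w \<bullet> \<nu>) *\<^sub>R \<nu> \<in> span (insert \<nu> B)" by (simp add: span_base span_scale)
    ultimately show ?thesis using span_add by fastforce
  qed
  then show "span (insert \<nu> B) = UNIV" by blast
qed

text \<open>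
  For a function with Hessian \<open>H\<close> and gradient \<open>w \<nu>\<close>, the map \<open>N\<close> is the derivative of \<open>\<nu>\<close>, so that \<open>- N\<close> is the
  shape operator of its level set.
\<close>

lemma shape_operator_identity:
  fixes H :: "'a::euclidean_space \<Rightarrow> 'a" and \<nu> :: 'a
  assumes H: "linear H" "\<And>v w. H v \<bullet> w = H w \<bullet> v" and \<nu>: "norm \<nu> = 1" and w: "w > 0"
    and N: "\<And>v. N v = (H v - (H v \<bullet> \<nu>) *\<^sub>R \<nu>) /\<^sub>R w"
  shows "(\<Sum>\<kappa>\<in>{\<kappa>. \<exists>v\<in>{v. v \<bullet> \<nu> = 0}. - N v = \<kappa> *\<^sub>R v \<and> v \<noteq> 0}.
      real (dim {v \<in> {v. v \<bullet> \<nu> = 0}. - N v = \<kappa> *\<^sub>R v}) * \<kappa>\<^sup>2) * w\<^sup>2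
    + (norm (H \<nu> - (H \<nu> \<bullet> \<nu>) *\<^sub>R \<nu>))\<^sup>2
    = (\<Sum>e\<in>Basis. (norm (H e))\<^sup>2) - (norm (H \<nu>))\<^sup>2"
proof -
  define T where "T = {v. v \<bullet> \<nu> = 0}"
  have T: "subspace T" by (auto simp: T_def subspace_def inner_add_left)
  have \<nu>\<nu>: "\<nu> \<bullet> \<nu> = 1" using \<nu> by (simp add: dot_square_norm)
  have L: "linear (\<lambda>v. - N v)"
    by (rule linearI) (simp_all add: N linear_add[OF H(1)] linear_cmul[OF H(1)] inner_add_left algebra_simps)
  have NT: "- N v \<in> T" for v using \<nu>\<nu> by (simp add: N T_def inner_diff_left)
  have sa: "- N v \<bullet> z = v \<bullet> - N z" if "v \<in> T" "z \<in> T" for v z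
    using that H(2)[of v z] by (simp add: N T_def inner_diff_left inner_diff_right inner_commute)
  obtain B where B: "B \<subseteq> T" "pairwise orthogonal B" "\<And>b. b \<in> B \<Longrightarrow> norm b = 1" "span B = T"
    "\<And>b. b \<in> B \<Longrightarrow> \<exists>l. - N b = l *\<^sub>R b"
    using selfadjoint_eigenbasis[OF L T NT sa] by metis
  note C = ortho_complement_basis[OF \<nu> B(2,3) B(4)[unfolded T_def]]
  have fin: "finite B" using orthonormal_props(1)[OF B(2,3)] .
  have "(\<Sum>e\<in>Basis. (norm (H e))\<^sup>2) = (\<Sum>b\<in>insert \<nu> B. (norm (H b))\<^sup>2)"
    using hilbert_schmidt_orthonormal[OF C(1) _ C(2) H(2)] B(3) \<nu> by fastforce
  then have 1: "(\<Sum>e\<in>Basis. (norm (H e))\<^sup>2) - (norm (H \<nu>))\<^sup>2 = (\<Sum>b\<in>B. (norm (H b))\<^sup>2)"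
    using C(3) fin by simp
  \<comment> \<open>Pythagoras for \<open>H b\<close>: the tangential part is \<open>w\<close> times
    \<open>N b\<close>, and by symmetry the normal part is the entry of \<open>H \<nu>\<close> along
    b.\<close>
  have 2: "(norm (H b))\<^sup>2 = (norm (- N b))\<^sup>2 * w\<^sup>2 + (H \<nu> \<bullet> b)\<^sup>2" for b
  proof -
    have "H b - (H b \<bullet> \<nu>) *\<^sub>R \<nu> = w *\<^sub>R N b" using w by (simp add: N)
    then have "(norm (- N b))\<^sup>2 * w\<^sup>2 = (norm (H b - (H b \<bullet> \<nu>) *\<^sub>R \<nu>))\<^sup>2"
      using w by (simp add: power_mult_distrib)
    also have "\<dots> = (norm (H b))\<^sup>2 - (H b \<bullet> \<nu>)\<^sup>2"
      unfolding power2_norm_eq_inner using \<nu>\<nu>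
      by (simp add: inner_diff_left inner_diff_right inner_commute power2_eq_square)
    finally show ?thesis using H(2)[of b \<nu>] by simp
  qed
  have "H \<nu> - (H \<nu> \<bullet> \<nu>) *\<^sub>R \<nu> \<in> span B" using \<nu>\<nu> by (simp add: B(4) T_def inner_diff_left)
  note p = orthonormal_parseval[OF B(2,3) this]
  \<comment> \<open>Summed over the tangent basis, these mixed entries form the squared tangential
    part of \<open>H \<nu>\<close>, that is, of the gradient of w.\<close>
  have 3: "(norm (H \<nu> - (H \<nu> \<bullet> \<nu>) *\<^sub>R \<nu>))\<^sup>2 = (\<Sum>b\<in>B. (H \<nu> \<bullet> b)\<^sup>2)"
  proof -
    have "b \<bullet> \<nu> = 0" "\<nu> \<bullet> b = 0" if "b \<in> B" for b using that B(1) by (auto simp: T_def inner_commute)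
    then have "(\<Sum>b\<in>B. ((H \<nu> - (H \<nu> \<bullet> \<nu>) *\<^sub>R \<nu>) \<bullet> b)\<^sup>2) = (\<Sum>b\<in>B. (H \<nu> \<bullet> b)\<^sup>2)"
      by (intro sum.cong) (simp_all add: inner_diff_left)
    then show ?thesis using p by simp
  qed
  have 4: "(\<Sum>b\<in>B. (norm (H b))\<^sup>2) = (\<Sum>b\<in>B. (norm (- N b))\<^sup>2) * w\<^sup>2 + (\<Sum>b\<in>B. (H \<nu> \<bullet> b)\<^sup>2)"
    by (simp only: 2 sum.distrib sum_distrib_right)
  show ?thesis
    using eigenspace_dims[OF L B(2-5)] unfolding 1 3 4 T_def[symmetric] by simp
qed

text \<open>Every v orthogonal to \<open>g\<close> must be the velocity of a curve in
  \<open>L\<close>. A curve of the form y + t v + s(t) g with s(t) = o(t) suffices, as only its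
  derivative at 0 is asked for, so the intermediate value theorem replaces the implicit function
  theorem and differentiability of \<open>h\<close> at the single point y is enough.\<close>

lemma tangent_space_hypersurface:
  fixes h :: "'b::euclidean_space \<Rightarrow> real"
  assumes U: "open U" "y \<in> U" and c: "continuous_on U h" and d: "GDERIV h y :> g" and g: "g \<noteq> 0"
    and L: "L \<inter> U = {z \<in> U. h z = c0}" "h y = c0"
  shows "tangent_space L y = {v. v \<bullet> g = 0}"
proof
  have dh: "(h has_derivative (\<lambda>k. k \<bullet> g)) (at y)" using d by (simp add: gderiv_def)
  show "tangent_space L y \<subseteq> {v. v \<bullet> g = 0}"
  proof
    fix v assume "v \<in> tangent_space L y"
    then obtain \<gamma> where \<gamma>: "\<gamma> 0 = y" "\<And>t. \<gamma> t \<in> L" "(\<gamma> has_vector_derivative v) (at (0::real))"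
      by (auto simp: tangent_space_def)
    have "((\<lambda>t. h (\<gamma> t)) has_derivative (\<lambda>t. (t *\<^sub>R v) \<bullet> g)) (at 0)"
      using \<gamma>(3) dh \<gamma>(1) unfolding has_vector_derivative_def
      by (intro has_derivative_compose[where f=\<gamma> and g=h]) auto
    moreover have "((\<lambda>t. h (\<gamma> t)) has_derivative (\<lambda>t. 0)) (at 0)"
    proof (rule has_derivative_transform_eventually[OF has_derivative_const])
      have "isCont \<gamma> 0" using \<gamma>(3) has_vector_derivative_continuous by blast
      then have "eventually (\<lambda>t. \<gamma> t \<in> U) (at 0)"
        using U \<gamma>(1) by (metis isCont_def topological_tendstoD)
      then show "eventually (\<lambda>t. c0 = h (\<gamma> t)) (at 0)"
        by (rule eventually_mono) (metis (mono_tags, lifting) IntI L(1) \<gamma>(2) mem_Collect_eq)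
      show "c0 = h (\<gamma> 0)" using L \<gamma> by simp
    qed auto
    ultimately have "(\<lambda>t. (t *\<^sub>R v) \<bullet> g) = (\<lambda>t. 0)" by (rule has_derivative_unique)
    then have "(1 *\<^sub>R v) \<bullet> g = 0" by meson
    then show "v \<in> {v. v \<bullet> g = 0}" by simp
  qed
  show "{v. v \<bullet> g = 0} \<subseteq> tangent_space L y"
  proof
    fix v assume "v \<in> {v. v \<bullet> g = 0}"
    then have v: "v \<bullet> g = 0" by simp
    define P where "P t s = y + t *\<^sub>R v + s *\<^sub>R g" for t s
    \<comment> \<open>On the segment of all s with absolute value at most
      \<open>e * \<bar>t\<bar>\<close> the function \<open>h\<close> crosses the level
      \<open>c0\<close>, since the first order term s |g|^2 decides the sign at both ends.\<close>
    have ex: "\<exists>d>0. \<forall>t. \<bar>t\<bar> < d \<longrightarrow> (\<exists>s. \<bar>s\<bar> \<le> e * \<bar>t\<bar> \<and> P t s \<in> L)" if e: "e > 0" for e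
    proof -
      define M where "M = norm v + e * norm g + 1"
      have M: "M > 0" using e by (simp add: M_def add_nonneg_pos)
      \<comment> \<open>Makes the linearisation error at most half of the first order term at the
        ends of the segment; \<open>M\<close> bounds the distance of its points to y, relative to
        t.\<close>
      define e' where "e' = e * (g \<bullet> g) / (2 * M)"
      have e': "e' > 0" using e g M by (simp add: e'_def)
      obtain d1 where d1: "d1 > 0" "\<And>z. norm (z - y) < d1 \<Longrightarrow> \<bar>h z - h y - (z - y) \<bullet> g\<bar> \<le> e' * norm (z - y)"
        using dh e' unfolding has_derivative_at_alt by (metis real_norm_def)
      obtain d2 where d2: "d2 > 0" "ball y d2 \<subseteq> U" using U openE by blast
      define d where "d = min d1 d2 / M"
      have "\<exists>s. \<bar>s\<bar> \<le> e * \<bar>t\<bar> \<and> P t s \<in> L" if t: "\<bar>t\<bar> < d" for t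
      proof -
        have n: "norm (P t s - y) \<le> \<bar>t\<bar> * M" "norm (P t s - y) < min d1 d2" if "\<bar>s\<bar> \<le> e * \<bar>t\<bar>" for s
        proof -
          have "norm (P t s - y) \<le> \<bar>t\<bar> * norm v + \<bar>s\<bar> * norm g"
            using norm_triangle_ineq[of "t *\<^sub>R v" "s *\<^sub>R g"] by (simp add: P_def add.assoc)
          also have "\<dots> \<le> \<bar>t\<bar> * norm v + (e * \<bar>t\<bar>) * norm g" using that by (intro add_left_mono mult_right_mono) auto
          also have "\<dots> \<le> \<bar>t\<bar> * M" by (simp add: M_def algebra_simps)
          finally show "norm (P t s - y) \<le> \<bar>t\<bar> * M" .
          also have "\<dots> < min d1 d2" using t M by (simp add: d_def pos_less_divide_eq)
          finally show "norm (P t s - y) < min d1 d2" .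
        qed
        have inU: "P t s \<in> U" if "\<bar>s\<bar> \<le> e * \<bar>t\<bar>" for s
          using n(2)[OF that] d2 by (auto simp: dist_norm norm_minus_commute)
        have est: "\<bar>h (P t s) - c0 - s * (g \<bullet> g)\<bar> \<le> e * \<bar>t\<bar> * (g \<bullet> g) / 2" if "\<bar>s\<bar> \<le> e * \<bar>t\<bar>" for s
        proof -
          have "\<bar>h (P t s) - h y - (P t s - y) \<bullet> g\<bar> \<le> e' * norm (P t s - y)"
            using d1(2) n(2)[OF that] by simp
          also have "\<dots> \<le> e' * (\<bar>t\<bar> * M)" using n(1)[OF that] e' by (intro mult_left_mono) auto
          also have "\<dots> = e * \<bar>t\<bar> * (g \<bullet> g) / 2" using M by (simp add: e'_def)
          finally show ?thesis using v L(2) by (simp add: P_def inner_add_left)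
        qed
        have "continuous_on {- (e * \<bar>t\<bar>)..e * \<bar>t\<bar>} (\<lambda>s. h (P t s))"
          using inU by (intro continuous_on_compose2[OF c]) (auto simp: P_def intro!: continuous_intros)
        moreover have "h (P t (- (e * \<bar>t\<bar>))) \<le> c0" "c0 \<le> h (P t (e * \<bar>t\<bar>))"
        proof -
          have nn: "0 \<le> e * \<bar>t\<bar> * (g \<bullet> g)" using e by simp
          show "h (P t (- (e * \<bar>t\<bar>))) \<le> c0" "c0 \<le> h (P t (e * \<bar>t\<bar>))"
            using est[of "- (e * \<bar>t\<bar>)"] est[of "e * \<bar>t\<bar>"] nn e
            by (simp_all only: abs_le_iff minus_mult_left[symmetric] abs_minus_cancel abs_mult abs_abs) auto
        qed
        ultimately obtain s where "s \<ge> - (e * \<bar>t\<bar>)" "s \<le> e * \<bar>t\<bar>" "h (P t s) = c0"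
          using IVT'[of "\<lambda>s. h (P t s)" "- (e * \<bar>t\<bar>)" c0 "e * \<bar>t\<bar>"] e by auto
        then show ?thesis using L(1) inU[of s] by (intro exI[of _ s]) (auto simp: abs_le_iff)
      qed
      moreover have "d > 0" using d1 d2 M by (simp add: d_def)
      ultimately show ?thesis by blast
    qed
    \<comment> \<open>The points found above depend on \<open>e\<close>, whereas one function of t
      must work for all \<open>e\<close>. Taking s within \<open>t\<^sup>2\<close> of the least
      possible absolute value does so: the infimum need not be attained, and the slack is
      o(t).\<close>
    define r where "r t = Inf {\<bar>s\<bar> |s. P t s \<in> L}" for t
    define \<sigma> where "\<sigma> t = (if t \<noteq> 0 \<and> (\<exists>s. P t s \<in> L) then (SOME s. P t s \<in> L \<and> \<bar>s\<bar> \<le> r t + t\<^sup>2) else 0)" for t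
    have \<sigma>: "P t (\<sigma> t) \<in> L \<and> \<bar>\<sigma> t\<bar> \<le> r t + t\<^sup>2" if "t \<noteq> 0" "\<exists>s. P t s \<in> L" for t
    proof -
      have ne: "{\<bar>s\<bar> |s. P t s \<in> L} \<noteq> {}" using that by blast
      have lt: "Inf {\<bar>s\<bar> |s. P t s \<in> L} < r t + t\<^sup>2" using that by (simp add: r_def)
      obtain x where "x \<in> {\<bar>s\<bar> |s. P t s \<in> L}" "x < r t + t\<^sup>2" using cInf_lessD[OF ne lt] by blast
      then have "\<exists>s. P t s \<in> L \<and> \<bar>s\<bar> \<le> r t + t\<^sup>2" by auto
      from someI_ex[OF this] show ?thesis using that by (simp add: \<sigma>_def)
    qed
    \<comment> \<open>Where the line meets no point of \<open>L\<close> the curve is parked at y,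
      because the definition of the tangent space asks for curves that lie in \<open>L\<close> at
      all times.\<close>
    define \<gamma> where "\<gamma> t = (if P t (\<sigma> t) \<in> L then P t (\<sigma> t) else y)" for t
    have yL: "y \<in> L" using L U by blast
    have \<gamma>0: "\<gamma> 0 = y" by (simp add: \<gamma>_def P_def \<sigma>_def)
    have \<sigma>small: "\<exists>d>0. \<forall>t. \<bar>t\<bar> < d \<longrightarrow> t \<noteq> 0 \<longrightarrow> P t (\<sigma> t) \<in> L \<and> \<bar>\<sigma> t\<bar> \<le> e * \<bar>t\<bar>" if e: "e > 0" for e
    proof -
      obtain d where d: "d > 0" "\<And>t. \<bar>t\<bar> < d \<Longrightarrow> \<exists>s. \<bar>s\<bar> \<le> (e / 2) * \<bar>t\<bar> \<and> P t s \<in> L"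
        using ex[of "e / 2"] e by auto
      have "P t (\<sigma> t) \<in> L \<and> \<bar>\<sigma> t\<bar> \<le> e * \<bar>t\<bar>" if t: "\<bar>t\<bar> < min d (e / 2)" "t \<noteq> 0" for t
      proof -
        obtain s where s: "\<bar>s\<bar> \<le> (e / 2) * \<bar>t\<bar>" "P t s \<in> L" using d t by auto
        have "r t \<le> \<bar>s\<bar>" unfolding r_def by (rule cInf_lower) (use s in \<open>auto intro!: bdd_belowI[of _ 0]\<close>)
        moreover have "t\<^sup>2 \<le> (e / 2) * \<bar>t\<bar>"
          using t mult_right_mono[of "\<bar>t\<bar>" "e / 2" "\<bar>t\<bar>"] by (simp add: power2_eq_square flip: abs_mult)
        moreover have "P t (\<sigma> t) \<in> L \<and> \<bar>\<sigma> t\<bar> \<le> r t + t\<^sup>2" using \<sigma>[OF t(2)] s(2) by blast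
        ultimately show ?thesis using s(1) by auto
      qed
      then show ?thesis using d(1) e by (intro exI[of _ "min d (e / 2)"]) auto
    qed
    have "(\<gamma> has_derivative (\<lambda>t. t *\<^sub>R v)) (at 0)"
      unfolding has_derivative_at_alt
    proof (intro conjI allI impI)
      show "bounded_linear (\<lambda>t. t *\<^sub>R v)" by (rule bounded_linear_scaleR_left)
      fix e :: real assume "e > 0"
      then have "e / norm g > 0" using g by simp
      from \<sigma>small[OF this] obtain d where d: "d > 0"
        "\<And>t. \<bar>t\<bar> < d \<Longrightarrow> t \<noteq> 0 \<Longrightarrow> P t (\<sigma> t) \<in> L \<and> \<bar>\<sigma> t\<bar> \<le> (e / norm g) * \<bar>t\<bar>" by blast
      have "norm (\<gamma> t - \<gamma> 0 - (t - 0) *\<^sub>R v) \<le> e * norm (t - 0)" if "norm (t - 0) < d" for t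
      proof (cases "t = 0")
        case False
        then have "P t (\<sigma> t) \<in> L" "\<bar>\<sigma> t\<bar> \<le> (e / norm g) * \<bar>t\<bar>" using d that by auto
        then have "\<bar>\<sigma> t\<bar> * norm g \<le> (e / norm g) * \<bar>t\<bar> * norm g" by (intro mult_right_mono) auto
        moreover have "\<gamma> t - \<gamma> 0 - (t - 0) *\<^sub>R v = \<sigma> t *\<^sub>R g"
          using \<open>P t (\<sigma> t) \<in> L\<close> by (simp add: \<gamma>_def[of t] \<gamma>0 P_def)
        ultimately show ?thesis using g by simp
      qed simp
      then show "\<exists>d>0. \<forall>t. norm (t - 0) < d \<longrightarrow> norm (\<gamma> t - \<gamma> 0 - (t - 0) *\<^sub>R v) \<le> e * norm (t - 0)"
        using d(1) by blast
    qed
    then show "v \<in> tangent_space L y"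
      using \<gamma>0 yL unfolding tangent_space_def has_vector_derivative_def
      by (auto intro!: exI[of _ \<gamma>] simp: \<gamma>_def)
  qed
qed

section \<open>Geometry on the set where the partial gradient does not vanish\<close>

lemma Ck_on_subset: "Ck_on k U g \<Longrightarrow> V \<subseteq> U \<Longrightarrow> Ck_on k V g"
  by (induction k arbitrary: g) (auto intro: continuous_on_subset)

text \<open>The gradient of a partial derivative is a row of the Hessian, whereas
  \<open>hess u X e\<close> is a column; symmetry identifies them.\<close>

lemma hess_Basis:
  assumes "open U" "Ck_on 2 U u" "X \<in> U" "e \<in> Basis"
  shows "hess u X e = grad (\<lambda>Z. grad u Z \<bullet> e) X"
proof -
  have "hess u X e \<bullet> v = grad (\<lambda>Z. grad u Z \<bullet> e) X \<bullet> v" for v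
  proof -
    have "hess u X e \<bullet> v = hess u X v \<bullet> e" by (rule hess_symmetric[OF assms(1-3)])
    also have "\<dots> = v \<bullet> grad (\<lambda>Z. grad u Z \<bullet> e) X" using assms(4) by (simp add: hess_def inner_sum_left_Basis)
    finally show ?thesis by (simp add: inner_commute)
  qed
  then show ?thesis using vector_eq_rdot[of "hess u X e"] by blast
qed

lemma vec_norm_sq: "(norm v)\<^sup>2 = (\<Sum>i\<in>UNIV. (v $ i)\<^sup>2)" for v :: "real ^ 'n"
  by (simp add: norm_vec_def L2_set_def sum_nonneg)

text \<open>The difference is the squared norm of the component of v orthogonal to \<nu>. Both
  \<open>\<S>\<close> and \<open>\<T>\<close> are built from such Cauchy-Schwarz defects.\<close>

lemma inner_unit_le:
  fixes v \<nu> :: "'a::euclidean_space"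
  assumes "norm \<nu> = 1"
  shows "0 \<le> (norm v)\<^sup>2 - (v \<bullet> \<nu>)\<^sup>2" "(norm v)\<^sup>2 - (v \<bullet> \<nu>)\<^sup>2 = 0 \<longleftrightarrow> v = (v \<bullet> \<nu>) *\<^sub>R \<nu>"
proof -
  have "\<nu> \<bullet> \<nu> = 1" using assms by (simp add: dot_square_norm)
  then have *: "(norm v)\<^sup>2 - (v \<bullet> \<nu>)\<^sup>2 = (norm (v - (v \<bullet> \<nu>) *\<^sub>R \<nu>))\<^sup>2"
    unfolding power2_norm_eq_inner by (simp add: inner_diff_left inner_diff_right inner_commute power2_eq_square)
  show "0 \<le> (norm v)\<^sup>2 - (v \<bullet> \<nu>)\<^sup>2" "(norm v)\<^sup>2 - (v \<bullet> \<nu>)\<^sup>2 = 0 \<longleftrightarrow> v = (v \<bullet> \<nu>) *\<^sub>R \<nu>"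
    unfolding * by auto
qed

text \<open>On \<open>\<R>\<close> this is the gradient of |grad_y u|: the derivative of that norm
  in direction v is the inner product of \<open>hess u X v\<close> with (0, \<nu>), and symmetry
  moves the Hessian to the other side.\<close>

definition normal_hess :: "('a::euclidean_space \<times> 'b::euclidean_space \<Rightarrow> real) \<Rightarrow> 'a \<times> 'b \<Rightarrow> 'a \<times> 'b" where
  "normal_hess u X = hess u X (0, level_normal u X)"

locale regular_function =
  fixes \<Omega> :: "((real ^ 'm) \<times> (real ^ 'k)) set" and u :: "(real ^ 'm) \<times> (real ^ 'k) \<Rightarrow> real"
  assumes open_\<Omega>: "open \<Omega>" and C1: "Ck_on 1 \<Omega> u" and C2: "Ck_on 2 (\<Omega> \<inter> {X. grad u X \<noteq> 0}) u"
begin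

lemma diff_u: "X \<in> \<Omega> \<Longrightarrow> u differentiable (at X)" and cont_grad: "continuous_on \<Omega> (grad u)"
  using C1[unfolded Ck_on_1_iff] by auto

lemma grad_y_u: "X \<in> \<Omega> \<Longrightarrow> grad_y u X = snd (grad u X)" and grad_x_u: "X \<in> \<Omega> \<Longrightarrow> grad_x u X = fst (grad u X)"
  by (simp_all add: grad_y_eq grad_x_eq diff_u)

lemma R_subset: "\<R> \<Omega> u \<subseteq> \<Omega>" by (auto simp: \<R>_def)

lemma R_iff: "X \<in> \<R> \<Omega> u \<longleftrightarrow> X \<in> \<Omega> \<and> snd (grad u X) \<noteq> 0"
  by (auto simp: \<R>_def grad_y_u)

lemma open_R: "open (\<R> \<Omega> u)"
proof -
  have "open (\<Omega> \<inter> (\<lambda>X. snd (grad u X)) -` (- {0}))"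
    using cont_grad open_\<Omega> by (intro continuous_open_preimage continuous_intros) auto
  moreover have "\<Omega> \<inter> (\<lambda>X. snd (grad u X)) -` (- {0}) = \<R> \<Omega> u" by (auto simp: R_iff)
  ultimately show ?thesis by simp
qed

lemma R_grad: "X \<in> \<R> \<Omega> u \<Longrightarrow> grad u X \<noteq> 0" by (auto simp: R_iff)

lemma C2_R: "Ck_on 2 (\<R> \<Omega> u) u"
  by (rule Ck_on_subset[OF C2]) (use R_subset R_grad in auto)

lemmas hess_deriv = Ck_on_2_imp(2)[OF C2_R]
lemmas cont_hess = Ck_on_2_imp(4)[OF C2_R]
lemmas hess_sym = hess_symmetric[OF open_R C2_R]
lemmas hess_Basis_R = hess_Basis[OF open_R C2_R]

lemma level_normal_u:
  assumes "X \<in> \<R> \<Omega> u"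
  shows "level_normal u X = snd (grad u X) /\<^sub>R norm (snd (grad u X))" "norm (level_normal u X) = 1"
    "snd (grad u X) = norm (snd (grad u X)) *\<^sub>R level_normal u X"
  using assms by (auto simp: level_normal_def grad_y_u R_iff)

lemma GDERIV_norm_grad_y:
  assumes X: "X \<in> \<R> \<Omega> u"
  shows "GDERIV (\<lambda>Z. norm (snd (grad u Z))) X :> normal_hess u X"
proof -
  have "((\<lambda>Z. snd (grad u Z)) has_derivative (\<lambda>v. snd (hess u X v))) (at X)"
    by (rule has_derivative_snd[OF hess_deriv[OF X]])
  from has_derivative_compose[OF this, of norm, OF has_derivative_norm] X
  have "((\<lambda>Z. norm (snd (grad u Z))) has_derivative (\<lambda>v. snd (hess u X v) \<bullet> sgn (snd (grad u X)))) (at X)"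
    by (simp add: R_iff inner_commute)
  moreover have "snd (hess u X v) \<bullet> sgn (snd (grad u X)) = v \<bullet> normal_hess u X" for v
    using hess_sym[OF X, of v "(0, level_normal u X)"] level_normal_u(1)[OF X]
    by (simp add: normal_hess_def inner_prod_def sgn_div_norm inner_commute)
  ultimately show ?thesis by (simp add: gderiv_def)
qed

lemma grad_norm_grad_y:
  assumes X: "X \<in> \<R> \<Omega> u"
  shows "grad (\<lambda>Z. norm (grad_y u Z)) X = normal_hess u X"
    "grad_x (\<lambda>Z. norm (grad_y u Z)) X = fst (normal_hess u X)"
    "grad_y (\<lambda>Z. norm (grad_y u Z)) X = snd (normal_hess u X)"
proof -
  have G: "GDERIV (\<lambda>Z. norm (grad_y u Z)) X :> normal_hess u X"
    by (rule GDERIV_cong_open[OF GDERIV_norm_grad_y[OF X] open_R X]) (use R_subset grad_y_u in auto)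
  then show "grad (\<lambda>Z. norm (grad_y u Z)) X = normal_hess u X" by (rule grad_eqI)
  then show "grad_x (\<lambda>Z. norm (grad_y u Z)) X = fst (normal_hess u X)"
    "grad_y (\<lambda>Z. norm (grad_y u Z)) X = snd (normal_hess u X)"
    using GDERIV_imp_differentiable[OF G] by (simp_all add: grad_x_eq grad_y_eq)
qed

lemma grad_components:
  assumes X: "X \<in> \<R> \<Omega> u"
  shows "grad (\<lambda>Z. grad_y u Z $ j) X = hess u X (0, axis j 1)"
    "grad_y (\<lambda>Z. grad_x u Z $ i) X = snd (hess u X (axis i 1, 0))"
proof -
  have b: "(0, axis j 1) \<in> (Basis :: ((real ^ 'm) \<times> (real ^ 'k)) set)" "(axis i 1, 0) \<in> (Basis :: ((real ^ 'm) \<times> (real ^ 'k)) set)"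
    by (auto simp: Basis_prod_def Basis_vec_def)
  have d: "(\<lambda>Z. grad u Z \<bullet> e) differentiable (at X)" for e
    unfolding differentiable_def using has_derivative_inner_left[OF hess_deriv[OF X]] by blast
  have y: "grad u Z \<bullet> (0, axis j 1) = grad_y u Z $ j" and x: "grad u Z \<bullet> (axis i 1, 0) = grad_x u Z $ i"
    if "Z \<in> \<R> \<Omega> u" for Z
    using that R_subset by (auto simp: inner_prod_def grad_y_u grad_x_u inner_axis)
  show "grad (\<lambda>Z. grad_y u Z $ j) X = hess u X (0, axis j 1)"
    unfolding hess_Basis_R[OF X b(1)] by (rule grad_cong_open[OF open_R X y[symmetric]])
  have "grad (\<lambda>Z. grad_x u Z $ i) X = hess u X (axis i 1, 0)"
    unfolding hess_Basis_R[OF X b(2)] by (rule grad_cong_open[OF open_R X x[symmetric]])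
  moreover have "(\<lambda>Z. grad_x u Z $ i) differentiable (at X)"
    using GDERIV_cong_open[OF GDERIV_grad[OF d] open_R X x] by (rule GDERIV_imp_differentiable)
  ultimately show "grad_y (\<lambda>Z. grad_x u Z $ i) X = snd (hess u X (axis i 1, 0))"
    by (simp add: grad_y_eq)
qed

text \<open>With v_i the y-gradient of the i-th x-derivative of u, symmetry of the Hessian shows
  that the i-th component of the x-gradient of |grad_y u| is v_i . \<nu>. This exhibits
  \<open>\<S>\<close> as a sum of Cauchy-Schwarz defects, which gives both its sign and the case of
  equality.\<close>

lemma S_eq:
  assumes X: "X \<in> \<R> \<Omega> u"
  shows "\<S> u X = (\<Sum>i\<in>UNIV. (norm (snd (hess u X (axis i 1, 0))))\<^sup>2
    - (snd (hess u X (axis i 1, 0)) \<bullet> level_normal u X)\<^sup>2)"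
proof -
  have "fst (normal_hess u X) $ i = snd (hess u X (axis i 1, 0)) \<bullet> level_normal u X" for i
    using hess_sym[OF X, of "(0, level_normal u X)" "(axis i 1, 0)"]
    by (simp add: normal_hess_def inner_prod_def inner_axis)
  then show ?thesis
    unfolding \<S>_def grad_norm_grad_y[OF X] grad_components[OF X]
    by (simp add: vec_norm_sq sum_subtractf)
qed

lemma S_nonneg: "X \<in> \<R> \<Omega> u \<Longrightarrow> 0 \<le> \<S> u X"
  unfolding S_eq by (intro sum_nonneg inner_unit_le level_normal_u)

lemma S_zero_iff:
  assumes X: "X \<in> \<R> \<Omega> u"
  shows "\<S> u X = 0 \<longleftrightarrow> (\<forall>i. \<exists>c. grad_y (\<lambda>Z. grad_x u Z $ i) X = c *\<^sub>R grad_y u X)"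
proof -
  note n = level_normal_u(2)[OF X]
  have g: "grad_y u X = norm (snd (grad u X)) *\<^sub>R level_normal u X" "norm (snd (grad u X)) \<noteq> 0"
    using X level_normal_u(3)[OF X] R_subset by (auto simp: grad_y_u R_iff)
  have "\<S> u X = 0 \<longleftrightarrow> (\<forall>i. (norm (snd (hess u X (axis i 1, 0))))\<^sup>2
    - (snd (hess u X (axis i 1, 0)) \<bullet> level_normal u X)\<^sup>2 = 0)"
    unfolding S_eq[OF X] using inner_unit_le(1)[OF n] by (subst sum_nonneg_eq_0_iff) (rule finite | blast)+
  also have "\<dots> \<longleftrightarrow> (\<forall>i. \<exists>c. snd (hess u X (axis i 1, 0)) = c *\<^sub>R grad_y u X)"
  proof (intro iff_allI)
    fix i
    let ?v = "snd (hess u X (axis i 1, 0))"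
    show "((norm ?v)\<^sup>2 - (?v \<bullet> level_normal u X)\<^sup>2 = 0) = (\<exists>c. ?v = c *\<^sub>R grad_y u X)"
      unfolding inner_unit_le(2)[OF n]
    proof
      assume "?v = (?v \<bullet> level_normal u X) *\<^sub>R level_normal u X"
      then have "?v = ((?v \<bullet> level_normal u X) / norm (snd (grad u X))) *\<^sub>R grad_y u X" using g by simp
      then show "\<exists>c. ?v = c *\<^sub>R grad_y u X" by blast
    next
      assume "\<exists>c. ?v = c *\<^sub>R grad_y u X"
      then obtain c where c: "?v = (c * norm (snd (grad u X))) *\<^sub>R level_normal u X" using g(1) by auto
      show "?v = (?v \<bullet> level_normal u X) *\<^sub>R level_normal u X"
        unfolding c using n by (simp add: dot_square_norm)
    qed
  qed
  finally show ?thesis unfolding grad_components(2)[OF X] .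
qed

lemma hess_y_sum:
  assumes X: "X \<in> \<R> \<Omega> u"
  shows "(\<Sum>j\<in>UNIV. (y $ j) *\<^sub>R hess u X (0, axis j 1)) = hess u X (0, y)"
proof -
  have "(0, y) = (\<Sum>j\<in>UNIV. (y $ j) *\<^sub>R (0::real ^ 'm, axis j 1 :: real ^ 'k))"
    by (simp add: prod_eq_iff fst_sum snd_sum vec_eq_iff axis_def if_distrib cong: if_cong)
  then show ?thesis by (simp only: linear_sum[OF linear_hess] linear_cmul[OF linear_hess])
qed

lemma T_eq:
  assumes X: "X \<in> \<R> \<Omega> u"
  shows "\<T> u X = - (grad u X \<bullet> normal_hess u X)\<^sup>2 + (\<Sum>j\<in>UNIV. (grad u X \<bullet> hess u X (0, axis j 1))\<^sup>2)"
  unfolding \<T>_def grad_norm_grad_y[OF X] grad_components[OF X] ..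

text \<open>With t_j = grad u . grad u_j, the inner product of grad u with the gradient of w is t .
  \<nu>, so \<open>\<T>\<close> is the Cauchy-Schwarz defect of t.\<close>

lemma T_nonneg: assumes X: "X \<in> \<R> \<Omega> u" shows "0 \<le> \<T> u X"
proof -
  define t :: "real ^ 'k" where "t = (\<chi> j. grad u X \<bullet> hess u X (0, axis j 1))"
  have "normal_hess u X = (\<Sum>j\<in>UNIV. (level_normal u X $ j) *\<^sub>R hess u X (0, axis j 1))"
    unfolding normal_hess_def by (rule hess_y_sum[OF X, symmetric])
  then have "grad u X \<bullet> normal_hess u X = t \<bullet> level_normal u X"
    by (simp add: t_def inner_vec_def inner_sum_right mult.commute)
  then have "\<T> u X = (norm t)\<^sup>2 - (t \<bullet> level_normal u X)\<^sup>2"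
    unfolding T_eq[OF X] vec_norm_sq by (simp add: t_def)
  then show ?thesis using inner_unit_le(1)[OF level_normal_u(2)[OF X]] by simp
qed

text \<open>On the slice of fixed x the map \<open>H\<close> is the Hessian of y \<mapsto> u(x, y),
  and \<open>- N\<close> is the shape operator of its level set. The identity is then the linear
  algebra of the y-block of the Hessian.\<close>

lemma curvature_eq:
  assumes X: "X \<in> \<R> \<Omega> u"
  shows "(\<K> \<Omega> u X)\<^sup>2 * (norm (grad_y u X))\<^sup>2 + (norm (tangential_grad u (\<lambda>Z. norm (grad_y u Z)) X))\<^sup>2
    = (\<Sum>j\<in>UNIV. (norm (snd (hess u X (0, axis j 1))))\<^sup>2) - (norm (snd (normal_hess u X)))\<^sup>2"
proof -
  obtain x y where xy: "X = (x, y)" by (cases X)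
  define w where "w = norm (snd (grad u X))"
  define \<nu> where "\<nu> = level_normal u X"
  define H where "H v = snd (hess u X (0, v))" for v
  define N where "N v = (H v - (H v \<bullet> \<nu>) *\<^sub>R \<nu>) /\<^sub>R w" for v
  define L where "L = regular_level_set \<Omega> u x (u X)"
  have w: "w > 0" using X by (simp add: w_def R_iff)
  have H: "linear H" unfolding H_def
    by (rule linearI) (use linear_add[OF linear_hess, of u X "(0, _)" "(0, _)"] linear_cmul[OF linear_hess, of u X _ "(0, _)"] in simp_all)
  have Hs: "H v \<bullet> z = H z \<bullet> v" for v z
    using hess_sym[OF X, of "(0, v)" "(0, z)"] by (simp add: H_def inner_prod_def)
  have \<nu>: "norm \<nu> = 1" using level_normal_u[OF X] by (simp add: \<nu>_def)
  have LN: "linear N" unfolding N_def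
    by (rule linearI) (simp_all add: linear_add[OF H] linear_cmul[OF H] inner_add_left algebra_simps)
  define U where "U = {z. (x, z) \<in> \<R> \<Omega> u}"
  have U: "open U" "y \<in> U"
  proof -
    have "continuous_on UNIV (\<lambda>z. (x, z))" by (intro continuous_intros)
    from open_vimage[OF open_R this] show "open U" by (simp add: U_def vimage_def)
  qed (use X xy in \<open>simp add: U_def\<close>)
  have gy: "((\<lambda>z. snd (grad u (x, z))) has_derivative H) (at y)"
  proof -
    have "((\<lambda>z. grad u (x, z)) has_derivative (\<lambda>v. hess u X (0, v))) (at y)"
      by (rule has_derivative_compose[where f="\<lambda>z. (x, z)" and g="grad u"])
        (use hess_deriv[OF X] xy in \<open>auto intro!: derivative_eq_intros\<close>)
    from has_derivative_snd[OF this] show ?thesis unfolding H_def[abs_def] .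
  qed
  have dn: "((\<lambda>z. level_normal u (x, z)) has_derivative N) (at y)"
  proof -
    have g0: "snd (grad u (x, y)) \<noteq> 0" using X xy by (simp add: R_iff)
    have nw: "((\<lambda>z. norm (snd (grad u (x, z)))) has_derivative (\<lambda>v. H v \<bullet> \<nu>)) (at y)"
      using has_derivative_compose[OF gy, of norm, OF has_derivative_norm[OF g0]] level_normal_u(1)[OF X] xy
      by (simp add: \<nu>_def sgn_div_norm inner_commute)
    let ?i = "inverse (norm (snd (grad u (x, y))))"
    have iv: "((\<lambda>z. inverse (norm (snd (grad u (x, z))))) has_derivative (\<lambda>v. - (?i * (H v \<bullet> \<nu>) * ?i))) (at y)"
      by (rule Deriv.has_derivative_inverse[OF _ nw]) (use g0 in simp)
    have aux: "inverse w *\<^sub>R h + (- (inverse w * c * inverse w)) *\<^sub>R (w *\<^sub>R \<nu>) = (h - c *\<^sub>R \<nu>) /\<^sub>R w" for c h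
      using w by (simp add: scaleR_diff_right)
    have i: "?i = inverse w" and g: "snd (grad u (x, y)) = w *\<^sub>R \<nu>"
      using level_normal_u(3)[OF X] by (simp_all add: w_def \<nu>_def xy)
    have eq: "(\<lambda>v. ?i *\<^sub>R H v + (- (?i * (H v \<bullet> \<nu>) * ?i)) *\<^sub>R snd (grad u (x, y))) = N"
      unfolding i unfolding g aux N_def[abs_def] ..
    have "((\<lambda>z. inverse (norm (snd (grad u (x, z)))) *\<^sub>R snd (grad u (x, z))) has_derivative N) (at y)"
      using has_derivative_scaleR[OF iv gy] unfolding eq .
    then show ?thesis
      by (rule has_derivative_transform_within_open[OF _ U]) (auto simp: U_def level_normal_u(1))
  qed
  have Tan: "tangent_space L y = {v. v \<bullet> \<nu> = 0}"
  proof -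
    have "tangent_space L y = {v. v \<bullet> snd (grad u X) = 0}"
    proof (rule tangent_space_hypersurface[OF U, of "\<lambda>z. u (x, z)"])
      show "continuous_on U (\<lambda>z. u (x, z))"
      proof (intro continuous_at_imp_continuous_on ballI)
        fix z assume "z \<in> U"
        then have "isCont u (x, z)"
          using diff_u R_subset by (intro differentiable_imp_continuous_within) (auto simp: U_def)
        then show "isCont (\<lambda>z. u (x, z)) z" by (intro isCont_o2[where g=u and f="\<lambda>z. (x, z)"]) (auto intro!: continuous_intros)
      qed
      have "((\<lambda>z. u (x, z)) has_derivative (\<lambda>h. (0, h) \<bullet> grad u X)) (at y)"
        by (rule has_derivative_compose[where f="\<lambda>z. (x, z)" and g=u])
          (use X xy R_subset diff_u in \<open>auto intro!: derivative_eq_intros has_derivative_grad\<close>)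
      then show "GDERIV (\<lambda>z. u (x, z)) y :> snd (grad u X)" by (simp add: gderiv_def inner_prod_def)
      show "snd (grad u X) \<noteq> 0" using X by (simp add: R_iff)
      show "L \<inter> U = {z \<in> U. u (x, z) = u X}"
        by (auto simp: L_def U_def regular_level_set_def level_set_def \<R>_def)
      show "u (x, y) = u X" by (simp add: xy)
    qed
    also have "\<dots> = {v. v \<bullet> \<nu> = 0}"
      using level_normal_u(3)[OF X] w by (metis (no_types, lifting) \<nu>_def inner_scaleR_right mult_eq_0_iff order_less_irrefl w_def)
    finally show ?thesis .
  qed
  have PS: "principal_space L (\<lambda>z. level_normal u (x, z)) y \<kappa> = {v \<in> {v. v \<bullet> \<nu> = 0}. - N v = \<kappa> *\<^sub>R v}" for \<kappa>
  proof -
    \<comment> \<open>\<open>L\<close> is no neighbourhood of y, so a derivative within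
      \<open>L\<close> is not unique as a linear map. Composed with a curve in \<open>L\<close> of
      velocity v it is a derivative on the real line, which fixes its value at v.\<close>
    have NN: "N' v = N v" if v: "v \<in> tangent_space L y" and N': "((\<lambda>z. level_normal u (x, z)) has_derivative N') (at y within L)" for N' v
    proof -
      obtain \<gamma> where \<gamma>: "\<gamma> 0 = y" "\<And>t. \<gamma> t \<in> L" "(\<gamma> has_vector_derivative v) (at (0::real))"
        using v unfolding tangent_space_def by blast
      have "((\<lambda>t. level_normal u (x, \<gamma> t)) has_derivative (\<lambda>t. M (t *\<^sub>R v))) (at 0)"
        if "((\<lambda>z. level_normal u (x, z)) has_derivative M) (at y within L)" for M
      proof (rule has_derivative_in_compose[where g="\<lambda>z. level_normal u (x, z)" and f=\<gamma>
            and g'=M and f'="\<lambda>t. t *\<^sub>R v"])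
        show "(\<gamma> has_derivative (\<lambda>t. t *\<^sub>R v)) (at 0)" using \<gamma>(3) by (simp add: has_vector_derivative_def)
        show "((\<lambda>z. level_normal u (x, z)) has_derivative M) (at (\<gamma> 0) within range \<gamma>)"
          using has_derivative_subset[OF that, of "range \<gamma>"] \<gamma>(1,2) by auto
      qed
      from this[OF N'] this[OF has_derivative_at_withinI[OF dn]]
      have "(\<lambda>t. N' (t *\<^sub>R v)) = (\<lambda>t. N (t *\<^sub>R v))" by (rule has_derivative_unique)
      then have "N' (1 *\<^sub>R v) = N (1 *\<^sub>R v)" by meson
      then show ?thesis by simp
    qed
    show ?thesis
      unfolding principal_space_def Tan[symmetric]
    proof (intro Collect_cong conj_cong refl iffI)
      fix v assume v: "v \<in> tangent_space L y"
      show "- N v = \<kappa> *\<^sub>R v" if "\<exists>N. ((\<lambda>z. level_normal u (x, z)) has_derivative N) (at y within L) \<and> - N v = \<kappa> *\<^sub>R v"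
        using that NN[OF v] by metis
      show "\<exists>N. ((\<lambda>z. level_normal u (x, z)) has_derivative N) (at y within L) \<and> - N v = \<kappa> *\<^sub>R v" if "- N v = \<kappa> *\<^sub>R v"
        using that has_derivative_at_withinI[OF dn, of L] by blast
    qed
  qed
  have "(\<K> \<Omega> u X)\<^sup>2 = (\<Sum>\<kappa>\<in>{\<kappa>. \<exists>v\<in>{v. v \<bullet> \<nu> = 0}. - N v = \<kappa> *\<^sub>R v \<and> v \<noteq> 0}.
      real (dim {v \<in> {v. v \<bullet> \<nu> = 0}. - N v = \<kappa> *\<^sub>R v}) * \<kappa>\<^sup>2)"
  proof -
    have "principal_curvatures L (\<lambda>z. level_normal u (x, z)) y = {\<kappa>. \<exists>v\<in>{v. v \<bullet> \<nu> = 0}. - N v = \<kappa> *\<^sub>R v \<and> v \<noteq> 0}"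
      unfolding principal_curvatures_def PS by auto
    then show ?thesis
      unfolding \<K>_def curvature_norm_def xy fst_conv snd_conv L_def[symmetric, unfolded xy] PS
      by (simp add: sum_nonneg)
  qed
  moreover have "tangential_grad u (\<lambda>Z. norm (grad_y u Z)) X = H \<nu> - (H \<nu> \<bullet> \<nu>) *\<^sub>R \<nu>"
    by (simp add: tangential_grad_def grad_norm_grad_y[OF X] H_def normal_hess_def \<nu>_def)
  moreover have "norm (grad_y u X) = w" using X R_subset by (auto simp: w_def grad_y_u)
  moreover have "(\<Sum>e\<in>Basis. (norm (H e))\<^sup>2) = (\<Sum>j\<in>UNIV. (norm (snd (hess u X (0, axis j 1))))\<^sup>2)"
  proof -
    have B: "(Basis :: (real ^ 'k) set) = range (\<lambda>j. axis j 1)" by (auto simp: Basis_vec_def)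
    have "inj (\<lambda>j. axis j 1 :: real ^ 'k)" by (auto intro!: injI simp: axis_eq_axis)
    from sum.reindex[OF this, of "\<lambda>e. (norm (H e))\<^sup>2"] show ?thesis
      unfolding B by (simp add: H_def o_def)
  qed
  ultimately show ?thesis
    using shape_operator_identity[OF H Hs \<nu> w N_def] by (simp add: H_def normal_hess_def \<nu>_def)
qed

text \<open>The columns \<open>hess u X (0, axis j 1)\<close> split into x- and y-parts. The y-parts
  give curvature and tangential gradient on the slice; the x-parts are mixed derivatives, whose
  squares combine with the x-gradient of w to \<open>\<S>\<close>.\<close>

lemma sternberg_zumbrun:
  assumes X: "X \<in> \<R> \<Omega> u"
  shows "\<S> u X + (\<K> \<Omega> u X)\<^sup>2 * (norm (grad_y u X))\<^sup>2 + (norm (tangential_grad u (\<lambda>Z. norm (grad_y u Z)) X))\<^sup>2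
    = (\<Sum>j\<in>UNIV. (norm (hess u X (0, axis j 1)))\<^sup>2) - (norm (normal_hess u X))\<^sup>2"
proof -
  have n: "(norm v)\<^sup>2 = (norm (fst v))\<^sup>2 + (norm (snd v))\<^sup>2" for v :: "(real ^ 'm) \<times> (real ^ 'k)"
    by (simp add: norm_prod_def)
  have "(\<Sum>j\<in>UNIV. (norm (fst (hess u X (0, axis j 1))))\<^sup>2) = (\<Sum>j\<in>UNIV. \<Sum>i\<in>UNIV. (snd (hess u X (axis i 1, 0)) $ j)\<^sup>2)"
  proof -
    have "fst (hess u X (0, axis j 1)) $ i = snd (hess u X (axis i 1, 0)) $ j" for i j
      using hess_sym[OF X, of "(0, axis j 1)" "(axis i 1, 0)"] by (simp add: inner_prod_def inner_axis)
    then show ?thesis by (simp add: vec_norm_sq)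
  qed
  also have "\<dots> = (\<Sum>i\<in>UNIV. \<Sum>j\<in>UNIV. (snd (hess u X (axis i 1, 0)) $ j)\<^sup>2)" by (rule sum.swap)
  finally have "(\<Sum>j\<in>UNIV. (norm (fst (hess u X (0, axis j 1))))\<^sup>2) - (norm (fst (normal_hess u X)))\<^sup>2 = \<S> u X"
    unfolding \<S>_def grad_norm_grad_y[OF X] grad_components[OF X] by simp
  then show ?thesis
    using curvature_eq[OF X] by (simp add: n[of "hess u X _"] n[of "normal_hess u X"] sum.distrib)
qed

end

section \<open>Passing to the limit in the stability inequality\<close>

text \<open>Used to obtain integrability of the Hessian energy on the whole regular set from bounds
  on its cut-off versions that are uniform in the cutoff.\<close>

lemma integrable_Fatou:
  fixes G :: "nat \<Rightarrow> 'x \<Rightarrow> real"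
  assumes G: "\<And>n. integrable M (G n)" "\<And>n. AE X in M. 0 \<le> G n X" "\<And>n. integral\<^sup>L M (G n) \<le> C"
    and lim: "AE X in M. (\<lambda>n. G n X) \<longlonglongrightarrow> g X" and g: "g \<in> borel_measurable M"
  shows "integrable M g"
proof (rule integrableI_bounded[OF g])
  have "AE X in M. \<forall>n. 0 \<le> G n X" using G(2) by (simp add: AE_all_countable)
  with lim have "AE X in M. ennreal (norm (g X)) = liminf (\<lambda>n. ennreal (G n X))"
  proof eventually_elim
    case (elim X)
    have "0 \<le> g X" using elim by (intro LIMSEQ_le_const) auto
    moreover have "(\<lambda>n. ennreal (G n X)) \<longlonglongrightarrow> ennreal (g X)" using elim by (intro tendsto_ennrealI) auto
    ultimately show ?case using lim_imp_Liminf[OF sequentially_bot] by fastforce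
  qed
  then have "(\<integral>\<^sup>+X. ennreal (norm (g X)) \<partial>M) = (\<integral>\<^sup>+X. liminf (\<lambda>n. ennreal (G n X)) \<partial>M)"
    by (rule nn_integral_cong_AE)
  also have "\<dots> \<le> liminf (\<lambda>n. \<integral>\<^sup>+X. ennreal (G n X) \<partial>M)"
    using G(1) by (intro nn_integral_liminf) (auto dest!: borel_measurable_integrable)
  also have "\<dots> \<le> liminf (\<lambda>n. ennreal C)"
  proof (rule Liminf_mono, rule always_eventually, rule allI)
    fix n
    have "(\<integral>\<^sup>+X. ennreal (G n X) \<partial>M) = ennreal (integral\<^sup>L M (G n))"
      by (rule nn_integral_eq_integral[OF G(1,2)])
    then show "(\<integral>\<^sup>+X. ennreal (G n X) \<partial>M) \<le> ennreal C" using G(3) by (simp add: ennreal_leI)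
  qed
  also have "\<dots> < \<infinity>" by (simp add: Liminf_const)
  finally show "(\<integral>\<^sup>+X. ennreal (norm (g X)) \<partial>M) < \<infinity>" .
qed

text \<open>
  Here \<open>a\<^sub>n = \<rho>\<^sub>n(w)\<close> and \<open>d\<^sub>n = w \<rho>\<^sub>n'(w)\<close> for a cutoff \<open>\<rho>\<^sub>n\<close>, while \<open>E\<close>, \<open>W\<close>, \<open>Z\<close>, \<open>P\<close> stand for
  \<open>\<Sum>\<^sub>j \<langle>\<B>\<nabla>u\<^sub>j, \<nabla>u\<^sub>j\<rangle>\<close>, \<open>\<langle>\<B>\<nabla>w, \<nabla>w\<rangle>\<close>, \<open>\<langle>\<B>\<nabla>w, \<nabla>\<phi>\<rangle>\<close>, \<open>\<langle>\<B>\<nabla>\<phi>, \<nabla>\<phi>\<rangle>\<close> and \<open>c\<close> for \<open>f\<^sub>u\<close>. The assumption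
  \<open>lin\<close> alone bounds the energy \<open>\<phi>\<^sup>2 E\<close> by absorption, which makes the error terms of the difference
  of \<open>stab\<close> and \<open>lin\<close> vanish in the limit.
\<close>

lemma poincare_limit:
  fixes \<phi> w c E W Z P :: "'x \<Rightarrow> real" and a d :: "nat \<Rightarrow> 'x \<Rightarrow> real"
  assumes [measurable]: "\<phi> \<in> borel_measurable M" "w \<in> borel_measurable M"
      "E \<in> borel_measurable M" "W \<in> borel_measurable M" "Z \<in> borel_measurable M" "P \<in> borel_measurable M"
      "\<And>n. a n \<in> borel_measurable M" "\<And>n. d n \<in> borel_measurable M"
    and a: "\<And>n X. X \<in> space M \<Longrightarrow> 0 \<le> a n X \<and> a n X \<le> 1" "\<And>X. X \<in> space M \<Longrightarrow> (\<lambda>n. a n X) \<longlonglongrightarrow> 1"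
    and d: "\<And>n X. X \<in> space M \<Longrightarrow> 0 \<le> d n X \<and> d n X \<le> 2" "\<And>X. X \<in> space M \<Longrightarrow> (\<lambda>n. d n X) \<longlonglongrightarrow> 0"
      "\<And>n X. X \<in> space M \<Longrightarrow> a n X = 0 \<Longrightarrow> d n X = 0"
    and form: "AE X in M. 0 \<le> W X \<and> W X \<le> E X \<and> (\<forall>s t. 0 \<le> s\<^sup>2 * W X + 2 * s * t * Z X + t\<^sup>2 * P X)"
    and int: "integrable M (\<lambda>X. (w X)\<^sup>2 * P X)" "integrable M (\<lambda>X. c X * (w X)\<^sup>2 * (\<phi> X)\<^sup>2)"
      "\<And>n. integrable M (\<lambda>X. (if a n X = 0 then 0 else (\<phi> X)\<^sup>2 * E X))"
    and lin: "\<And>n. (LINT X|M. (a n X)\<^sup>2 * (\<phi> X)\<^sup>2 * E X + 2 * a n X * d n X * (\<phi> X)\<^sup>2 * W X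
        + 2 * w X * (a n X)\<^sup>2 * \<phi> X * Z X) = (LINT X|M. c X * (w X)\<^sup>2 * (\<phi> X)\<^sup>2 * (a n X)\<^sup>2)"
    and stab: "\<And>n. 0 \<le> (LINT X|M. (a n X + d n X)\<^sup>2 * (\<phi> X)\<^sup>2 * W X
        + 2 * (a n X + d n X) * w X * a n X * \<phi> X * Z X + (w X)\<^sup>2 * (a n X)\<^sup>2 * P X
        - c X * (w X)\<^sup>2 * (\<phi> X)\<^sup>2 * (a n X)\<^sup>2)"
  shows "integrable M (\<lambda>X. (\<phi> X)\<^sup>2 * (E X - W X))"
    and "(LINT X|M. (\<phi> X)\<^sup>2 * (E X - W X)) \<le> (LINT X|M. (w X)\<^sup>2 * P X)"
proof -
  have P0: "0 \<le> P X" if "\<forall>s t. 0 \<le> s\<^sup>2 * W X + 2 * s * t * Z X + t\<^sup>2 * P X" for X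
    using that[rule_format, of 0 1] by simp
  \<comment> \<open>Nonnegativity of the quadratic form at \<open>(\<phi> X, w X)\<close> and at
    \<open>(\<phi> X, - w X)\<close>.\<close>
  have ZZ: "\<bar>2 * w X * \<phi> X * Z X\<bar> \<le> (\<phi> X)\<^sup>2 * W X + (w X)\<^sup>2 * P X"
    if "\<forall>s t. 0 \<le> s\<^sup>2 * W X + 2 * s * t * Z X + t\<^sup>2 * P X" for X
    using that[rule_format, of "\<phi> X" "w X"] that[rule_format, of "\<phi> X" "- w X"]
    by (simp add: abs_le_iff algebra_simps)
  have a2: "(a n X)\<^sup>2 \<le> 1" if "X \<in> space M" for n X using a(1)[OF that] by (simp add: power_le_one)
  note [measurable] = borel_measurable_integrable[OF int(2)]
  let ?I = "\<lambda>n X. if a n X = 0 then 0 else (\<phi> X)\<^sup>2 * E X"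
  let ?Q = "\<lambda>X. (w X)\<^sup>2 * P X"
  have i1: "integrable M (\<lambda>X. (a n X)\<^sup>2 * (\<phi> X)\<^sup>2 * E X)" for n
  proof (rule Bochner_Integration.integrable_bound[OF int(3)[of n]])
    show "AE X in M. norm ((a n X)\<^sup>2 * (\<phi> X)\<^sup>2 * E X) \<le> norm (?I n X)"
      using form AE_space
      by eventually_elim (use a2 in \<open>auto simp: abs_mult mult.assoc intro!: mult_left_le_one_le\<close>)
  qed measurable
  have i2: "integrable M (\<lambda>X. a n X * d n X * (\<phi> X)\<^sup>2 * W X)" for n
  proof (rule Bochner_Integration.integrable_bound[OF integrable_mult_right[OF int(3)[of n], of 2]])
    show "AE X in M. norm (a n X * d n X * (\<phi> X)\<^sup>2 * W X) \<le> norm (2 * ?I n X)"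
      using form AE_space
    proof eventually_elim
      case (elim X)
      have "(a n X * d n X) * ((\<phi> X)\<^sup>2 * W X) \<le> (1 * 2) * ((\<phi> X)\<^sup>2 * E X)"
        using elim a(1)[of X n] d(1)[of X n] by (intro mult_mono) auto
      then show ?case using elim a(1)[of X n] d(1)[of X n] by (auto simp: abs_mult mult.assoc)
    qed
  qed measurable
  have i3: "integrable M (\<lambda>X. (d n X)\<^sup>2 * (\<phi> X)\<^sup>2 * W X)" for n
  proof (rule Bochner_Integration.integrable_bound[OF integrable_mult_right[OF int(3)[of n], of 4]])
    show "AE X in M. norm ((d n X)\<^sup>2 * (\<phi> X)\<^sup>2 * W X) \<le> norm (4 * ?I n X)"
      using form AE_space
    proof eventually_elim
      case (elim X)
      have "(d n X * d n X) * ((\<phi> X)\<^sup>2 * W X) \<le> (2 * 2) * ((\<phi> X)\<^sup>2 * E X)"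
        using elim d(1)[of X n] by (intro mult_mono) auto
      then show ?case using elim d(1)[of X n] d(3)[of X n] by (auto simp: abs_mult mult.assoc power2_eq_square)
    qed
  qed measurable
  have i4: "integrable M (\<lambda>X. k X * a n X * w X * \<phi> X * Z X)"
    if k: "\<And>X. X \<in> space M \<Longrightarrow> 0 \<le> k X \<and> k X \<le> 3" and [measurable]: "k \<in> borel_measurable M" for k n
  proof (rule Bochner_Integration.integrable_bound[OF Bochner_Integration.integrable_add[OF
        integrable_mult_right[OF int(3)[of n], of 3] integrable_mult_right[OF int(1), of 3]]])
    show "AE X in M. norm (k X * a n X * w X * \<phi> X * Z X) \<le> norm (3 * ?I n X + 3 * ?Q X)"
      using form AE_space
    proof eventually_elim
      case (elim X)
      show ?case
      proof (cases "a n X = 0")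
        case False
        have "\<bar>w X * \<phi> X * Z X\<bar> \<le> (\<phi> X)\<^sup>2 * W X + ?Q X" using ZZ[of X] elim by simp
        also have "\<dots> \<le> (\<phi> X)\<^sup>2 * E X + ?Q X" using elim by (intro add_right_mono mult_left_mono) auto
        finally have "(k X * a n X) * \<bar>w X * \<phi> X * Z X\<bar> \<le> (3 * 1) * ((\<phi> X)\<^sup>2 * E X + ?Q X)"
          using elim a(1)[of X n] k[of X] by (intro mult_mono) auto
        then show ?thesis using False elim a(1)[of X n] k[of X] by (simp add: abs_mult mult.assoc)
      qed simp
    qed
  qed measurable
  have i5: "integrable M (\<lambda>X. (a n X)\<^sup>2 * ?Q X)" for n
  proof (rule Bochner_Integration.integrable_bound[OF int(1)])
    show "AE X in M. norm ((a n X)\<^sup>2 * ?Q X) \<le> norm (?Q X)"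
      using form AE_space
      by eventually_elim (use a2 in \<open>auto simp: abs_mult mult.assoc intro!: mult_left_le_one_le\<close>)
  qed measurable
  have i6: "integrable M (\<lambda>X. c X * (w X)\<^sup>2 * (\<phi> X)\<^sup>2 * (a n X)\<^sup>2)" for n
  proof (rule Bochner_Integration.integrable_bound[OF int(2)])
    show "AE X in M. norm (c X * (w X)\<^sup>2 * (\<phi> X)\<^sup>2 * (a n X)\<^sup>2) \<le> norm (c X * (w X)\<^sup>2 * (\<phi> X)\<^sup>2)"
      using AE_space
      by eventually_elim (use a2 in \<open>auto simp: abs_mult mult.assoc intro!: mult_left_mono mult_left_le\<close>)
  qed measurable
  have i7: "integrable M (\<lambda>X. (a n X)\<^sup>2 * w X * \<phi> X * Z X)" "integrable M (\<lambda>X. d n X * a n X * w X * \<phi> X * Z X)"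
    "integrable M (\<lambda>X. (a n X + d n X) * a n X * w X * \<phi> X * Z X)" for n
  proof -
    show "integrable M (\<lambda>X. d n X * a n X * w X * \<phi> X * Z X)"
    proof (rule i4)
      show "0 \<le> d n X \<and> d n X \<le> 3" if "X \<in> space M" for X
        using d(1)[OF that, of n] by linarith
    qed measurable
    show "integrable M (\<lambda>X. (a n X)\<^sup>2 * w X * \<phi> X * Z X)"
    proof -
      have "0 \<le> a n X \<and> a n X \<le> 3" if "X \<in> space M" for X
        using a(1)[OF that, of n] by linarith
      from i4[of "a n" n, OF this] show ?thesis by (simp add: power2_eq_square)
    qed
    show "integrable M (\<lambda>X. (a n X + d n X) * a n X * w X * \<phi> X * Z X)"
    proof (rule i4)
      show "0 \<le> a n X + d n X \<and> a n X + d n X \<le> 3" if "X \<in> space M" for X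
        using a(1)[OF that, of n] d(1)[OF that, of n] by linarith
    qed measurable
  qed
  have L: "integrable M (\<lambda>X. (a n X)\<^sup>2 * (\<phi> X)\<^sup>2 * E X + 2 * a n X * d n X * (\<phi> X)\<^sup>2 * W X
        + 2 * w X * (a n X)\<^sup>2 * \<phi> X * Z X)" for n
  proof -
    have "integrable M (\<lambda>X. (a n X)\<^sup>2 * (\<phi> X)\<^sup>2 * E X + 2 * (a n X * d n X * (\<phi> X)\<^sup>2 * W X)
        + 2 * ((a n X)\<^sup>2 * w X * \<phi> X * Z X))"
      by (intro Bochner_Integration.integrable_add integrable_mult_right i1 i2 i7)
    then show ?thesis by (simp add: mult_ac)
  qed
  have S: "integrable M (\<lambda>X. (a n X + d n X)\<^sup>2 * (\<phi> X)\<^sup>2 * W X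
        + 2 * (a n X + d n X) * w X * a n X * \<phi> X * Z X + (w X)\<^sup>2 * (a n X)\<^sup>2 * P X
        - c X * (w X)\<^sup>2 * (\<phi> X)\<^sup>2 * (a n X)\<^sup>2)" for n
  proof -
    have "integrable M (\<lambda>X. (a n X)\<^sup>2 * (\<phi> X)\<^sup>2 * W X)"
    proof (rule Bochner_Integration.integrable_bound[OF i1[of n]])
      show "AE X in M. norm ((a n X)\<^sup>2 * (\<phi> X)\<^sup>2 * W X) \<le> norm ((a n X)\<^sup>2 * (\<phi> X)\<^sup>2 * E X)"
        using form by eventually_elim (auto simp: abs_mult intro!: mult_left_mono)
    qed measurable
    then have "integrable M (\<lambda>X. ((a n X)\<^sup>2 * (\<phi> X)\<^sup>2 * W X + 2 * (a n X * d n X * (\<phi> X)\<^sup>2 * W X) + (d n X)\<^sup>2 * (\<phi> X)\<^sup>2 * W X)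
        + 2 * ((a n X + d n X) * a n X * w X * \<phi> X * Z X) + (a n X)\<^sup>2 * ((w X)\<^sup>2 * P X)
        - c X * (w X)\<^sup>2 * (\<phi> X)\<^sup>2 * (a n X)\<^sup>2)"
      by (intro Bochner_Integration.integrable_add Bochner_Integration.integrable_diff integrable_mult_right i2 i3 i5 i6 i7)
    then show ?thesis by (simp add: algebra_simps power2_eq_square)
  qed
  define C where "C = (LINT X|M. \<bar>c X * (w X)\<^sup>2 * (\<phi> X)\<^sup>2\<bar>) + 2 * (LINT X|M. ?Q X)"
  have energy: "integrable M (\<lambda>X. (\<phi> X)\<^sup>2 * E X)"
  proof (rule integrable_Fatou[where G="\<lambda>n X. (a n X)\<^sup>2 * (\<phi> X)\<^sup>2 * E X" and C="2 * C"])
    show "AE X in M. 0 \<le> (a n X)\<^sup>2 * (\<phi> X)\<^sup>2 * E X" for n using form by eventually_elim auto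
    show "AE X in M. (\<lambda>n. (a n X)\<^sup>2 * (\<phi> X)\<^sup>2 * E X) \<longlonglongrightarrow> (\<phi> X)\<^sup>2 * E X"
      using AE_space by eventually_elim (auto intro!: tendsto_eq_intros a)
    show "(LINT X|M. (a n X)\<^sup>2 * (\<phi> X)\<^sup>2 * E X) \<le> 2 * C" for n
    proof -
      have "(LINT X|M. (1 / 2) * ((a n X)\<^sup>2 * (\<phi> X)\<^sup>2 * E X)) \<le>
        (LINT X|M. ((a n X)\<^sup>2 * (\<phi> X)\<^sup>2 * E X + 2 * a n X * d n X * (\<phi> X)\<^sup>2 * W X
          + 2 * w X * (a n X)\<^sup>2 * \<phi> X * Z X) + 2 * ((a n X)\<^sup>2 * ?Q X))"
      proof (rule integral_mono_AE)
        show "AE X in M. (1 / 2) * ((a n X)\<^sup>2 * (\<phi> X)\<^sup>2 * E X) \<le>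
          ((a n X)\<^sup>2 * (\<phi> X)\<^sup>2 * E X + 2 * a n X * d n X * (\<phi> X)\<^sup>2 * W X
          + 2 * w X * (a n X)\<^sup>2 * \<phi> X * Z X) + 2 * ((a n X)\<^sup>2 * ?Q X)" using form AE_space
        proof eventually_elim
          case (elim X)
          \<comment> \<open>Evaluation at \<open>(\<phi> X, 2 * w X)\<close>: half of this
            inequality cancels the whole cross term of \<open>lin\<close> and costs only half of
            \<open>W\<close>, hence at most half of \<open>E\<close>.\<close>
          have "0 \<le> (\<phi> X)\<^sup>2 * W X + 2 * \<phi> X * (2 * w X) * Z X + (2 * w X)\<^sup>2 * P X" using elim by blast
          then have "0 \<le> (a n X)\<^sup>2 * ((\<phi> X)\<^sup>2 * W X + 2 * \<phi> X * (2 * w X) * Z X + (2 * w X)\<^sup>2 * P X)" by simp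
          moreover have "(a n X)\<^sup>2 * (\<phi> X)\<^sup>2 * W X \<le> (a n X)\<^sup>2 * (\<phi> X)\<^sup>2 * E X" using elim by (intro mult_left_mono) auto
          moreover have "0 \<le> 2 * a n X * d n X * (\<phi> X)\<^sup>2 * W X" using elim a(1)[of X n] d(1)[of X n] by simp
          ultimately show ?case by (simp add: algebra_simps power2_eq_square)
        qed
      qed (intro integrable_mult_right i1 Bochner_Integration.integrable_add L i5)+
      also have "\<dots> = (LINT X|M. c X * (w X)\<^sup>2 * (\<phi> X)\<^sup>2 * (a n X)\<^sup>2) + 2 * (LINT X|M. (a n X)\<^sup>2 * ?Q X)"
        by (subst Bochner_Integration.integral_add[OF L integrable_mult_right[OF i5]]) (simp add: lin)
      also have "\<dots> \<le> C"
      proof -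
        have "(LINT X|M. c X * (w X)\<^sup>2 * (\<phi> X)\<^sup>2 * (a n X)\<^sup>2) \<le> (LINT X|M. \<bar>c X * (w X)\<^sup>2 * (\<phi> X)\<^sup>2\<bar>)"
        proof (rule integral_mono_AE[OF i6 integrable_abs[OF int(2)]])
          show "AE X in M. c X * (w X)\<^sup>2 * (\<phi> X)\<^sup>2 * (a n X)\<^sup>2 \<le> \<bar>c X * (w X)\<^sup>2 * (\<phi> X)\<^sup>2\<bar>"
            using AE_space
          proof eventually_elim
            case (elim X)
            have "c X * (w X)\<^sup>2 * (\<phi> X)\<^sup>2 * (a n X)\<^sup>2 \<le> \<bar>c X * (w X)\<^sup>2 * (\<phi> X)\<^sup>2\<bar> * (a n X)\<^sup>2"
              by (intro mult_right_mono) auto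
            also have "\<dots> \<le> \<bar>c X * (w X)\<^sup>2 * (\<phi> X)\<^sup>2\<bar>" using a2[OF elim] by (intro mult_left_le) auto
            finally show ?case .
          qed
        qed
        moreover have "(LINT X|M. (a n X)\<^sup>2 * ?Q X) \<le> (LINT X|M. ?Q X)"
        proof (rule integral_mono_AE[OF i5 int(1)])
          show "AE X in M. (a n X)\<^sup>2 * ?Q X \<le> ?Q X" using form AE_space
            by eventually_elim (use a2 P0 in \<open>auto intro!: mult_left_le_one_le\<close>)
        qed
        ultimately show ?thesis by (simp add: C_def)
      qed
      finally show ?thesis by simp
    qed
  qed (intro i1, measurable)
  have iW: "integrable M (\<lambda>X. (\<phi> X)\<^sup>2 * W X)"
  proof (rule Bochner_Integration.integrable_bound[OF energy])
    show "AE X in M. norm ((\<phi> X)\<^sup>2 * W X) \<le> norm ((\<phi> X)\<^sup>2 * E X)"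
      using form by eventually_elim (auto simp: abs_mult intro!: mult_left_mono)
  qed measurable
  show EW: "integrable M (\<lambda>X. (\<phi> X)\<^sup>2 * (E X - W X))"
    using Bochner_Integration.integrable_diff[OF energy iW] by (simp add: algebra_simps)
  \<comment> \<open>The integrand of \<open>stab\<close> minus that of \<open>lin\<close>. Besides
    the terms with \<open>c\<close>, also the term \<open>2 * a * d\<close> with \<open>W\<close>
    and the part of the cross term free of \<open>d\<close> cancel, so every error term carries a
    factor \<open>d n X\<close>.\<close>
  let ?R = "\<lambda>n X. - ((a n X)\<^sup>2 * (\<phi> X)\<^sup>2 * (E X - W X)) + (d n X)\<^sup>2 * (\<phi> X)\<^sup>2 * W X
      + 2 * (d n X * a n X * w X * \<phi> X * Z X) + (a n X)\<^sup>2 * ?Q X"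
  have nonneg: "0 \<le> (LINT X|M. ?R n X)" for n
  proof -
    have "(LINT X|M. ?R n X) = (LINT X|M. ((a n X + d n X)\<^sup>2 * (\<phi> X)\<^sup>2 * W X
        + 2 * (a n X + d n X) * w X * a n X * \<phi> X * Z X + (w X)\<^sup>2 * (a n X)\<^sup>2 * P X
        - c X * (w X)\<^sup>2 * (\<phi> X)\<^sup>2 * (a n X)\<^sup>2) - (((a n X)\<^sup>2 * (\<phi> X)\<^sup>2 * E X + 2 * a n X * d n X * (\<phi> X)\<^sup>2 * W X
        + 2 * w X * (a n X)\<^sup>2 * \<phi> X * Z X) - c X * (w X)\<^sup>2 * (\<phi> X)\<^sup>2 * (a n X)\<^sup>2))"
      by (intro Bochner_Integration.integral_cong refl) (simp add: algebra_simps power2_eq_square)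
    also have "\<dots> = (LINT X|M. (a n X + d n X)\<^sup>2 * (\<phi> X)\<^sup>2 * W X
        + 2 * (a n X + d n X) * w X * a n X * \<phi> X * Z X + (w X)\<^sup>2 * (a n X)\<^sup>2 * P X
        - c X * (w X)\<^sup>2 * (\<phi> X)\<^sup>2 * (a n X)\<^sup>2)"
      by (simp only: Bochner_Integration.integral_diff[OF S Bochner_Integration.integrable_diff[OF L i6]]
          Bochner_Integration.integral_diff[OF L i6] lin diff_self diff_zero)
    finally show ?thesis using stab[of n] by simp
  qed
  have "(\<lambda>n. LINT X|M. ?R n X) \<longlonglongrightarrow> (LINT X|M. - ((\<phi> X)\<^sup>2 * (E X - W X)) + ?Q X)"
  proof (rule integral_dominated_convergence[where w="\<lambda>X. 7 * ((\<phi> X)\<^sup>2 * E X) + 3 * ?Q X"])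
    \<comment> \<open>The weights add up the four estimates below: 7 = 1 + 4 + 2 and 3 = 2 + 1,
      where 2 and 4 come from \<open>d \<le> 2\<close> and its square.\<close>
    show "integrable M (\<lambda>X. 7 * ((\<phi> X)\<^sup>2 * E X) + 3 * ?Q X)"
      by (intro Bochner_Integration.integrable_add integrable_mult_right energy int(1))
    show "AE X in M. (\<lambda>n. ?R n X) \<longlonglongrightarrow> - ((\<phi> X)\<^sup>2 * (E X - W X)) + ?Q X"
      using AE_space by eventually_elim (auto intro!: tendsto_eq_intros a d)
    show "AE X in M. norm (?R n X) \<le> 7 * ((\<phi> X)\<^sup>2 * E X) + 3 * ?Q X" for n
      using form AE_space
    proof eventually_elim
      case (elim X)
      note an = a(1)[OF elim(2), of n] and dn = d(1)[OF elim(2), of n]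
      have 1: "\<bar>(a n X)\<^sup>2 * (\<phi> X)\<^sup>2 * (E X - W X)\<bar> \<le> (\<phi> X)\<^sup>2 * E X"
      proof -
        have "(a n X)\<^sup>2 * ((\<phi> X)\<^sup>2 * (E X - W X)) \<le> 1 * ((\<phi> X)\<^sup>2 * E X)"
          using a2[OF elim(2), of n] elim by (intro mult_mono) auto
        then show ?thesis using elim by (simp add: abs_mult mult.assoc)
      qed
      have 2: "\<bar>(d n X)\<^sup>2 * (\<phi> X)\<^sup>2 * W X\<bar> \<le> 4 * ((\<phi> X)\<^sup>2 * E X)"
      proof -
        have "(d n X * d n X) * ((\<phi> X)\<^sup>2 * W X) \<le> (2 * 2) * ((\<phi> X)\<^sup>2 * E X)"
          using elim dn by (intro mult_mono) auto
        then show ?thesis using elim by (simp add: abs_mult mult.assoc power2_eq_square)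
      qed
      have 3: "\<bar>2 * (d n X * a n X * w X * \<phi> X * Z X)\<bar> \<le> 2 * ((\<phi> X)\<^sup>2 * E X + ?Q X)"
      proof -
        have "\<bar>2 * w X * \<phi> X * Z X\<bar> \<le> (\<phi> X)\<^sup>2 * W X + ?Q X" using ZZ[of X] elim by simp
        also have "\<dots> \<le> (\<phi> X)\<^sup>2 * E X + ?Q X" using elim by (intro add_right_mono mult_left_mono) auto
        finally have "(d n X * a n X) * \<bar>2 * w X * \<phi> X * Z X\<bar> \<le> (2 * 1) * ((\<phi> X)\<^sup>2 * E X + ?Q X)"
          using an dn by (intro mult_mono) auto
        then show ?thesis using an dn by (simp add: abs_mult mult_ac)
      qed
      have 4: "\<bar>(a n X)\<^sup>2 * ?Q X\<bar> \<le> ?Q X"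
        using a2[OF elim(2), of n] P0[of X] elim by (auto simp: abs_mult intro!: mult_left_le_one_le)
      have "\<bar>- x + y + z + v\<bar> \<le> 7 * e + 3 * q"
        if "\<bar>x::real\<bar> \<le> e" "\<bar>y\<bar> \<le> 4 * e" "\<bar>z\<bar> \<le> 2 * (e + q)" "\<bar>v\<bar> \<le> q" for x y z v e q :: real
        using that by (auto simp: abs_le_iff)
      from this[OF 1 2 3 4] show ?case unfolding real_norm_def .
    qed
  qed measurable
  then have "0 \<le> (LINT X|M. - ((\<phi> X)\<^sup>2 * (E X - W X)) + ?Q X)"
    using nonneg by (intro LIMSEQ_le_const) auto
  also have "\<dots> = - (LINT X|M. (\<phi> X)\<^sup>2 * (E X - W X)) + (LINT X|M. ?Q X)"
    using EW int(1) by (subst Bochner_Integration.integral_add) auto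
  finally show "(LINT X|M. (\<phi> X)\<^sup>2 * (E X - W X)) \<le> (LINT X|M. ?Q X)" by simp
qed

section \<open>Integrals over the regular region\<close>

lemma matrix_form_B:
  fixes \<eta> v w :: "'a::euclidean_space"
  assumes "\<eta> \<noteq> 0"
  shows "matrix_form (\<B> \<alpha> p x \<eta>) v w =
    \<alpha> x * norm \<eta> powr (p x - 2) * (v \<bullet> w + (p x - 2) * ((\<eta> \<bullet> v) * (\<eta> \<bullet> w) / (norm \<eta>)\<^sup>2))"
proof -
  define c where "c = \<alpha> x * norm \<eta> powr (p x - 2)"
  define k where "k = (p x - 2) / (norm \<eta>)\<^sup>2"
  have 1: "(\<Sum>j\<in>Basis. \<B> \<alpha> p x \<eta> i j * (v \<bullet> j)) = c * (v \<bullet> i + k * (\<eta> \<bullet> i) * (\<eta> \<bullet> v))" if "i \<in> Basis" for i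
  proof -
    have "(\<Sum>j\<in>Basis. \<B> \<alpha> p x \<eta> i j * (v \<bullet> j)) =
      (\<Sum>j\<in>Basis. c * (if i = j then v \<bullet> j else 0) + c * k * (\<eta> \<bullet> i) * ((\<eta> \<bullet> j) * (v \<bullet> j)))"
      using assms by (intro sum.cong) (auto simp: \<B>_def c_def k_def algebra_simps)
    also have "\<dots> = c * (v \<bullet> i) + c * k * (\<eta> \<bullet> i) * (\<eta> \<bullet> v)"
      using that by (simp add: sum.distrib sum_distrib_left[symmetric] euclidean_inner[of \<eta> v])
    finally show ?thesis by (simp add: algebra_simps)
  qed
  have "matrix_form (\<B> \<alpha> p x \<eta>) v w = (\<Sum>i\<in>Basis. c * ((v \<bullet> i) * (w \<bullet> i)) + c * k * (\<eta> \<bullet> v) * ((\<eta> \<bullet> i) * (w \<bullet> i)))"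
    unfolding matrix_form_def by (intro sum.cong refl) (simp only: 1, simp add: algebra_simps)
  also have "\<dots> = c * (v \<bullet> w) + c * k * (\<eta> \<bullet> v) * (\<eta> \<bullet> w)"
    by (simp add: sum.distrib sum_distrib_left[symmetric] euclidean_inner[of v w] euclidean_inner[of \<eta> w])
  finally show ?thesis by (simp add: c_def k_def algebra_simps)
qed

lemma has_vector_derivative_line:
  assumes "(g has_derivative g') (at (X + t *\<^sub>R e))"
  shows "((\<lambda>s. g (X + s *\<^sub>R e)) has_vector_derivative g' e) (at t)"
proof -
  have "((\<lambda>s. g (X + s *\<^sub>R e)) has_derivative (\<lambda>s. g' (s *\<^sub>R e))) (at t)"
    by (rule has_derivative_compose[where f="\<lambda>s. X + s *\<^sub>R e" and g=g, OF _ assms])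
      (auto intro!: derivative_eq_intros)
  then show ?thesis
    using linear_cmul[OF has_derivative_linear[OF assms]] by (simp add: has_vector_derivative_def)
qed

locale stable_weak_solution = regular_function \<Omega> u
  for \<Omega> :: "((real ^ 'm) \<times> (real ^ 'k)) set" and u +
  fixes \<alpha> p :: "real ^ 'm \<Rightarrow> real" and f :: "real ^ 'm \<Rightarrow> real \<Rightarrow> real"
  assumes f: "Linf_on UNIV (\<lambda>(x, s). f x s)" "\<forall>x s. f x differentiable (at s)"
      "Linf_on UNIV (\<lambda>(x, s). deriv (f x) s)"
    and \<alpha>: "Linf_on UNIV \<alpha>" "\<And>x. 0 \<le> \<alpha> x"
    and p: "Linf_on UNIV p" "\<And>x. 2 \<le> p x"
    and weak: "weak_solution \<Omega> \<alpha> p f u"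
    and stable: "stable_solution \<Omega> \<alpha> p f u"
begin

abbreviation R where "R \<equiv> \<R> \<Omega> u"

definition wt where "wt X = \<alpha> (fst X) * norm (grad u X) powr (p (fst X) - 2)"

text \<open>The form of \<open>\<B>\<close> in closed form. At critical points of u it is 0, because
  \<open>0 powr 0 = 0\<close>, and there it can differ from \<open>\<B>\<close>; on
  \<open>\<R>\<close> the two agree.\<close>

definition bil where
  "bil X v w = wt X * (v \<bullet> w + (p (fst X) - 2) * ((grad u X \<bullet> v) * (grad u X \<bullet> w) / (norm (grad u X))\<^sup>2))"

definition fu where "fu X = deriv (f (fst X)) (u X)"

text \<open>The clause for \<open>f\<close> ranges over all s and thus depends on the x-component of
  \<open>X\<close> only, which allows a single exceptional set of x.\<close>

definition bounds where
  "bounds M X \<longleftrightarrow> wt X \<le> M \<and> (\<forall>v w. \<bar>bil X v w\<bar> \<le> M * norm v * norm w) \<and>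
    (\<forall>s. \<bar>f (fst X) s\<bar> \<le> M \<and> \<bar>deriv (f (fst X)) s\<bar> \<le> M)"

lemma boundsD:
  assumes "bounds M X"
  shows "wt X \<le> M" "\<bar>bil X v w\<bar> \<le> M * norm v * norm w" "\<bar>f (fst X) s\<bar> \<le> M" "\<bar>fu X\<bar> \<le> M"
  using assms unfolding bounds_def fu_def by blast+

lemma R_sets: "R \<in> sets lebesgue" "\<Omega> \<in> sets lebesgue"
  using open_R open_\<Omega> by (simp_all add: sets_completionI_sets)

lemma AE_R: "(AE X in lebesgue. X \<in> R \<longrightarrow> P X) \<Longrightarrow> (AE X in lebesgue_on R. P X)"
  using R_sets by (simp add: AE_restrict_space_iff)

lemma bil_eq_matrix_form:
  "grad u X \<noteq> 0 \<Longrightarrow> matrix_form (\<B> \<alpha> p (fst X) (grad u X)) v w = bil X v w"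
  by (simp add: matrix_form_B bil_def wt_def)

lemma wt_nonneg: "0 \<le> wt X"
  using \<alpha>(2) by (simp add: wt_def)

lemma bil_commute: "bil X v w = bil X w v"
  by (simp add: bil_def inner_commute mult.commute)

lemma bil_add_right: "bil X v (w + w') = bil X v w + bil X v w'"
  by (simp add: bil_def inner_add_right add_divide_distrib algebra_simps)

lemma bil_scale_right: "bil X v (c *\<^sub>R w) = c * bil X v w"
  by (simp add: bil_def algebra_simps)

lemma bil_add_left: "bil X (v + v') w = bil X v w + bil X v' w"
  using bil_add_right[of X w v v'] by (simp add: bil_commute)

lemma bil_scale_left: "bil X (c *\<^sub>R v) w = c * bil X v w"
  using bil_scale_right[of X w c v] by (simp add: bil_commute)

lemma bil_sum_left: "finite I \<Longrightarrow> bil X (\<Sum>i\<in>I. v i) w = (\<Sum>i\<in>I. bil X (v i) w)"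
proof (induction rule: finite_induct)
  case empty
  show ?case using bil_scale_left[of X 0 0 w] by simp
qed (simp add: bil_add_left)

lemma bil_nonneg: "0 \<le> bil X v v"
  using wt_nonneg p(2) by (auto simp: bil_def intro!: mult_nonneg_nonneg add_nonneg_nonneg)

lemma bil_quadratic:
  "bil X (s *\<^sub>R v + t *\<^sub>R w) (s *\<^sub>R v + t *\<^sub>R w) = s\<^sup>2 * bil X v v + 2 * s * t * bil X v w + t\<^sup>2 * bil X w w"
  using bil_commute[of X v w]
  by (simp add: bil_add_left bil_add_right bil_scale_left bil_scale_right power2_eq_square algebra_simps)

lemma bil_form_nonneg: "0 \<le> s\<^sup>2 * bil X v v + 2 * s * t * bil X v w + t\<^sup>2 * bil X w w"
  using bil_nonneg[of X "s *\<^sub>R v + t *\<^sub>R w"] unfolding bil_quadratic .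

lemma bil_bound: "\<bar>bil X v w\<bar> \<le> wt X * (p (fst X) - 1) * norm v * norm w"
proof -
  let ?\<eta> = "grad u X"
  have "\<bar>(?\<eta> \<bullet> v) * (?\<eta> \<bullet> w) / (norm ?\<eta>)\<^sup>2\<bar> \<le> norm v * norm w"
  proof (cases "?\<eta> = 0")
    case False
    have "\<bar>(?\<eta> \<bullet> v) * (?\<eta> \<bullet> w)\<bar> \<le> (norm ?\<eta> * norm v) * (norm ?\<eta> * norm w)"
      unfolding abs_mult by (intro mult_mono Cauchy_Schwarz_ineq2) auto
    then show ?thesis using False by (simp add: divide_le_eq power2_eq_square mult_ac)
  qed simp
  then have "\<bar>(p (fst X) - 2) * ((?\<eta> \<bullet> v) * (?\<eta> \<bullet> w) / (norm ?\<eta>)\<^sup>2)\<bar> \<le> (p (fst X) - 2) * (norm v * norm w)"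
    using p(2)[of "fst X"] unfolding abs_mult[of "p (fst X) - 2"] by (intro mult_mono) auto
  then have "\<bar>v \<bullet> w + (p (fst X) - 2) * ((?\<eta> \<bullet> v) * (?\<eta> \<bullet> w) / (norm ?\<eta>)\<^sup>2)\<bar> \<le> norm v * norm w + (p (fst X) - 2) * (norm v * norm w)"
    using Cauchy_Schwarz_ineq2[of v w] by linarith
  then have "wt X * \<bar>v \<bullet> w + (p (fst X) - 2) * ((?\<eta> \<bullet> v) * (?\<eta> \<bullet> w) / (norm ?\<eta>)\<^sup>2)\<bar> \<le>
     wt X * (norm v * norm w + (p (fst X) - 2) * (norm v * norm w))"
    by (rule mult_left_mono[OF _ wt_nonneg])
  moreover have "\<bar>bil X v w\<bar> = wt X * \<bar>v \<bullet> w + (p (fst X) - 2) * ((?\<eta> \<bullet> v) * (?\<eta> \<bullet> w) / (norm ?\<eta>)\<^sup>2)\<bar>"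
    unfolding bil_def abs_mult using wt_nonneg[of X] by simp
  ultimately show ?thesis by (simp add: algebra_simps)
qed

text \<open>For almost every \<open>X\<close> the bound holds on the entire part of \<open>K\<close>
  over the x-component of \<open>X\<close>, not just at \<open>X\<close>. This is what permits
  moving along lines in the y-directions.\<close>

lemma coefficient_bounds:
  assumes K: "compact K" "K \<subseteq> \<Omega>"
  obtains M where "M \<ge> 0" "AE X :: (real ^ 'm) \<times> (real ^ 'k) in lebesgue. \<forall>y. (fst X, y) \<in> K \<longrightarrow> bounds M (fst X, y)"
proof -
  obtain C1 where C1: "AE x in lebesgue. norm (\<alpha> x) \<le> C1"
    using \<alpha>(1) unfolding Linf_on_def lebesgue_on_UNIV_eq by blast
  obtain C2 where C2: "AE x in lebesgue. norm (p x) \<le> C2"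
    using p(1) unfolding Linf_on_def lebesgue_on_UNIV_eq by blast
  obtain C3 where C3: "AE x in lebesgue. \<forall>s. \<bar>f x s\<bar> \<le> C3 \<and> \<bar>deriv (f x) s\<bar> \<le> C3"
  proof (rule structural_f[OF f])
    fix F F' C
    assume "AE x in lebesgue. \<forall>s. F x s = f x s \<and> F' x s = deriv (f x) s \<and> \<bar>f x s\<bar> \<le> C \<and> \<bar>deriv (f x) s\<bar> \<le> C"
    then have "AE x in lebesgue. \<forall>s. \<bar>f x s\<bar> \<le> C \<and> \<bar>deriv (f x) s\<bar> \<le> C" by (rule eventually_mono) blast
    then show ?thesis by (rule that)
  qed
  have "bounded (grad u ` K)"
    using K cont_grad by (intro compact_imp_bounded compact_continuous_image) (auto intro: continuous_on_subset)
  then obtain D where D: "\<And>X. X \<in> K \<Longrightarrow> norm (grad u X) \<le> D" by (auto simp: bounded_iff)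
  \<comment> \<open>Bounds the weight: the base is raised to at least 1 so that the power grows with
    the exponent, and \<open>\<bar>C2\<bar>\<close> exceeds p - 2. The form carries the further
    factor p - 1, again at most \<open>\<bar>C2\<bar>\<close>.\<close>
  define M1 where "M1 = \<bar>C1\<bar> * max 1 D powr \<bar>C2\<bar>"
  define M where "M = M1 + M1 * \<bar>C2\<bar> + \<bar>C3\<bar>"
  have M1: "M1 \<ge> 0" by (simp add: M1_def)
  show ?thesis
  proof (rule that[of M])
    show "M \<ge> 0" using M1 by (simp add: M_def)
    show "AE X :: (real ^ 'm) \<times> (real ^ 'k) in lebesgue. \<forall>y. (fst X, y) \<in> K \<longrightarrow> bounds M (fst X, y)"
      using AE_fst[OF C1] AE_fst[OF C2] AE_fst[OF C3]
    proof eventually_elim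
      case (elim X)
      show ?case
      proof (intro allI impI)
        fix y assume y: "(fst X, y) \<in> K"
        let ?Y = "(fst X, y)"
        have pC: "p (fst X) \<le> \<bar>C2\<bar>" and \<alpha>C: "\<alpha> (fst X) \<le> \<bar>C1\<bar>" using elim by auto
        have "norm (grad u ?Y) powr (p (fst X) - 2) \<le> max 1 D powr (p (fst X) - 2)"
          using D[OF y] p(2)[of "fst X"] by (intro powr_mono2) auto
        also have "\<dots> \<le> max 1 D powr \<bar>C2\<bar>" using pC by (intro powr_mono) auto
        finally have wt: "wt ?Y \<le> M1"
          unfolding wt_def M1_def fst_conv using \<alpha>C \<alpha>(2) by (intro mult_mono) auto
        have "\<bar>bil ?Y v w\<bar> \<le> M * norm v * norm w" for v w
        proof -
          have "wt ?Y * (p (fst X) - 1) \<le> M1 * \<bar>C2\<bar>"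
            using wt wt_nonneg[of ?Y] pC p(2)[of "fst X"] M1 by (intro mult_mono) auto
          also have "\<dots> \<le> M" using M1 by (simp add: M_def)
          finally have "wt ?Y * (p (fst X) - 1) * (norm v * norm w) \<le> M * (norm v * norm w)"
            by (rule mult_right_mono) simp
          then show ?thesis using bil_bound[of ?Y v w] by (simp add: mult.assoc)
        qed
        moreover have "wt ?Y \<le> M" using wt M1 by (simp add: M_def add_increasing2)
        moreover have "\<bar>f (fst X) s\<bar> \<le> M \<and> \<bar>deriv (f (fst X)) s\<bar> \<le> M" for s
          using elim(3)[rule_format, of s] M1 mult_nonneg_nonneg[OF M1, of "\<bar>C2\<bar>"] unfolding M_def by linarith
        ultimately show "bounds M ?Y" unfolding bounds_def fst_conv by blast
      qed
    qed
  qed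
qed

lemma coefficient_bounds_R:
  assumes K: "compact K" "K \<subseteq> \<Omega>"
  obtains M where "M \<ge> 0" "AE X in lebesgue_on R. X \<in> K \<longrightarrow> bounds M X"
proof -
  obtain M where M: "M \<ge> 0" "AE X :: (real ^ 'm) \<times> (real ^ 'k) in lebesgue. \<forall>y. (fst X, y) \<in> K \<longrightarrow> bounds M (fst X, y)"
    using coefficient_bounds[OF K] by blast
  have "AE X in lebesgue. X \<in> R \<longrightarrow> (X \<in> K \<longrightarrow> bounds M X)"
    by (rule eventually_mono[OF M(2)]) (metis prod.collapse)
  from AE_R[OF this] show ?thesis by (rule that[OF M(1)])
qed

lemma continuous_measurable_R [measurable]:
  fixes g :: "(real ^ 'm) \<times> (real ^ 'k) \<Rightarrow> 'b::euclidean_space"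
  shows "continuous_on R g \<Longrightarrow> g \<in> borel_measurable (lebesgue_on R)"
  by (rule continuous_imp_measurable_on_sets_lebesgue) (use R_sets in auto)

lemma cont_grad_R: "continuous_on R (grad u)"
  using cont_grad R_subset continuous_on_subset by blast

lemma cont_u_R: "continuous_on R u"
  using diff_u R_subset by (intro continuous_at_imp_continuous_on ballI differentiable_imp_continuous_within) auto

lemma measurable_grad_R [measurable]: "grad u \<in> borel_measurable (lebesgue_on R)"
  by (rule continuous_measurable_R[OF cont_grad_R])

lemma measurable_p_R [measurable]: "(\<lambda>X. p (fst X)) \<in> borel_measurable (lebesgue_on R)"
  using borel_measurable_fst_lebesgue[of p] p(1)
  by (intro measurable_restrict_space1) (simp add: Linf_on_def lebesgue_on_UNIV_eq)

lemma measurable_wt [measurable]: "wt \<in> borel_measurable (lebesgue_on R)"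
proof -
  have [measurable]: "(\<lambda>X. \<alpha> (fst X)) \<in> borel_measurable (lebesgue_on R)"
    using borel_measurable_fst_lebesgue[of \<alpha>] \<alpha>(1)
    by (intro measurable_restrict_space1) (simp add: Linf_on_def lebesgue_on_UNIV_eq)
  show ?thesis unfolding wt_def[abs_def] by measurable
qed

lemma measurable_bil [measurable]:
  assumes [measurable]: "v \<in> borel_measurable (lebesgue_on R)" "w \<in> borel_measurable (lebesgue_on R)"
  shows "(\<lambda>X. bil X (v X) (w X)) \<in> borel_measurable (lebesgue_on R)"
  unfolding bil_def by measurable

lemma measurable_f_R [measurable]: "(\<lambda>X. f (fst X) (u X)) \<in> borel_measurable (lebesgue_on R)"
  and measurable_fu_R [measurable]: "fu \<in> borel_measurable (lebesgue_on R)"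
proof -
  obtain F F' C where F: "(\<lambda>(x, s). F x s) \<in> borel_measurable borel" "(\<lambda>(x, s). F' x s) \<in> borel_measurable borel"
    "AE x in lebesgue. \<forall>s. F x s = f x s \<and> F' x s = deriv (f x) s \<and> \<bar>f x s\<bar> \<le> C \<and> \<bar>deriv (f x) s\<bar> \<le> C"
    using structural_f[OF f] by blast
  show "(\<lambda>X. f (fst X) (u X)) \<in> borel_measurable (lebesgue_on R)"
    by (rule borel_measurable_superposition[OF open_R cont_u_R F(1)]) (use F(3) in \<open>auto elim!: eventually_mono\<close>)
  show "fu \<in> borel_measurable (lebesgue_on R)" unfolding fu_def[abs_def]
    by (rule borel_measurable_superposition[OF open_R cont_u_R F(2), of "\<lambda>x. deriv (f x)"])
      (use F(3) in \<open>auto elim!: eventually_mono\<close>)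
qed

lemma integrable_bound_compact:
  assumes K: "compact K"
  shows "integrable (lebesgue_on R) (\<lambda>X. M * indicator K X :: real)"
proof -
  have "integrable lebesgue (\<lambda>X. M * indicator K X :: real)"
    using lmeasurable_compact[OF K]
    by (intro integrable_mult_right integrable_real_indicator) (auto simp: fmeasurable_def)
  from integrable_mult_indicator[OF R_sets(1) this] show ?thesis
    by (rule integrable_restrict_space[THEN iffD2, rotated]) (use R_sets in simp)
qed

lemma integrable_on_compact:
  fixes g :: "_ \<Rightarrow> real"
  assumes "g \<in> borel_measurable (lebesgue_on R)" "compact K" "AE X in lebesgue_on R. X \<in> K \<longrightarrow> \<bar>g X\<bar> \<le> N"
    and "\<And>X. X \<in> R \<Longrightarrow> X \<notin> K \<Longrightarrow> g X = 0"
  shows "integrable (lebesgue_on R) g"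
proof (rule Bochner_Integration.integrable_bound[OF integrable_bound_compact[OF assms(2), of "\<bar>N\<bar>"] assms(1)])
  show "AE X in lebesgue_on R. norm (g X) \<le> norm (\<bar>N\<bar> * indicator K X)"
    using assms(3) AE_space
  proof eventually_elim
    case (elim X)
    then show ?case using assms(4)[of X] by (cases "X \<in> K") auto
  qed
qed

lemma integral_\<Omega>_R:
  fixes g :: "_ \<Rightarrow> real"
  assumes "\<And>X. X \<in> \<Omega> \<Longrightarrow> X \<notin> R \<Longrightarrow> g X = 0"
  shows "(LINT X|lebesgue_on \<Omega>. g X) = (LINT X|lebesgue_on R. g X)"
    and "integrable (lebesgue_on \<Omega>) g \<longleftrightarrow> integrable (lebesgue_on R) g"
proof -
  have *: "indicator \<Omega> X *\<^sub>R g X = indicator R X *\<^sub>R g X" for X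
    using assms[of X] R_subset by (cases "X \<in> \<Omega>"; cases "X \<in> R") auto
  show "(LINT X|lebesgue_on \<Omega>. g X) = (LINT X|lebesgue_on R. g X)"
    using R_sets by (simp add: integral_restrict_space * del: real_scaleR_def)
  show "integrable (lebesgue_on \<Omega>) g \<longleftrightarrow> integrable (lebesgue_on R) g"
    using R_sets by (simp add: integrable_restrict_space * del: real_scaleR_def)
qed

end

section \<open>Differentiating the equation in the y-directions\<close>

lemma test_funD:
  assumes "test_fun V \<xi>"
  shows "compact (closure {X. \<xi> X \<noteq> 0})" "closure {X. \<xi> X \<noteq> 0} \<subseteq> V" "Ck_on k UNIV \<xi>"
    "X \<notin> closure {X. \<xi> X \<noteq> 0} \<Longrightarrow> \<xi> X = 0" "X \<notin> closure {X. \<xi> X \<noteq> 0} \<Longrightarrow> grad \<xi> X = 0"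
proof -
  show c: "compact (closure {X. \<xi> X \<noteq> 0})" "closure {X. \<xi> X \<noteq> 0} \<subseteq> V" "Ck_on k UNIV \<xi>"
    using assms by (auto simp: test_fun_def)
  have z: "\<xi> X = 0" if "X \<notin> closure {X. \<xi> X \<noteq> 0}" for X
    using that closure_subset[of "{X. \<xi> X \<noteq> 0}"] by auto
  show "X \<notin> closure {X. \<xi> X \<noteq> 0} \<Longrightarrow> \<xi> X = 0" by (rule z)
  show "X \<notin> closure {X. \<xi> X \<noteq> 0} \<Longrightarrow> grad \<xi> X = 0"
    by (rule grad_zero_outside[OF closed_closure z])
qed

lemma test_fun_mono: "test_fun V \<xi> \<Longrightarrow> V \<subseteq> W \<Longrightarrow> test_fun W \<xi>"
  by (auto simp: test_fun_def)

lemma test_fun_partial: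
  assumes "test_fun V \<xi>" "b \<in> Basis"
  shows "test_fun V (\<lambda>X. grad \<xi> X \<bullet> b)" "X \<notin> closure {X. \<xi> X \<noteq> 0} \<Longrightarrow> grad \<xi> X \<bullet> b = 0"
proof -
  show z: "X \<notin> closure {X. \<xi> X \<noteq> 0} \<Longrightarrow> grad \<xi> X \<bullet> b = 0" for X
    using test_funD(5)[OF assms(1)] by simp
  then have s: "closure {X. grad \<xi> X \<bullet> b \<noteq> 0} \<subseteq> closure {X. \<xi> X \<noteq> 0}"
    by (intro closure_minimal) auto
  moreover have "compact (closure {X. grad \<xi> X \<bullet> b \<noteq> 0})"
    using closed_Int_compact[OF closed_closure test_funD(1)[OF assms(1)]] s by (metis Int_absorb2)
  moreover have "Ck_on k UNIV (\<lambda>X. grad \<xi> X \<bullet> b)" for k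
    using test_funD(3)[OF assms(1), of "Suc k"] assms(2) by simp
  ultimately show "test_fun V (\<lambda>X. grad \<xi> X \<bullet> b)"
    using test_funD(2)[OF assms(1)] by (auto simp: test_fun_def)
qed

lemma bounded_on_compact:
  assumes "continuous_on U g" "compact K" "K \<subseteq> U"
  obtains D :: real where "D \<ge> 0" "\<And>X. X \<in> K \<Longrightarrow> norm (g X) \<le> D"
proof -
  have "bounded (g ` K)"
    using assms by (intro compact_imp_bounded compact_continuous_image) (auto intro: continuous_on_subset)
  then obtain D where D: "\<And>X. X \<in> K \<Longrightarrow> norm (g X) \<le> D" by (auto simp: bounded_iff)
  then show ?thesis by (intro that[of "max 0 D"]) (auto simp: le_max_iff_disj)
qed

lemma eventually_line:
  fixes X e :: "'a::real_normed_vector"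
  assumes "open S" "X + t *\<^sub>R e \<in> S"
  shows "\<forall>\<^sub>F s in nhds t. X + s *\<^sub>R e \<in> S"
proof -
  have "continuous_on UNIV (\<lambda>s. X + s *\<^sub>R e)" by (intro continuous_intros)
  from open_vimage[OF assms(1) this] assms(2) show ?thesis
    using eventually_nhds_in_open[of "(\<lambda>s. X + s *\<^sub>R e) -` S" t] by simp
qed

context stable_weak_solution
begin

text \<open>On a line with \<open>fst e = 0\<close> the point x is fixed, so \<open>\<alpha>\<close>
  and \<open>p\<close> are constants and \<open>f\<close> is differentiated in its last argument
  alone. The derivative of the power of |grad u| produces the rank-one part of
  \<open>\<B>\<close>.\<close>

lemma flux_derivative:
  assumes Y: "X + t *\<^sub>R e \<in> R" and e: "e \<in> Basis" "fst e = 0" and \<xi>: "Ck_on 2 UNIV \<xi>"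
  defines "Y \<equiv> X + t *\<^sub>R e"
  shows "((\<lambda>s. wt (X + s *\<^sub>R e) * (grad u (X + s *\<^sub>R e) \<bullet> grad \<xi> (X + s *\<^sub>R e))
       - f (fst (X + s *\<^sub>R e)) (u (X + s *\<^sub>R e)) * \<xi> (X + s *\<^sub>R e)) has_real_derivative
     bil Y (hess u Y e) (grad \<xi> Y) + wt Y * (grad u Y \<bullet> grad (\<lambda>Z. grad \<xi> Z \<bullet> e) Y)
       - (fu Y * (grad u Y \<bullet> e) * \<xi> Y + f (fst Y) (u Y) * (grad \<xi> Y \<bullet> e))) (at t)"
proof -
  define x where "x = fst X"
  define q where "q = p x - 2"
  define \<eta> where "\<eta> s = grad u (X + s *\<^sub>R e)" for s
  define \<zeta> where "\<zeta> s = grad \<xi> (X + s *\<^sub>R e)" for s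
  define h where "h s = u (X + s *\<^sub>R e)" for s
  define k where "k s = \<xi> (X + s *\<^sub>R e)" for s
  have YR: "Y \<in> R" using Y by (simp add: Y_def)
  have fst: "fst (X + s *\<^sub>R e) = x" for s using e by (simp add: x_def)
  have \<eta>0: "\<eta> t \<noteq> 0" using R_grad[OF Y] by (simp add: \<eta>_def)
  have d\<eta>: "(\<eta> has_vector_derivative hess u Y e) (at t)"
    unfolding \<eta>_def[abs_def] Y_def by (rule has_vector_derivative_line[OF hess_deriv[OF Y]])
  have d\<zeta>: "(\<zeta> has_vector_derivative grad (\<lambda>Z. grad \<xi> Z \<bullet> e) Y) (at t)"
    unfolding \<zeta>_def[abs_def] hess_Basis[OF open_UNIV \<xi> UNIV_I e(1), symmetric] Y_def
    by (rule has_vector_derivative_line[OF Ck_on_2_imp(2)[OF \<xi> UNIV_I]])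
  have dh: "(h has_real_derivative grad u Y \<bullet> e) (at t)"
    unfolding h_def[abs_def] Y_def has_real_derivative_iff_has_vector_derivative inner_commute[of _ e]
    using diff_u[OF subsetD[OF R_subset Y]]
    by (intro has_vector_derivative_line[where g'="\<lambda>h. h \<bullet> grad u (X + t *\<^sub>R e)"] has_derivative_grad) auto
  have dk: "(k has_real_derivative grad \<xi> Y \<bullet> e) (at t)"
    unfolding k_def[abs_def] Y_def has_real_derivative_iff_has_vector_derivative inner_commute[of _ e]
    by (intro has_vector_derivative_line[where g'="\<lambda>h. h \<bullet> grad \<xi> (X + t *\<^sub>R e)"] has_derivative_grad
        Ck_on_2_imp(1)[OF \<xi>]) auto
  have dn: "((\<lambda>s. norm (\<eta> s)) has_real_derivative (\<eta> t \<bullet> hess u Y e) / norm (\<eta> t)) (at t)"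
  proof -
    have "((\<lambda>s. norm (\<eta> s)) has_derivative (\<lambda>r. (r *\<^sub>R hess u Y e) \<bullet> sgn (\<eta> t))) (at t)"
      using has_derivative_compose[of \<eta> _ t UNIV norm, OF d\<eta>[unfolded has_vector_derivative_def]
          has_derivative_norm[OF \<eta>0]] by (simp add: inner_commute)
    moreover have "(\<lambda>r. (r *\<^sub>R hess u Y e) \<bullet> sgn (\<eta> t)) = (*) ((\<eta> t \<bullet> hess u Y e) / norm (\<eta> t))"
      by (rule ext) (simp add: sgn_div_norm divide_inverse inner_commute)
    ultimately show ?thesis unfolding has_field_derivative_def by metis
  qed
  have dp: "((\<lambda>s. norm (\<eta> s) powr q) has_real_derivative
     norm (\<eta> t) powr q * q * (\<eta> t \<bullet> hess u Y e) / (norm (\<eta> t))\<^sup>2) (at t)"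
  proof -
    have "((\<lambda>s. norm (\<eta> s) powr q) has_real_derivative
       q * norm (\<eta> t) powr (q - 1) * ((\<eta> t \<bullet> hess u Y e) / norm (\<eta> t))) (at t)"
      by (rule DERIV_chain2[OF has_real_derivative_powr dn]) (use \<eta>0 in simp)
    moreover have "norm (\<eta> t) powr (q - 1) = norm (\<eta> t) powr q / norm (\<eta> t)"
      using \<eta>0 by (simp add: powr_diff)
    ultimately show ?thesis by (simp add: power2_eq_square mult_ac)
  qed
  have di: "((\<lambda>s. \<eta> s \<bullet> \<zeta> s) has_real_derivative
      \<eta> t \<bullet> grad (\<lambda>Z. grad \<xi> Z \<bullet> e) Y + hess u Y e \<bullet> \<zeta> t) (at t)"
  proof -
    have "(\<lambda>r. \<eta> t \<bullet> r *\<^sub>R grad (\<lambda>Z. grad \<xi> Z \<bullet> e) Y + r *\<^sub>R hess u Y e \<bullet> \<zeta> t) =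
      (*) (\<eta> t \<bullet> grad (\<lambda>Z. grad \<xi> Z \<bullet> e) Y + hess u Y e \<bullet> \<zeta> t)"
      by (rule ext) (simp add: algebra_simps)
    with has_derivative_inner[OF d\<eta>[unfolded has_vector_derivative_def] d\<zeta>[unfolded has_vector_derivative_def]]
    show ?thesis unfolding has_field_derivative_def by metis
  qed
  have df: "((\<lambda>s. f x (h s)) has_real_derivative deriv (f x) (h t) * (grad u Y \<bullet> e)) (at t)"
    using f(2) by (intro DERIV_chain2[OF _ dh]) (simp add: DERIV_deriv_iff_real_differentiable)
  have "((\<lambda>s. \<alpha> x * (norm (\<eta> s) powr q * (\<eta> s \<bullet> \<zeta> s)) - f x (h s) * k s) has_real_derivative
    \<alpha> x * (norm (\<eta> t) powr q * q * (\<eta> t \<bullet> hess u Y e) / (norm (\<eta> t))\<^sup>2 * (\<eta> t \<bullet> \<zeta> t)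
       + (\<eta> t \<bullet> grad (\<lambda>Z. grad \<xi> Z \<bullet> e) Y + hess u Y e \<bullet> \<zeta> t) * norm (\<eta> t) powr q)
     - (deriv (f x) (h t) * (grad u Y \<bullet> e) * k t + (grad \<xi> Y \<bullet> e) * f x (h t))) (at t)"
    by (intro DERIV_diff DERIV_mult DERIV_cmult dp di df dk)
  moreover have "(\<lambda>s. \<alpha> x * (norm (\<eta> s) powr q * (\<eta> s \<bullet> \<zeta> s)) - f x (h s) * k s) =
    (\<lambda>s. wt (X + s *\<^sub>R e) * (grad u (X + s *\<^sub>R e) \<bullet> grad \<xi> (X + s *\<^sub>R e))
       - f (fst (X + s *\<^sub>R e)) (u (X + s *\<^sub>R e)) * \<xi> (X + s *\<^sub>R e))"
    unfolding wt_def fst q_def \<eta>_def \<zeta>_def h_def k_def by (simp add: mult.assoc)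
  moreover have "\<alpha> x * (norm (\<eta> t) powr q * q * (\<eta> t \<bullet> hess u Y e) / (norm (\<eta> t))\<^sup>2 * (\<eta> t \<bullet> \<zeta> t)
       + (\<eta> t \<bullet> grad (\<lambda>Z. grad \<xi> Z \<bullet> e) Y + hess u Y e \<bullet> \<zeta> t) * norm (\<eta> t) powr q)
     - (deriv (f x) (h t) * (grad u Y \<bullet> e) * k t + (grad \<xi> Y \<bullet> e) * f x (h t)) =
     bil Y (hess u Y e) (grad \<xi> Y) + wt Y * (grad u Y \<bullet> grad (\<lambda>Z. grad \<xi> Z \<bullet> e) Y)
       - (fu Y * (grad u Y \<bullet> e) * \<xi> Y + f (fst Y) (u Y) * (grad \<xi> Y \<bullet> e))"
    unfolding bil_def wt_def fu_def Y_def fst q_def \<eta>_def \<zeta>_def h_def k_def by (simp add: algebra_simps)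
  ultimately show ?thesis by simp
qed

text \<open>The derivative falls on the test function: the weak equation is tested with
  \<open>\<psi>\<close>, the derivative of \<open>\<xi>\<close> along e, which equates the integrals
  of \<open>B\<close> and \<open>D\<close>. The flux density \<open>F\<close> has compact support,
  so its derivative along e, which is \<open>A + B - (C + D)\<close>, integrates to 0, and the
  integrals of \<open>A\<close> and \<open>C\<close> agree.\<close>

lemma linearized_test:
  assumes \<xi>: "test_fun R \<xi>" and e: "e \<in> Basis" "fst e = 0"
  shows "(LINT X|lebesgue_on R. bil X (hess u X e) (grad \<xi> X)) =
    (LINT X|lebesgue_on R. fu X * (grad u X \<bullet> e) * \<xi> X)"
proof -
  define K where "K = closure {X. \<xi> X \<noteq> 0}"
  define \<psi> where "\<psi> X = grad \<xi> X \<bullet> e" for X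
  note tf = test_funD[OF \<xi>, folded K_def]
  have \<psi>: "test_fun R \<psi>" and \<psi>0: "\<And>X. X \<notin> K \<Longrightarrow> \<psi> X = 0"
    using test_fun_partial[OF \<xi> e(1)] unfolding \<psi>_def[abs_def] K_def by auto
  have K: "compact K" "K \<subseteq> R" "K \<subseteq> \<Omega>" using tf(1,2) R_subset by auto
  have g\<psi>0: "grad \<psi> X = 0" if "X \<notin> K" for X
    using grad_zero_outside[OF compact_imp_closed[OF K(1)] \<psi>0 that] .
  have C2\<xi>: "Ck_on 2 UNIV \<xi>" by (rule tf(3))
  have c: "continuous_on UNIV \<xi>" "continuous_on UNIV (grad \<xi>)" "continuous_on UNIV \<psi>" "continuous_on UNIV (grad \<psi>)"
    using tf(3)[of 0] tf(3)[of 1, unfolded Ck_on_1_iff] test_funD(3)[OF \<psi>, of 0] test_funD(3)[OF \<psi>, of 1, unfolded Ck_on_1_iff]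
    by simp_all
  have cR: "continuous_on R g" if "continuous_on UNIV g" for g :: "(real ^ 'm) \<times> (real ^ 'k) \<Rightarrow> 'c::euclidean_space"
    using that continuous_on_subset by blast
  note m[measurable] = continuous_measurable_R[OF cR[OF c(1)]] continuous_measurable_R[OF cR[OF c(2)]]
    continuous_measurable_R[OF cR[OF c(3)]] continuous_measurable_R[OF cR[OF c(4)]]
    continuous_measurable_R[OF cont_hess[of e]]
  define F where "F X = wt X * (grad u X \<bullet> grad \<xi> X) - f (fst X) (u X) * \<xi> X" for X
  define A where "A X = bil X (hess u X e) (grad \<xi> X)" for X
  define B where "B X = wt X * (grad u X \<bullet> grad \<psi> X)" for X
  define C where "C X = fu X * (grad u X \<bullet> e) * \<xi> X" for X
  define D where "D X = f (fst X) (u X) * \<psi> X" for X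
  define g where "g X = (if X \<in> R then F X else 0)" for X
  define g' where "g' X = (if X \<in> R then A X + B X - (C X + D X) else 0)" for X
  have [measurable]: "A \<in> borel_measurable (lebesgue_on R)" "B \<in> borel_measurable (lebesgue_on R)"
      "C \<in> borel_measurable (lebesgue_on R)" "D \<in> borel_measurable (lebesgue_on R)" "F \<in> borel_measurable (lebesgue_on R)"
    unfolding A_def[abs_def] B_def[abs_def] C_def[abs_def] D_def[abs_def] F_def[abs_def] by measurable
  obtain d1 where d1: "d1 \<ge> 0" "\<And>X. X \<in> K \<Longrightarrow> norm (grad u X) \<le> d1"
    using bounded_on_compact[OF cont_grad_R K(1,2)] by blast
  obtain d2 where d2: "d2 \<ge> 0" "\<And>X. X \<in> K \<Longrightarrow> norm (hess u X e) \<le> d2"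
    using bounded_on_compact[OF cont_hess K(1,2)] by blast
  obtain d3 where d3: "d3 \<ge> 0" "\<And>X. X \<in> K \<Longrightarrow> norm (\<xi> X) \<le> d3"
    using bounded_on_compact[OF c(1) K(1)] by blast
  obtain d4 where d4: "d4 \<ge> 0" "\<And>X. X \<in> K \<Longrightarrow> norm (grad \<xi> X) \<le> d4"
    using bounded_on_compact[OF c(2) K(1)] by blast
  obtain d5 where d5: "d5 \<ge> 0" "\<And>X. X \<in> K \<Longrightarrow> norm (\<psi> X) \<le> d5"
    using bounded_on_compact[OF c(3) K(1)] by blast
  obtain d6 where d6: "d6 \<ge> 0" "\<And>X. X \<in> K \<Longrightarrow> norm (grad \<psi> X) \<le> d6"
    using bounded_on_compact[OF c(4) K(1)] by blast
  obtain M where M: "M \<ge> 0" "AE X :: (real ^ 'm) \<times> (real ^ 'k) in lebesgue. \<forall>y. (fst X, y) \<in> K \<longrightarrow> bounds M (fst X, y)"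
    using coefficient_bounds[OF K(1,3)] by blast
  define N where "N = M * d1 * d4 + M * d3 + M * d2 * d4 + M * d1 * d6 + M * d1 * d3 + M * d5"
  have N: "M * d1 * d4 + M * d3 \<le> N" "M * d2 * d4 \<le> N" "M * d1 * d6 \<le> N" "M * d1 * d3 \<le> N" "M * d5 \<le> N"
    "M * d2 * d4 + M * d1 * d6 + (M * d1 * d3 + M * d5) \<le> N" "N \<ge> 0"
    using M(1) d1(1) d2(1) d3(1) d4(1) d5(1) d6(1) by (simp_all add: N_def)
  have bd: "\<bar>F X\<bar> \<le> N" "\<bar>A X\<bar> \<le> M * d2 * d4" "\<bar>B X\<bar> \<le> M * d1 * d6" "\<bar>C X\<bar> \<le> M * d1 * d3" "\<bar>D X\<bar> \<le> M * d5"
    if X: "X \<in> K" and b: "bounds M X" for X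
  proof -
    have in1: "\<bar>grad u X \<bullet> grad \<xi> X\<bar> \<le> d1 * d4" "\<bar>grad u X \<bullet> grad \<psi> X\<bar> \<le> d1 * d6"
      using Cauchy_Schwarz_ineq2[of "grad u X"] d1 d4 d6 X by (meson mult_mono norm_ge_zero order_trans)+
    have in2: "\<bar>grad u X \<bullet> e\<bar> \<le> d1" using Basis_le_norm[OF e(1), of "grad u X"] d1(2)[OF X] by linarith
    have x: "\<bar>\<xi> X\<bar> \<le> d3" "\<bar>\<psi> X\<bar> \<le> d5" using d3 d5 X by auto
    have w': "\<bar>wt X\<bar> \<le> M" using boundsD(1)[OF b] wt_nonneg[of X] by simp
    have 1: "\<bar>wt X * (grad u X \<bullet> grad \<xi> X)\<bar> \<le> M * (d1 * d4)"
      unfolding abs_mult using w' in1 M(1) by (intro mult_mono) auto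
    have 2: "\<bar>f (fst X) (u X) * \<xi> X\<bar> \<le> M * d3"
      unfolding abs_mult using boundsD(3)[OF b] x M(1) by (intro mult_mono) auto
    show "\<bar>F X\<bar> \<le> N" using 1 2 N(1) unfolding F_def mult.assoc by linarith
    show "\<bar>A X\<bar> \<le> M * d2 * d4"
    proof -
      have "\<bar>A X\<bar> \<le> M * norm (hess u X e) * norm (grad \<xi> X)" unfolding A_def by (rule boundsD(2)[OF b])
      also have "\<dots> \<le> M * d2 * d4" using d2 d4 X M(1) by (intro mult_mono) auto
      finally show ?thesis .
    qed
    show "\<bar>B X\<bar> \<le> M * d1 * d6"
      unfolding B_def abs_mult mult.assoc using w' in1 M(1) by (intro mult_mono) auto
    show "\<bar>C X\<bar> \<le> M * d1 * d3"
      unfolding C_def abs_mult using boundsD(4)[OF b] in2 x M(1) d1(1) by (intro mult_mono) auto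
    show "\<bar>D X\<bar> \<le> M * d5" unfolding D_def abs_mult using boundsD(3)[OF b] x M(1) by (intro mult_mono) auto
  qed
  have zero: "F X = 0" "A X = 0" "B X = 0" "C X = 0" "D X = 0" if "X \<notin> K" for X
    using tf(4,5) \<psi>0 g\<psi>0 that by (simp_all add: F_def A_def B_def C_def D_def bil_def)
  have "(LINT X|lebesgue. g' X) = 0"
  proof (rule integral_directional_derivative[where K=K and C=N and e=e and g=g])
    show "g \<in> borel_measurable lebesgue" unfolding g_def[abs_def] using R_sets(1) by (simp add: borel_measurable_if)
    show "compact K" by (rule K)
    show "g X = 0" if "X \<notin> K" for X using zero that by (simp add: g_def)
    show "g' X = 0" if "X \<notin> K" for X using zero that by (simp add: g'_def)
    have der: "((\<lambda>t. g (X + t *\<^sub>R e)) has_real_derivative g' (X + t *\<^sub>R e)) (at t)" for X t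
    proof (cases "X + t *\<^sub>R e \<in> R")
      case True
      have "((\<lambda>s. F (X + s *\<^sub>R e)) has_real_derivative g' (X + t *\<^sub>R e)) (at t)"
        using flux_derivative[OF True e C2\<xi>] True
        unfolding F_def g'_def A_def B_def C_def D_def \<psi>_def[abs_def] by simp
      moreover have "eventually (\<lambda>s. X + s *\<^sub>R e \<in> R) (nhds t)"
        by (rule eventually_line[OF open_R True])
      then have "eventually (\<lambda>s. F (X + s *\<^sub>R e) = g (X + s *\<^sub>R e)) (nhds t)"
        by eventually_elim (simp add: g_def)
      ultimately show ?thesis by (subst DERIV_cong_ev[OF refl _ refl, symmetric])
    next
      case False
      then have nK: "X + t *\<^sub>R e \<in> - K" using K by auto
      have "eventually (\<lambda>s. X + s *\<^sub>R e \<in> - K) (nhds t)"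
        by (rule eventually_line[OF _ nK]) (use compact_imp_closed[OF K(1)] in auto)
      then have "eventually (\<lambda>s. 0 = g (X + s *\<^sub>R e)) (nhds t)"
        by eventually_elim (use zero in \<open>simp add: g_def\<close>)
      moreover have "((\<lambda>s. 0) has_real_derivative g' (X + t *\<^sub>R e)) (at t)" using False by (simp add: g'_def)
      ultimately show ?thesis by (subst DERIV_cong_ev[OF refl _ refl, symmetric])
    qed
    show "AE X in lebesgue. \<bar>g X\<bar> \<le> N \<and> (\<forall>t. ((\<lambda>t. g (X + t *\<^sub>R e)) has_real_derivative g' (X + t *\<^sub>R e)) (at t)
        \<and> \<bar>g' (X + t *\<^sub>R e)\<bar> \<le> N)"
    proof (rule eventually_mono[OF M(2)])
      fix X :: "(real ^ 'm) \<times> (real ^ 'k)"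
      assume a: "\<forall>y. (fst X, y) \<in> K \<longrightarrow> bounds M (fst X, y)"
      \<comment> \<open>Translates of \<open>X\<close> along \<open>e\<close> keep its x-component,
        so the one bound \<open>M\<close> holds at all of them.\<close>
      have b: "\<bar>g Y\<bar> \<le> N \<and> \<bar>g' Y\<bar> \<le> N" if "fst Y = fst X" for Y
      proof (cases "Y \<in> K")
        case True
        have Y: "Y = (fst X, snd Y)" using that by (metis prod.collapse)
        have "bounds M Y" using a[rule_format, of "snd Y"] True Y by metis
        then have "\<bar>F Y\<bar> \<le> N" "\<bar>A Y\<bar> \<le> M * d2 * d4" "\<bar>B Y\<bar> \<le> M * d1 * d6" "\<bar>C Y\<bar> \<le> M * d1 * d3" "\<bar>D Y\<bar> \<le> M * d5"
          using bd[OF True] by blast+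
        then show ?thesis using True K N(6) unfolding g_def g'_def by auto
      qed (use zero N(7) in \<open>simp add: g_def g'_def\<close>)
      show "\<bar>g X\<bar> \<le> N \<and> (\<forall>t. ((\<lambda>t. g (X + t *\<^sub>R e)) has_real_derivative g' (X + t *\<^sub>R e)) (at t)
        \<and> \<bar>g' (X + t *\<^sub>R e)\<bar> \<le> N)"
        using b[of X] b[of "X + _ *\<^sub>R e"] der e(2) by simp
    qed
  qed
  then have 0: "(LINT X|lebesgue_on R. A X + B X - (C X + D X)) = 0"
    unfolding g'_def[abs_def] Lebesgue_Measure.integral_restrict_UNIV[OF R_sets(1)] .
  have AEb: "AE X in lebesgue_on R. X \<in> K \<longrightarrow> \<bar>A X\<bar> \<le> N \<and> \<bar>B X\<bar> \<le> N \<and> \<bar>C X\<bar> \<le> N \<and> \<bar>D X\<bar> \<le> N"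
  proof (rule AE_R, rule eventually_mono[OF M(2)], intro impI)
    fix X :: "(real ^ 'm) \<times> (real ^ 'k)"
    assume "\<forall>y. (fst X, y) \<in> K \<longrightarrow> bounds M (fst X, y)" and X: "X \<in> K"
    then have "bounds M X" by (metis prod.collapse)
    then show "\<bar>A X\<bar> \<le> N \<and> \<bar>B X\<bar> \<le> N \<and> \<bar>C X\<bar> \<le> N \<and> \<bar>D X\<bar> \<le> N"
      using bd(2-5)[OF X] N(2-5) by (meson order_trans)
  qed
  have int: "integrable (lebesgue_on R) A" "integrable (lebesgue_on R) B" "integrable (lebesgue_on R) C" "integrable (lebesgue_on R) D"
    by (rule integrable_on_compact[OF _ K(1), where N=N];
        use zero AEb in \<open>auto elim!: eventually_mono\<close>)+
  have "(LINT X|lebesgue_on \<Omega>. \<alpha> (fst X) * norm (grad u X) powr (p (fst X) - 2) * (grad u X \<bullet> grad \<psi> X)) =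
     (LINT X|lebesgue_on \<Omega>. f (fst X) (u X) * \<psi> X)"
    using weak test_fun_mono[OF \<psi> R_subset] unfolding weak_solution_def by blast
  then have "(LINT X|lebesgue_on \<Omega>. B X) = (LINT X|lebesgue_on \<Omega>. D X)" by (simp add: B_def D_def wt_def)
  then have BD: "(LINT X|lebesgue_on R. B X) = (LINT X|lebesgue_on R. D X)"
    using integral_\<Omega>_R(1)[of B] integral_\<Omega>_R(1)[of D] zero K by (metis subsetD)
  show ?thesis
    using 0 BD int by (simp add: A_def[symmetric] C_def[symmetric])
qed

end

section \<open>Extension by zero and the cutoff\<close>

text \<open>\<open>V\<close> and the complement of \<open>K\<close> are open, cover the space, and
  the extended function is C^1 on each. The case distinction also discards whatever values
  \<open>g\<close> has outside \<open>V\<close>.\<close>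

lemma Ck_on_1_extension:
  fixes g :: "'a::euclidean_space \<Rightarrow> real"
  assumes V: "open V" and K: "compact K" "K \<subseteq> V" and g: "\<And>X. X \<in> V \<Longrightarrow> GDERIV g X :> G X"
    and G: "continuous_on V G" and z: "\<And>X. X \<in> V \<Longrightarrow> X \<notin> K \<Longrightarrow> g X = 0"
  shows "Ck_on 1 UNIV (\<lambda>X. if X \<in> V then g X else 0)"
    and "X \<in> V \<Longrightarrow> grad (\<lambda>X. if X \<in> V then g X else 0) X = G X"
proof -
  let ?g = "\<lambda>X. if X \<in> V then g X else 0"
  have oK: "open (- K)" using K compact_imp_closed by auto
  have D1: "GDERIV ?g X :> G X" if "X \<in> V" for X
    by (rule GDERIV_cong_open[OF g[OF that] V that]) auto
  have D2: "GDERIV ?g X :> 0" if "X \<in> - K" for X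
    by (rule GDERIV_cong_open[OF GDERIV_const[of 0] oK that]) (use z in auto)
  show "X \<in> V \<Longrightarrow> grad ?g X = G X" by (rule grad_eqI[OF D1])
  have U: "V \<union> - K = UNIV" using K by auto
  have "continuous_on V (grad ?g)"
    by (rule continuous_on_eq[OF G]) (simp add: grad_eqI[OF D1])
  moreover have "continuous_on (- K) (grad ?g)"
    by (rule continuous_on_eq[OF continuous_on_const[of _ 0]]) (simp add: grad_eqI[OF D2])
  ultimately have "continuous_on (V \<union> - K) (grad ?g)" by (rule continuous_on_open_Un[OF V oK])
  moreover have "?g differentiable (at X)" for X
    using D1[of X] D2[of X] K GDERIV_imp_differentiable by blast
  ultimately show "Ck_on 1 UNIV ?g" unfolding Ck_on_1_iff U by blast
qed

text \<open>
  This cutoff is only used for \<open>t > 0\<close>, where it vanishes up to \<open>1 / (n + 1)\<close>; its value at \<open>0\<close> is the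
  junk value \<open>1\<close>. Multiplied by \<open>t\<close>, its derivative stays bounded and tends to \<open>0\<close> as \<open>n \<rightarrow> \<infinity>\<close>.
\<close>

definition cutoff :: "nat \<Rightarrow> real \<Rightarrow> real" where
  "cutoff n t = (max 0 (1 - 1 / (real (Suc n) * t)))\<^sup>2"

definition cutoff_deriv :: "nat \<Rightarrow> real \<Rightarrow> real" where
  "cutoff_deriv n t = 2 * max 0 (1 - 1 / (real (Suc n) * t)) * (1 / (real (Suc n) * t\<^sup>2))"

text \<open>The reason for the square in the cutoff: the positive part has a corner at 0, its square
  is C^1.\<close>

lemma DERIV_max_sq: "((\<lambda>r::real. (max 0 r)\<^sup>2) has_real_derivative 2 * max 0 r) (at r)"
proof -
  consider "r > 0" | "r < 0" | "r = 0" by linarith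
  then show ?thesis
  proof cases
    case 1
    have "\<forall>\<^sub>F s in nhds r. s\<^sup>2 = (max 0 s)\<^sup>2"
      using eventually_nhds_in_open[of "{0<..}" r] 1 by (auto elim!: eventually_mono)
    moreover have "((\<lambda>s. s\<^sup>2) has_real_derivative 2 * max 0 r) (at r)"
      using 1 by (auto intro!: derivative_eq_intros)
    ultimately show ?thesis by (subst DERIV_cong_ev[OF refl _ refl, symmetric])
  next
    case 2
    have "\<forall>\<^sub>F s in nhds r. 0 = (max 0 s)\<^sup>2"
      using eventually_nhds_in_open[of "{..<0}" r] 2 by (auto elim!: eventually_mono)
    moreover have "((\<lambda>s. 0) has_real_derivative 2 * max 0 r) (at r)" using 2 by simp
    ultimately show ?thesis by (subst DERIV_cong_ev[OF refl _ refl, symmetric])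
  next
    case 3
    have "((\<lambda>h::real. max 0 h) \<longlongrightarrow> max 0 0) (at 0)" by (intro tendsto_intros)
    moreover have "(max 0 (0 + h))\<^sup>2 - (max 0 0)\<^sup>2 = max 0 h * h" for h :: real
      by (simp add: max_def power2_eq_square)
    then have "\<forall>\<^sub>F h in at (0::real). max 0 h = ((max 0 (0 + h))\<^sup>2 - (max 0 0)\<^sup>2) / h"
      by (simp add: eventually_at_filter)
    ultimately show ?thesis using 3 unfolding DERIV_def
      by (auto intro: Lim_transform_eventually)
  qed
qed

lemma DERIV_cutoff:
  assumes "t > 0" shows "(cutoff n has_real_derivative cutoff_deriv n t) (at t)"
proof -
  have "((\<lambda>t. 1 - 1 / (real (Suc n) * t)) has_real_derivative 1 / (real (Suc n) * t\<^sup>2)) (at t)"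
  proof -
    have "((\<lambda>t. 1 / t) has_real_derivative - (1 / t\<^sup>2)) (at t)"
      using assms by (auto intro!: derivative_eq_intros simp: power2_eq_square)
    from DERIV_diff[OF DERIV_const[of 1] DERIV_cmult[OF this, of "1 / real (Suc n)"]]
    show ?thesis by simp
  qed
  from DERIV_chain2[OF DERIV_max_sq this] show ?thesis
    unfolding cutoff_def[abs_def] cutoff_deriv_def .
qed

text \<open>With \<open>r n\<close> the positive part of 1 - 1/((n+1) t), the product of t and the
  derivative is 2 \<open>r n\<close> / ((n+1) t). Wherever \<open>r n\<close> is not 0 the quotient
  1/((n+1) t) is below 1, which gives the bound 2 and the lower bound for t.\<close>

lemma cutoff_props:
  assumes t: "t > 0"
  shows "0 \<le> cutoff n t" "cutoff n t \<le> 1" "0 \<le> t * cutoff_deriv n t" "t * cutoff_deriv n t \<le> 2"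
    "cutoff n t = 0 \<Longrightarrow> t * cutoff_deriv n t = 0" "cutoff n t \<noteq> 0 \<Longrightarrow> inverse (real (Suc n)) \<le> t"
    "(\<lambda>n. cutoff n t) \<longlonglongrightarrow> 1" "(\<lambda>n. t * cutoff_deriv n t) \<longlonglongrightarrow> 0"
proof -
  define r where "r n = max 0 (1 - 1 / (real (Suc n) * t))" for n
  have s: "real (Suc n) * t > 0" for n using t by simp
  have r: "0 \<le> r n" "r n \<le> 1" for n using s[of n] by (auto simp: r_def)
  have c: "cutoff n t = (r n)\<^sup>2" for n by (simp add: cutoff_def r_def)
  have d: "t * cutoff_deriv n t = 2 * r n * (1 / (real (Suc n) * t))" for n
    using t by (simp add: cutoff_deriv_def r_def power2_eq_square)
  show "0 \<le> cutoff n t" "cutoff n t \<le> 1" using r[of n] by (auto simp: c power_le_one)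
  show "0 \<le> t * cutoff_deriv n t" using r[of n] t by (simp add: d)
  show "cutoff n t = 0 \<Longrightarrow> t * cutoff_deriv n t = 0" by (simp add: c d)
  have lt: "1 / (real (Suc n) * t) < 1" if "r n \<noteq> 0"
  proof (rule ccontr)
    assume "\<not> 1 / (real (Suc n) * t) < 1"
    then have "1 - 1 / (real (Suc n) * t) \<le> 0" by linarith
    then show False using that unfolding r_def by (simp only: max_absorb1)
  qed
  show "t * cutoff_deriv n t \<le> 2"
  proof (cases "r n = 0")
    case False
    have "r n * (1 / (real (Suc n) * t)) \<le> 1 * 1"
      using lt[OF False] r[of n] s[of n] by (intro mult_mono) auto
    then show ?thesis unfolding d by linarith
  qed (simp add: d)
  show "inverse (real (Suc n)) \<le> t" if "cutoff n t \<noteq> 0"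
  proof -
    have "1 / (real (Suc n) * t) < 1" using that lt by (auto simp: c)
    then have "1 < real (Suc n) * t" using s[of n] by (simp only: divide_less_eq_1_pos)
    then show ?thesis by (simp add: inverse_eq_divide pos_divide_le_eq mult.commute del: of_nat_Suc)
  qed
  have l: "(\<lambda>n. 1 / (real (Suc n) * t)) \<longlonglongrightarrow> 0"
    using tendsto_mult[OF LIMSEQ_inverse_real_of_nat tendsto_const[of "inverse t"]]
    by (simp add: divide_inverse inverse_mult_distrib)
  have rl: "r \<longlonglongrightarrow> 1"
    using tendsto_max[OF tendsto_const[of 0] tendsto_diff[OF tendsto_const[of 1] l]]
    by (simp add: r_def[abs_def] del: of_nat_Suc)
  show "(\<lambda>n. cutoff n t) \<longlonglongrightarrow> 1" unfolding c using tendsto_power[OF rl, of 2] by simp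
  show "(\<lambda>n. t * cutoff_deriv n t) \<longlonglongrightarrow> 0" unfolding d using tendsto_mult[OF tendsto_mult[OF tendsto_const[of 2] rl] l] by simp
qed

section \<open>From smooth to C^1 test functions\<close>

context stable_weak_solution
begin

lemma tendsto_bil:
  "v \<longlonglongrightarrow> v0 \<Longrightarrow> w \<longlonglongrightarrow> w0 \<Longrightarrow> (\<lambda>n. bil X (v n) (w n)) \<longlonglongrightarrow> bil X v0 w0"
  unfolding bil_def divide_inverse by (intro tendsto_intros)

lemma measurable_Ck:
  assumes "Ck_on 1 UNIV \<xi>"
  shows "\<xi> \<in> borel_measurable (lebesgue_on R)" "grad \<xi> \<in> borel_measurable (lebesgue_on R)"
proof -
  have "continuous_on UNIV (grad \<xi>)" "continuous_on UNIV \<xi>"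
    using assms[unfolded Ck_on_1_iff]
    by (auto intro!: continuous_at_imp_continuous_on differentiable_imp_continuous_within)
  then have "continuous_on R (grad \<xi>)" "continuous_on R \<xi>" using continuous_on_subset by blast+
  then show "\<xi> \<in> borel_measurable (lebesgue_on R)" "grad \<xi> \<in> borel_measurable (lebesgue_on R)"
    by (auto intro: continuous_measurable_R)
qed

lemma test_fun_Ck1: "test_fun V \<xi> \<Longrightarrow> Ck_on 1 UNIV \<xi>"
  by (simp add: test_fun_def)

text \<open>Mollification keeps all supports in one compact subset \<open>K'\<close> of
  \<open>\<R>\<close>, where the Hessian is bounded; dominated convergence then passes to the limit
  on both sides.\<close>

lemma linearized:
  assumes \<xi>: "Ck_on 1 UNIV \<xi>" "compact K" "K \<subseteq> R" "\<And>X. X \<notin> K \<Longrightarrow> \<xi> X = 0" and e: "e \<in> Basis" "fst e = 0"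
  shows "(LINT X|lebesgue_on R. bil X (hess u X e) (grad \<xi> X)) =
    (LINT X|lebesgue_on R. fu X * (grad u X \<bullet> e) * \<xi> X)"
    and "integrable (lebesgue_on R) (\<lambda>X. bil X (hess u X e) (grad \<xi> X))"
    and "integrable (lebesgue_on R) (\<lambda>X. fu X * (grad u X \<bullet> e) * \<xi> X)"
proof -
  obtain \<zeta> K' B where \<zeta>: "compact K'" "K' \<subseteq> R" "\<And>n. test_fun R (\<zeta> n)"
    "\<And>n X. X \<notin> K' \<Longrightarrow> \<zeta> n X = 0" "\<And>n X. \<bar>\<zeta> n X\<bar> \<le> B" "\<And>n X. norm (grad (\<zeta> n) X) \<le> B"
    "\<And>X. (\<lambda>n. \<zeta> n X) \<longlonglongrightarrow> \<xi> X" "\<And>X. (\<lambda>n. grad (\<zeta> n) X) \<longlonglongrightarrow> grad \<xi> X"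
    by (rule C1_approx_test_fun[OF open_R \<xi>(2,3,1,4)]) (assumption, rule that, assumption+)
  have g0: "grad (\<zeta> n) X = 0" if "X \<notin> K'" for n X
    using grad_zero_outside[OF compact_imp_closed[OF \<zeta>(1)] \<zeta>(4) that] .
  have B: "0 \<le> B" using \<zeta>(5)[of 0 0] by linarith
  obtain M where M: "M \<ge> 0" "AE X in lebesgue_on R. X \<in> K' \<longrightarrow> bounds M X"
    by (rule coefficient_bounds_R[OF \<zeta>(1) subset_trans[OF \<zeta>(2) R_subset]])
  obtain d1 where d1: "d1 \<ge> 0" "\<And>X. X \<in> K' \<Longrightarrow> norm (grad u X) \<le> d1"
    using bounded_on_compact[OF cont_grad_R \<zeta>(1,2)] by blast
  obtain d2 where d2: "d2 \<ge> 0" "\<And>X. X \<in> K' \<Longrightarrow> norm (hess u X e) \<le> d2"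
    using bounded_on_compact[OF cont_hess \<zeta>(1,2)] by blast
  note [measurable] = measurable_Ck[OF \<xi>(1)] measurable_Ck[OF test_fun_Ck1[OF \<zeta>(3)]]
    continuous_measurable_R[OF cont_hess[of e]]
  have 1: "AE X in lebesgue_on R. (\<lambda>n. bil X (hess u X e) (grad (\<zeta> n) X)) \<longlonglongrightarrow> bil X (hess u X e) (grad \<xi> X)"
    by (intro always_eventually allI tendsto_bil tendsto_const \<zeta>)
  have 2: "AE X in lebesgue_on R. norm (bil X (hess u X e) (grad (\<zeta> n) X)) \<le> (M * d2 * B) * indicator K' X" for n
    using M(2)
  proof (rule eventually_mono)
    fix X assume a: "X \<in> K' \<longrightarrow> bounds M X"
    show "norm (bil X (hess u X e) (grad (\<zeta> n) X)) \<le> (M * d2 * B) * indicator K' X"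
    proof (cases "X \<in> K'")
      case True
      have "\<bar>bil X (hess u X e) (grad (\<zeta> n) X)\<bar> \<le> M * norm (hess u X e) * norm (grad (\<zeta> n) X)" by (rule boundsD(2)[OF mp[OF a True]])
      also have "\<dots> \<le> M * d2 * B" using M(1) d2 \<zeta>(6) B True by (intro mult_mono) auto
      finally show ?thesis using True by simp
    qed (simp add: g0 bil_def)
  qed
  have 3: "AE X in lebesgue_on R. (\<lambda>n. fu X * (grad u X \<bullet> e) * \<zeta> n X) \<longlonglongrightarrow> fu X * (grad u X \<bullet> e) * \<xi> X"
    by (intro always_eventually allI tendsto_mult tendsto_const \<zeta>)
  have 4: "AE X in lebesgue_on R. norm (fu X * (grad u X \<bullet> e) * \<zeta> n X) \<le> (M * d1 * B) * indicator K' X" for n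
    using M(2)
  proof (rule eventually_mono)
    fix X assume a: "X \<in> K' \<longrightarrow> bounds M X"
    show "norm (fu X * (grad u X \<bullet> e) * \<zeta> n X) \<le> (M * d1 * B) * indicator K' X"
    proof (cases "X \<in> K'")
      case True
      then have "\<bar>grad u X \<bullet> e\<bar> \<le> d1" "\<bar>fu X\<bar> \<le> M"
        using Basis_le_norm[OF e(1), of "grad u X"] d1(2)[of X] boundsD(4)[OF mp[OF a]] by auto
      then have "\<bar>fu X\<bar> * \<bar>grad u X \<bullet> e\<bar> * \<bar>\<zeta> n X\<bar> \<le> M * d1 * B"
        using M(1) d1(1) \<zeta>(5) by (intro mult_mono) auto
      then show ?thesis using True by (simp add: abs_mult)
    qed (simp add: \<zeta>(4))
  qed
  have m1: "(\<lambda>X. bil X (hess u X e) (grad \<xi> X)) \<in> borel_measurable (lebesgue_on R)"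
    "\<And>n. (\<lambda>X. bil X (hess u X e) (grad (\<zeta> n) X)) \<in> borel_measurable (lebesgue_on R)"
    "(\<lambda>X. fu X * (grad u X \<bullet> e) * \<xi> X) \<in> borel_measurable (lebesgue_on R)"
    "\<And>n. (\<lambda>X. fu X * (grad u X \<bullet> e) * \<zeta> n X) \<in> borel_measurable (lebesgue_on R)"
    by measurable
  note D1 = m1(1,2) integrable_bound_compact[OF \<zeta>(1)] 1 2 and D2 = m1(3,4) integrable_bound_compact[OF \<zeta>(1)] 3 4
  show "integrable (lebesgue_on R) (\<lambda>X. bil X (hess u X e) (grad \<xi> X))" by (rule integrable_dominated_convergence[OF D1])
  show "integrable (lebesgue_on R) (\<lambda>X. fu X * (grad u X \<bullet> e) * \<xi> X)" by (rule integrable_dominated_convergence[OF D2])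
  have "(\<lambda>n. LINT X|lebesgue_on R. bil X (hess u X e) (grad (\<zeta> n) X)) \<longlonglongrightarrow> (LINT X|lebesgue_on R. fu X * (grad u X \<bullet> e) * \<xi> X)"
    using integral_dominated_convergence[OF D2] linearized_test[OF \<zeta>(3) e] by simp
  then show "(LINT X|lebesgue_on R. bil X (hess u X e) (grad \<xi> X)) =
    (LINT X|lebesgue_on R. fu X * (grad u X \<bullet> e) * \<xi> X)"
    by (rule LIMSEQ_unique[OF integral_dominated_convergence[OF D1]])
qed

text \<open>For test functions supported in \<open>\<R>\<close> the integrand vanishes outside
  \<open>\<R>\<close>, and inside the gradient of u is not 0, so \<open>bil\<close> represents
  \<open>\<B>\<close>.\<close>

lemma stability_test:
  assumes \<xi>: "test_fun R \<xi>"
  shows "0 \<le> (LINT X|lebesgue_on R. bil X (grad \<xi> X) (grad \<xi> X) - fu X * (\<xi> X)\<^sup>2)"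
proof -
  let ?g = "\<lambda>X. matrix_form (\<B> \<alpha> p (fst X) (grad u X)) (grad \<xi> X) (grad \<xi> X) - deriv (f (fst X)) (u X) * (\<xi> X)\<^sup>2"
  have "0 \<le> (LINT X|lebesgue_on \<Omega>. ?g X)"
    using stable test_fun_mono[OF \<xi> R_subset] unfolding stable_solution_def by blast
  also have "\<dots> = (LINT X|lebesgue_on R. ?g X)"
  proof (rule integral_\<Omega>_R(1))
    fix X assume "X \<notin> R"
    then have "X \<notin> closure {X. \<xi> X \<noteq> 0}" using test_funD(2)[OF \<xi>] by blast
    then have "\<xi> X = 0" "grad \<xi> X = 0" by (rule test_funD(4)[OF \<xi>], rule test_funD(5)[OF \<xi>])
    then show "?g X = 0" by (simp add: matrix_form_def)
  qed
  also have "\<dots> = (LINT X|lebesgue_on R. bil X (grad \<xi> X) (grad \<xi> X) - fu X * (\<xi> X)\<^sup>2)"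
    by (intro Bochner_Integration.integral_cong) (auto simp: bil_eq_matrix_form R_grad fu_def)
  finally show ?thesis .
qed

lemma stability:
  assumes \<xi>: "Ck_on 1 UNIV \<xi>" "compact K" "K \<subseteq> R" "\<And>X. X \<notin> K \<Longrightarrow> \<xi> X = 0"
  shows "0 \<le> (LINT X|lebesgue_on R. bil X (grad \<xi> X) (grad \<xi> X) - fu X * (\<xi> X)\<^sup>2)"
proof -
  obtain \<zeta> K' B where \<zeta>: "compact K'" "K' \<subseteq> R" "\<And>n. test_fun R (\<zeta> n)"
    "\<And>n X. X \<notin> K' \<Longrightarrow> \<zeta> n X = 0" "\<And>n X. \<bar>\<zeta> n X\<bar> \<le> B" "\<And>n X. norm (grad (\<zeta> n) X) \<le> B"
    "\<And>X. (\<lambda>n. \<zeta> n X) \<longlonglongrightarrow> \<xi> X" "\<And>X. (\<lambda>n. grad (\<zeta> n) X) \<longlonglongrightarrow> grad \<xi> X"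
    by (rule C1_approx_test_fun[OF open_R \<xi>(2,3,1,4)]) (assumption, rule that, assumption+)
  have g0: "grad (\<zeta> n) X = 0" if "X \<notin> K'" for n X
    using grad_zero_outside[OF compact_imp_closed[OF \<zeta>(1)] \<zeta>(4) that] .
  have B: "0 \<le> B" using \<zeta>(5)[of 0 0] by linarith
  obtain M where M: "M \<ge> 0" "AE X in lebesgue_on R. X \<in> K' \<longrightarrow> bounds M X"
    by (rule coefficient_bounds_R[OF \<zeta>(1) subset_trans[OF \<zeta>(2) R_subset]])
  note [measurable] = measurable_Ck[OF \<xi>(1)] measurable_Ck[OF test_fun_Ck1[OF \<zeta>(3)]]
  have 1: "AE X in lebesgue_on R. (\<lambda>n. bil X (grad (\<zeta> n) X) (grad (\<zeta> n) X) - fu X * (\<zeta> n X)\<^sup>2)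
      \<longlonglongrightarrow> bil X (grad \<xi> X) (grad \<xi> X) - fu X * (\<xi> X)\<^sup>2"
    by (intro always_eventually allI tendsto_bil tendsto_intros \<zeta>)
  have 2: "AE X in lebesgue_on R. norm (bil X (grad (\<zeta> n) X) (grad (\<zeta> n) X) - fu X * (\<zeta> n X)\<^sup>2)
      \<le> (M * B * B + M * B\<^sup>2) * indicator K' X" for n
    using M(2)
  proof (rule eventually_mono)
    fix X assume a: "X \<in> K' \<longrightarrow> bounds M X"
    show "norm (bil X (grad (\<zeta> n) X) (grad (\<zeta> n) X) - fu X * (\<zeta> n X)\<^sup>2) \<le> (M * B * B + M * B\<^sup>2) * indicator K' X"
    proof (cases "X \<in> K'")
      case True
      have "\<bar>bil X (grad (\<zeta> n) X) (grad (\<zeta> n) X)\<bar> \<le> M * norm (grad (\<zeta> n) X) * norm (grad (\<zeta> n) X)" by (rule boundsD(2)[OF mp[OF a True]])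
      also have "\<dots> \<le> M * B * B" using M(1) \<zeta>(6) B by (intro mult_mono) auto
      finally have "\<bar>bil X (grad (\<zeta> n) X) (grad (\<zeta> n) X)\<bar> \<le> M * B * B" .
      moreover have "\<bar>fu X * (\<zeta> n X)\<^sup>2\<bar> \<le> M * B\<^sup>2"
        unfolding abs_mult using boundsD(4)[OF mp[OF a True]] M(1) power_mono[OF \<zeta>(5), of n X 2] by (intro mult_mono) auto
      ultimately show ?thesis using True by simp
    qed (simp add: g0 \<zeta>(4) bil_def)
  qed
  have m1: "(\<lambda>X. bil X (grad \<xi> X) (grad \<xi> X) - fu X * (\<xi> X)\<^sup>2) \<in> borel_measurable (lebesgue_on R)"
    "\<And>n. (\<lambda>X. bil X (grad (\<zeta> n) X) (grad (\<zeta> n) X) - fu X * (\<zeta> n X)\<^sup>2) \<in> borel_measurable (lebesgue_on R)"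
    by measurable
  have "(\<lambda>n. LINT X|lebesgue_on R. bil X (grad (\<zeta> n) X) (grad (\<zeta> n) X) - fu X * (\<zeta> n X)\<^sup>2)
     \<longlonglongrightarrow> (LINT X|lebesgue_on R. bil X (grad \<xi> X) (grad \<xi> X) - fu X * (\<xi> X)\<^sup>2)"
    by (rule integral_dominated_convergence[OF m1 integrable_bound_compact[OF \<zeta>(1)] 1 2])
  then show ?thesis using stability_test[OF \<zeta>(3)] by (intro LIMSEQ_le_const) auto
qed

end

section \<open>The inequality for the quadratic forms and its geometric version\<close>

lemma basis_y: "(0, axis j 1) \<in> (Basis :: ((real ^ 'm) \<times> (real ^ 'k)) set)"
  by (auto simp: Basis_prod_def Basis_vec_def)

context stable_weak_solution
begin

abbreviation w where "w X \<equiv> norm (snd (grad u X))"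
abbreviation h where "h j X \<equiv> hess u X (0, axis j 1)"

lemma w_pos: "X \<in> R \<Longrightarrow> 0 < w X" by (simp add: R_iff)

lemma cont_w: "continuous_on \<Omega> w"
  by (intro continuous_intros cont_grad)

lemma cont_w_R: "continuous_on R w"
  by (rule continuous_on_subset[OF cont_w R_subset])

lemma cont_normal_hess: "continuous_on R (normal_hess u)"
proof -
  have "continuous_on R (\<lambda>X. \<Sum>j\<in>UNIV. ((snd (grad u X) /\<^sub>R w X) $ j) *\<^sub>R h j X)"
    by (intro continuous_intros cont_hess cont_grad_R) (use w_pos in force)
  then show ?thesis
    by (rule continuous_on_eq) (simp only: hess_y_sum normal_hess_def level_normal_u(1))
qed

lemma GDERIV_w: "X \<in> R \<Longrightarrow> GDERIV w X :> normal_hess u X"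
  by (rule GDERIV_norm_grad_y)

lemma GDERIV_cutoff: "X \<in> R \<Longrightarrow> GDERIV (\<lambda>X. cutoff n (w X)) X :> cutoff_deriv n (w X) *\<^sub>R normal_hess u X"
  by (rule GDERIV_DERIV_compose[OF GDERIV_w DERIV_cutoff[OF w_pos]])

lemma cont_cutoff: "continuous_on R (\<lambda>X. cutoff n (w X))" "continuous_on R (\<lambda>X. cutoff_deriv n (w X))"
  unfolding cutoff_def cutoff_deriv_def
  by (intro continuous_intros cont_w_R; use w_pos in force)+

lemma GDERIV_partial: "X \<in> R \<Longrightarrow> GDERIV (\<lambda>X. grad u X \<bullet> (0, axis j 1)) X :> h j X"
proof -
  assume X: "X \<in> R"
  have "(\<lambda>Z. grad u Z \<bullet> (0, axis j 1)) differentiable (at X)"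
    unfolding differentiable_def using has_derivative_inner_left[OF hess_deriv[OF X]] by blast
  from GDERIV_grad[OF this] show ?thesis unfolding hess_Basis_R[OF X basis_y] .
qed

text \<open>The first identity is half the gradient of the second. It turns the sum over j of the
  linearised equations into terms with w and its gradient only.\<close>

lemma sum_partials:
  assumes X: "X \<in> R"
  shows "(\<Sum>j\<in>UNIV. (grad u X \<bullet> (0, axis j 1)) *\<^sub>R h j X) = w X *\<^sub>R normal_hess u X"
    "(\<Sum>j\<in>UNIV. (grad u X \<bullet> (0, axis j 1))\<^sup>2) = (w X)\<^sup>2"
proof -
  have c: "grad u X \<bullet> (0, axis j 1) = snd (grad u X) $ j" for j by (simp add: inner_prod_def inner_axis)
  have "hess u X (0, snd (grad u X)) = hess u X (w X *\<^sub>R (0, level_normal u X))"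
    using level_normal_u(3)[OF X] by (metis scaleR_Pair scaleR_zero_right)
  then show "(\<Sum>j\<in>UNIV. (grad u X \<bullet> (0, axis j 1)) *\<^sub>R h j X) = w X *\<^sub>R normal_hess u X"
    unfolding c hess_y_sum[OF X] normal_hess_def by (simp only: linear_cmul[OF linear_hess])
  show "(\<Sum>j\<in>UNIV. (grad u X \<bullet> (0, axis j 1))\<^sup>2) = (w X)\<^sup>2"
    unfolding c by (simp add: vec_norm_sq)
qed

text \<open>Supplies the supports of the cut-off test functions: \<open>w\<close> is continuous on
  all of \<open>\<Omega>\<close>, so a positive lower bound keeps the set closed in \<open>K\<close>
  and away from the boundary of \<open>\<R>\<close>.\<close>

lemma compact_superlevel:
  assumes K: "compact K" "K \<subseteq> \<Omega>" and c: "c > 0"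
  shows "compact {X \<in> K. c \<le> w X}" "{X \<in> K. c \<le> w X} \<subseteq> R"
proof -
  have "closedin (top_of_set K) (K \<inter> w -` {c..})"
    using continuous_on_subset[OF cont_w K(2)] by (rule continuous_closedin_preimage) simp
  moreover have "K \<inter> w -` {c..} = {X \<in> K. c \<le> w X}" by auto
  ultimately show "compact {X \<in> K. c \<le> w X}" using closedin_compact[OF K(1)] by simp
  show "{X \<in> K. c \<le> w X} \<subseteq> R" using K(2) c by (auto simp: R_iff)
qed

lemma poincare_inequality:
  assumes \<phi>: "test_fun \<Omega> \<phi>"
  defines "Q \<equiv> \<lambda>X. (\<Sum>j\<in>UNIV. bil X (h j X) (h j X)) - bil X (normal_hess u X) (normal_hess u X)"
    and "P \<equiv> \<lambda>X. bil X (grad \<phi> X) (grad \<phi> X)"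
  shows "integrable (lebesgue_on R) (\<lambda>X. (\<phi> X)\<^sup>2 * Q X)" "integrable (lebesgue_on R) (\<lambda>X. (w X)\<^sup>2 * P X)"
    and "(LINT X|lebesgue_on R. (\<phi> X)\<^sup>2 * Q X) \<le> (LINT X|lebesgue_on R. (w X)\<^sup>2 * P X)"
proof -
  define K where "K = closure {X. \<phi> X \<noteq> 0}"
  note tf = test_funD[OF \<phi>, folded K_def]
  have K: "compact K" "K \<subseteq> \<Omega>" using tf(1,2) by auto
  define N where "N X = normal_hess u X" for X
  define E where "E X = (\<Sum>j\<in>UNIV. bil X (h j X) (h j X))" for X
  define W where "W X = bil X (N X) (N X)" for X
  define Z where "Z X = bil X (N X) (grad \<phi> X)" for X
  define a where "a n X = cutoff n (w X)" for n X
  define d where "d n X = w X * cutoff_deriv n (w X)" for n X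
  define Kn where "Kn n = {X \<in> K. inverse (real (Suc n)) \<le> w X}" for n
  have Kn: "compact (Kn n)" "Kn n \<subseteq> R" for n
    using compact_superlevel[OF K, of "inverse (real (Suc n))"] by (simp_all add: Kn_def)
  have a0: "a n X = 0 \<or> \<phi> X = 0" if "X \<in> R" "X \<notin> Kn n" for n X
    using cutoff_props(6)[OF w_pos[OF that(1)], of n] tf(4)[of X] that(2) by (auto simp: Kn_def a_def)
  have \<phi>c: "continuous_on R \<phi>" "continuous_on R (grad \<phi>)"
  proof -
    have "continuous_on UNIV \<phi>" "continuous_on UNIV (grad \<phi>)"
      using tf(3)[of 0] test_fun_Ck1[OF \<phi>, unfolded Ck_on_1_iff] by auto
    then show "continuous_on R \<phi>" "continuous_on R (grad \<phi>)" using continuous_on_subset by blast+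
  qed
  have \<phi>g: "GDERIV \<phi> X :> grad \<phi> X" for X
    using test_fun_Ck1[OF \<phi>, unfolded Ck_on_1_iff] GDERIV_grad by blast
  have Nc: "continuous_on R N" unfolding N_def by (rule cont_normal_hess)
  note [measurable] = measurable_Ck[OF test_fun_Ck1[OF \<phi>]] continuous_measurable_R[OF cont_w_R]
    continuous_measurable_R[OF cont_hess] continuous_measurable_R[OF Nc]
    continuous_measurable_R[OF cont_cutoff(1)] continuous_measurable_R[OF cont_cutoff(2)]
  have m: "E \<in> borel_measurable (lebesgue_on R)" "W \<in> borel_measurable (lebesgue_on R)"
    "Z \<in> borel_measurable (lebesgue_on R)" "P \<in> borel_measurable (lebesgue_on R)"
    "a n \<in> borel_measurable (lebesgue_on R)" "d n \<in> borel_measurable (lebesgue_on R)" for n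
    unfolding E_def[abs_def] W_def[abs_def] Z_def[abs_def] P_def a_def[abs_def] d_def[abs_def] by measurable
  note [measurable] = m
  \<comment> \<open>The gradient of w is the combination of the gradients of the u_j with
    coefficients \<nu>_j. Summing the nonnegative form over the vectors \<open>h j X\<close> minus
    \<nu>_j \<open>N X\<close> gives \<open>E X - W X\<close>, because |\<nu>| = 1.\<close>
  have WE: "W X \<le> E X" if X: "X \<in> R" for X
  proof -
    have Neq: "N X = (\<Sum>j\<in>UNIV. (level_normal u X $ j) *\<^sub>R h j X)"
      by (simp add: N_def normal_hess_def hess_y_sum[OF X])
    have n1: "(\<Sum>j\<in>UNIV. (level_normal u X $ j)\<^sup>2) = 1"
      using level_normal_u(2)[OF X] by (simp add: vec_norm_sq[symmetric])
    have "0 \<le> (\<Sum>j\<in>UNIV. bil X (1 *\<^sub>R h j X + (- (level_normal u X $ j)) *\<^sub>R N X) (1 *\<^sub>R h j X + (- (level_normal u X $ j)) *\<^sub>R N X))"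
      by (intro sum_nonneg bil_nonneg)
    also have "\<dots> = (\<Sum>j\<in>UNIV. bil X (h j X) (h j X) - 2 * ((level_normal u X $ j) * bil X (h j X) (N X)) + (level_normal u X $ j)\<^sup>2 * W X)"
      unfolding bil_quadratic by (simp add: W_def mult.assoc)
    also have "\<dots> = E X - 2 * (\<Sum>j\<in>UNIV. (level_normal u X $ j) * bil X (h j X) (N X)) + (\<Sum>j\<in>UNIV. (level_normal u X $ j)\<^sup>2) * W X"
      by (simp add: sum.distrib sum_subtractf sum_distrib_left sum_distrib_right E_def)
    also have "(\<Sum>j\<in>UNIV. (level_normal u X $ j) * bil X (h j X) (N X)) = W X"
      unfolding W_def by (subst (2) Neq) (simp add: bil_sum_left bil_scale_left)
    finally show ?thesis using n1 by simp
  qed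
  have lin: "(LINT X|lebesgue_on R. (a n X)\<^sup>2 * (\<phi> X)\<^sup>2 * E X + 2 * a n X * d n X * (\<phi> X)\<^sup>2 * W X
        + 2 * w X * (a n X)\<^sup>2 * \<phi> X * Z X) = (LINT X|lebesgue_on R. fu X * (w X)\<^sup>2 * (\<phi> X)\<^sup>2 * (a n X)\<^sup>2)" for n
  proof -
    define q where "q X = a n X *\<^sub>R grad \<phi> X + \<phi> X *\<^sub>R (cutoff_deriv n (w X) *\<^sub>R N X)" for X
    define b where "b X = (a n X * \<phi> X) * (a n X * \<phi> X)" for X
    define G where "G j X = (grad u X \<bullet> (0, axis j 1)) *\<^sub>R ((a n X * \<phi> X) *\<^sub>R q X + (a n X * \<phi> X) *\<^sub>R q X) + b X *\<^sub>R h j X" for j X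
    \<comment> \<open>The product of u_j with the square of the cutoff and of \<open>\<phi>\<close>.
      It has to be set to 0 off \<open>\<R>\<close>, where the cutoff takes its junk value 1 if w =
      0 and u may be arbitrary outside \<open>\<Omega>\<close>.\<close>
    define \<eta> where "\<eta> j X = (if X \<in> R then (grad u X \<bullet> (0, axis j 1)) * b X else 0)" for j X
    have dq: "GDERIV (\<lambda>X. a n X * \<phi> X) X :> q X" if "X \<in> R" for X
      unfolding q_def a_def N_def by (rule GDERIV_mult[OF GDERIV_cutoff[OF that] \<phi>g])
    have db: "GDERIV b X :> (a n X * \<phi> X) *\<^sub>R q X + (a n X * \<phi> X) *\<^sub>R q X" if "X \<in> R" for X
      unfolding b_def[abs_def] by (rule GDERIV_mult[OF dq[OF that] dq[OF that]])
    have dG: "GDERIV (\<lambda>X. (grad u X \<bullet> (0, axis j 1)) * b X) X :> G j X" if "X \<in> R" for X j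
      unfolding G_def by (rule GDERIV_mult[OF GDERIV_partial[OF that] db[OF that]])
    have Gc: "continuous_on R (G j)" for j
      unfolding G_def[abs_def] q_def b_def a_def
      by (intro continuous_intros cont_cutoff \<phi>c Nc cont_hess cont_grad_R)
    have z: "(grad u X \<bullet> (0, axis j 1)) * b X = 0" if "X \<in> R" "X \<notin> Kn n" for X j
      using a0[OF that] by (auto simp: b_def)
    have ext1: "Ck_on 1 UNIV (\<eta> j)" for j
      unfolding \<eta>_def[abs_def] by (rule Ck_on_1_extension(1)[OF open_R Kn dG Gc z])
    have ext2: "X \<in> R \<Longrightarrow> grad (\<eta> j) X = G j X" for j X
      unfolding \<eta>_def[abs_def] by (rule Ck_on_1_extension(2)[OF open_R Kn dG Gc z])
    have \<eta>0: "\<eta> j X = 0" if "X \<notin> Kn n" for j X using z that by (simp add: \<eta>_def)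
    note L = linearized[OF ext1 Kn \<eta>0 basis_y fst_conv]
    have "(LINT X|lebesgue_on R. (a n X)\<^sup>2 * (\<phi> X)\<^sup>2 * E X + 2 * a n X * d n X * (\<phi> X)\<^sup>2 * W X
        + 2 * w X * (a n X)\<^sup>2 * \<phi> X * Z X) = (LINT X|lebesgue_on R. (\<Sum>j\<in>UNIV. bil X (h j X) (grad (\<eta> j) X)))"
    proof (intro Bochner_Integration.integral_cong refl)
      fix X assume "X \<in> space (lebesgue_on R)"
      then have X: "X \<in> R" by simp
      have "(\<Sum>j\<in>UNIV. bil X (h j X) (grad (\<eta> j) X)) =
        (\<Sum>j\<in>UNIV. 2 * (a n X * \<phi> X) * bil X ((grad u X \<bullet> (0, axis j 1)) *\<^sub>R h j X) (q X) + b X * bil X (h j X) (h j X))"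
        unfolding ext2[OF X] G_def by (intro sum.cong refl)
          (simp add: bil_add_right bil_scale_right bil_scale_left algebra_simps)
      also have "\<dots> = 2 * (a n X * \<phi> X) * bil X (\<Sum>j\<in>UNIV. (grad u X \<bullet> (0, axis j 1)) *\<^sub>R h j X) (q X) + b X * E X"
        by (simp add: sum.distrib sum_distrib_left bil_sum_left E_def)
      also have "\<dots> = 2 * (a n X * \<phi> X) * (w X * (a n X * Z X + \<phi> X * cutoff_deriv n (w X) * W X)) + b X * E X"
        unfolding sum_partials(1)[OF X] q_def
        by (simp add: bil_add_right bil_scale_right bil_scale_left Z_def W_def N_def algebra_simps)
      finally show "(a n X)\<^sup>2 * (\<phi> X)\<^sup>2 * E X + 2 * a n X * d n X * (\<phi> X)\<^sup>2 * W X
        + 2 * w X * (a n X)\<^sup>2 * \<phi> X * Z X = (\<Sum>j\<in>UNIV. bil X (h j X) (grad (\<eta> j) X))"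
        by (simp add: b_def d_def power2_eq_square algebra_simps)
    qed
    also have "\<dots> = (\<Sum>j\<in>UNIV. LINT X|lebesgue_on R. fu X * (grad u X \<bullet> (0, axis j 1)) * \<eta> j X)"
      by (subst Bochner_Integration.integral_sum) (auto intro: L(2) simp: L(1))
    also have "\<dots> = (LINT X|lebesgue_on R. (\<Sum>j\<in>UNIV. fu X * (grad u X \<bullet> (0, axis j 1)) * \<eta> j X))"
      by (subst Bochner_Integration.integral_sum) (auto intro: L(3))
    also have "\<dots> = (LINT X|lebesgue_on R. fu X * (w X)\<^sup>2 * (\<phi> X)\<^sup>2 * (a n X)\<^sup>2)"
    proof (intro Bochner_Integration.integral_cong refl)
      fix X assume "X \<in> space (lebesgue_on R)"
      then have X: "X \<in> R" by simp
      have "(\<Sum>j\<in>UNIV. fu X * (grad u X \<bullet> (0, axis j 1)) * \<eta> j X) = (\<Sum>j\<in>UNIV. (grad u X \<bullet> (0, axis j 1))\<^sup>2) * (fu X * b X)"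
        unfolding sum_distrib_right using X by (intro sum.cong) (simp_all add: \<eta>_def power2_eq_square mult_ac)
      then show "(\<Sum>j\<in>UNIV. fu X * (grad u X \<bullet> (0, axis j 1)) * \<eta> j X) = fu X * (w X)\<^sup>2 * (\<phi> X)\<^sup>2 * (a n X)\<^sup>2"
        unfolding sum_partials(2)[OF X] by (simp add: b_def power2_eq_square mult_ac)
    qed
    finally show ?thesis .
  qed
  have stab: "0 \<le> (LINT X|lebesgue_on R. (a n X + d n X)\<^sup>2 * (\<phi> X)\<^sup>2 * W X
        + 2 * (a n X + d n X) * w X * a n X * \<phi> X * Z X + (w X)\<^sup>2 * (a n X)\<^sup>2 * P X
        - fu X * (w X)\<^sup>2 * (\<phi> X)\<^sup>2 * (a n X)\<^sup>2)" for n
  proof -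
    define G where "G X = (w X * a n X) *\<^sub>R grad \<phi> X + \<phi> X *\<^sub>R (w X *\<^sub>R (cutoff_deriv n (w X) *\<^sub>R N X) + a n X *\<^sub>R N X)" for X
    define \<xi> where "\<xi> X = (if X \<in> R then (w X * a n X) * \<phi> X else 0)" for X
    have dG: "GDERIV (\<lambda>X. (w X * a n X) * \<phi> X) X :> G X" if "X \<in> R" for X
      unfolding G_def a_def N_def by (rule GDERIV_mult[OF GDERIV_mult[OF GDERIV_w[OF that] GDERIV_cutoff[OF that]] \<phi>g])
    have Gc: "continuous_on R G"
      unfolding G_def[abs_def] a_def by (intro continuous_intros cont_cutoff \<phi>c Nc cont_w_R)
    have z: "(w X * a n X) * \<phi> X = 0" if "X \<in> R" "X \<notin> Kn n" for X using a0[OF that] by auto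
    have ext1: "Ck_on 1 UNIV \<xi>"
      unfolding \<xi>_def[abs_def] by (rule Ck_on_1_extension(1)[OF open_R Kn dG Gc z])
    have ext2: "X \<in> R \<Longrightarrow> grad \<xi> X = G X" for X
      unfolding \<xi>_def[abs_def] by (rule Ck_on_1_extension(2)[OF open_R Kn dG Gc z])
    have \<xi>0: "\<xi> X = 0" if "X \<notin> Kn n" for X using z that by (simp add: \<xi>_def)
    have "0 \<le> (LINT X|lebesgue_on R. bil X (grad \<xi> X) (grad \<xi> X) - fu X * (\<xi> X)\<^sup>2)"
      by (rule stability[OF ext1 Kn \<xi>0])
    also have "\<dots> = (LINT X|lebesgue_on R. (a n X + d n X)\<^sup>2 * (\<phi> X)\<^sup>2 * W X
        + 2 * (a n X + d n X) * w X * a n X * \<phi> X * Z X + (w X)\<^sup>2 * (a n X)\<^sup>2 * P X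
        - fu X * (w X)\<^sup>2 * (\<phi> X)\<^sup>2 * (a n X)\<^sup>2)"
    proof (intro Bochner_Integration.integral_cong refl)
      fix X assume "X \<in> space (lebesgue_on R)"
      then have X: "X \<in> R" by simp
      \<comment> \<open>The coefficient \<open>a n X + d n X\<close> is the derivative of t
        \<rho>(t) at t = w.\<close>
      have "grad \<xi> X = ((a n X + d n X) * \<phi> X) *\<^sub>R N X + (w X * a n X) *\<^sub>R grad \<phi> X"
        unfolding ext2[OF X] G_def d_def by (simp add: algebra_simps)
      then show "bil X (grad \<xi> X) (grad \<xi> X) - fu X * (\<xi> X)\<^sup>2 = (a n X + d n X)\<^sup>2 * (\<phi> X)\<^sup>2 * W X
        + 2 * (a n X + d n X) * w X * a n X * \<phi> X * Z X + (w X)\<^sup>2 * (a n X)\<^sup>2 * P X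
        - fu X * (w X)\<^sup>2 * (\<phi> X)\<^sup>2 * (a n X)\<^sup>2"
        using X by (simp add: bil_quadratic W_def Z_def P_def \<xi>_def power_mult_distrib mult_ac)
    qed
    finally show ?thesis .
  qed
  obtain M where M: "M \<ge> 0" "AE X in lebesgue_on R. X \<in> K \<longrightarrow> bounds M X"
    by (rule coefficient_bounds_R[OF K])
  obtain D1 where D1: "D1 \<ge> 0" "\<And>X. X \<in> K \<Longrightarrow> norm (w X) \<le> D1" using bounded_on_compact[OF cont_w K] by blast
  obtain D2 where D2: "D2 \<ge> 0" "\<And>X. X \<in> K \<Longrightarrow> norm (\<phi> X) \<le> D2"
    using bounded_on_compact[of UNIV \<phi>, OF _ K(1)] tf(3)[of 0] by auto
  obtain D3 where D3: "D3 \<ge> 0" "\<And>X. X \<in> K \<Longrightarrow> norm (grad \<phi> X) \<le> D3"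
    using bounded_on_compact[of UNIV "grad \<phi>", OF _ K(1)] test_fun_Ck1[OF \<phi>, unfolded Ck_on_1_iff] by blast
  have int1: "integrable (lebesgue_on R) (\<lambda>X. (w X)\<^sup>2 * P X)"
  proof (rule integrable_on_compact[OF _ K(1)])
    show "AE X in lebesgue_on R. X \<in> K \<longrightarrow> \<bar>(w X)\<^sup>2 * P X\<bar> \<le> D1\<^sup>2 * (M * D3 * D3)"
    proof (rule eventually_mono[OF M(2)], intro impI)
      fix X assume a: "X \<in> K \<longrightarrow> bounds M X" and X: "X \<in> K"
      have "\<bar>P X\<bar> \<le> M * norm (grad \<phi> X) * norm (grad \<phi> X)" unfolding P_def by (rule boundsD(2)[OF mp[OF a X]])
      also have "\<dots> \<le> M * D3 * D3" using M(1) D3 X by (intro mult_mono) auto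
      finally have "(w X)\<^sup>2 * \<bar>P X\<bar> \<le> D1\<^sup>2 * (M * D3 * D3)"
        using D1(2)[OF X] by (intro mult_mono power_mono) auto
      then show "\<bar>(w X)\<^sup>2 * P X\<bar> \<le> D1\<^sup>2 * (M * D3 * D3)" by (simp add: abs_mult)
    qed
  qed (measurable, simp add: P_def tf(5) bil_def)
  have int2: "integrable (lebesgue_on R) (\<lambda>X. fu X * (w X)\<^sup>2 * (\<phi> X)\<^sup>2)"
  proof (rule integrable_on_compact[OF _ K(1)])
    show "AE X in lebesgue_on R. X \<in> K \<longrightarrow> \<bar>fu X * (w X)\<^sup>2 * (\<phi> X)\<^sup>2\<bar> \<le> M * D1\<^sup>2 * D2\<^sup>2"
    proof (rule eventually_mono[OF M(2)], intro impI)
      fix X assume a: "X \<in> K \<longrightarrow> bounds M X" and X: "X \<in> K"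
      have "\<bar>\<phi> X\<bar>\<^sup>2 \<le> D2\<^sup>2" using D2(2)[OF X] by (intro power_mono) auto
      moreover have "(w X)\<^sup>2 \<le> D1\<^sup>2" using D1(2)[OF X] by (intro power_mono) auto
      ultimately have "\<bar>fu X\<bar> * (w X)\<^sup>2 * (\<phi> X)\<^sup>2 \<le> M * D1\<^sup>2 * D2\<^sup>2"
        using boundsD(4)[OF mp[OF a X]] M(1) by (intro mult_mono) auto
      then show "\<bar>fu X * (w X)\<^sup>2 * (\<phi> X)\<^sup>2\<bar> \<le> M * D1\<^sup>2 * D2\<^sup>2" by (simp add: abs_mult)
    qed
  qed (measurable, simp add: tf(4))
  \<comment> \<open>On \<open>Kn n\<close>, a compact subset of \<open>\<R>\<close>, continuity
    bounds the Hessian; on the rest of \<open>\<R>\<close> either \<open>a n X\<close> or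
    \<open>\<phi> X\<close> is 0.\<close>
  have int3: "integrable (lebesgue_on R) (\<lambda>X. if a n X = 0 then 0 else (\<phi> X)\<^sup>2 * E X)" for n
  proof -
    have "continuous_on R (\<lambda>X. \<Sum>j\<in>UNIV. norm (h j X) * norm (h j X))"
      by (intro continuous_intros cont_hess)
    then obtain D4 where D4: "D4 \<ge> 0" "\<And>X. X \<in> Kn n \<Longrightarrow> norm (\<Sum>j\<in>UNIV. norm (h j X) * norm (h j X)) \<le> D4"
      using bounded_on_compact[OF _ Kn] by blast
    show ?thesis
    proof (rule integrable_on_compact[OF _ Kn(1)[of n]])
      show "AE X in lebesgue_on R. X \<in> Kn n \<longrightarrow> \<bar>if a n X = 0 then 0 else (\<phi> X)\<^sup>2 * E X\<bar> \<le> D2\<^sup>2 * (M * D4)"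
      proof (rule eventually_mono[OF M(2)], intro impI)
        fix X assume a: "X \<in> K \<longrightarrow> bounds M X" and X: "X \<in> Kn n"
        then have XK: "X \<in> K" by (simp add: Kn_def)
        have "\<bar>E X\<bar> \<le> (\<Sum>j\<in>UNIV. \<bar>bil X (h j X) (h j X)\<bar>)" unfolding E_def by (rule sum_abs)
        also have "\<dots> \<le> (\<Sum>j\<in>UNIV. M * (norm (h j X) * norm (h j X)))"
          by (intro sum_mono order_trans[OF boundsD(2)[OF mp[OF a XK]]]) (simp add: mult.assoc)
        also have "\<dots> \<le> M * D4"
          using D4(2)[OF X] M(1) by (simp add: sum_distrib_left[symmetric] mult_left_mono)
        finally have "\<bar>\<phi> X\<bar>\<^sup>2 * \<bar>E X\<bar> \<le> D2\<^sup>2 * (M * D4)"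
          using D2(2)[OF XK] by (intro mult_mono power_mono) auto
        then show "\<bar>if a n X = 0 then 0 else (\<phi> X)\<^sup>2 * E X\<bar> \<le> D2\<^sup>2 * (M * D4)"
          using M(1) D4(1) by (simp add: abs_mult)
      qed
    qed (measurable, drule (1) a0, auto)
  qed
  have a: "\<And>n X. X \<in> space (lebesgue_on R) \<Longrightarrow> 0 \<le> a n X \<and> a n X \<le> 1"
    "\<And>X. X \<in> space (lebesgue_on R) \<Longrightarrow> (\<lambda>n. a n X) \<longlonglongrightarrow> 1"
    and d: "\<And>n X. X \<in> space (lebesgue_on R) \<Longrightarrow> 0 \<le> d n X \<and> d n X \<le> 2"
      "\<And>X. X \<in> space (lebesgue_on R) \<Longrightarrow> (\<lambda>n. d n X) \<longlonglongrightarrow> 0"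
      "\<And>n X. X \<in> space (lebesgue_on R) \<Longrightarrow> a n X = 0 \<Longrightarrow> d n X = 0"
    using cutoff_props[OF w_pos] by (simp_all add: a_def d_def)
  have form: "AE X in lebesgue_on R. 0 \<le> W X \<and> W X \<le> E X \<and> (\<forall>s t. 0 \<le> s\<^sup>2 * W X + 2 * s * t * Z X + t\<^sup>2 * P X)"
  proof (rule eventually_mono[OF AE_space], intro conjI allI)
    fix X s t assume "X \<in> space (lebesgue_on R)"
    then show "W X \<le> E X" using WE by simp
    show "0 \<le> W X" "0 \<le> s\<^sup>2 * W X + 2 * s * t * Z X + t\<^sup>2 * P X"
      unfolding W_def Z_def P_def by (rule bil_nonneg, rule bil_form_nonneg)
  qed
  have Q: "Q = (\<lambda>X. E X - W X)" by (simp add: Q_def E_def W_def N_def)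
  note lim = poincare_limit[where M="lebesgue_on R" and \<phi>=\<phi> and w=w and c=fu and E=E and W=W and Z=Z and P=P
      and a=a and d=d, OF _ _ m a d form int1 int2 int3 lin stab]
  show "integrable (lebesgue_on R) (\<lambda>X. (w X)\<^sup>2 * P X)" by (rule int1)
  show "integrable (lebesgue_on R) (\<lambda>X. (\<phi> X)\<^sup>2 * Q X)" unfolding Q by (rule lim(1)) measurable
  show "(LINT X|lebesgue_on R. (\<phi> X)\<^sup>2 * Q X) \<le> (LINT X|lebesgue_on R. (w X)\<^sup>2 * P X)"
    unfolding Q by (rule lim(2)) measurable
qed

text \<open>The isotropic part of the form gives the Sternberg-Zumbrun expression and the rank-one
  part gives (p - 2) / |grad u|^2 times \<open>\<T>\<close>; the common weight factors out.\<close>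

lemma geometric_poincare:
  assumes \<phi>: "test_fun \<Omega> \<phi>"
  defines "lhs \<equiv> \<lambda>X. \<alpha> (fst X) * norm (grad u X) powr (p (fst X) - 2) *
      (\<S> u X + (\<K> \<Omega> u X)\<^sup>2 * (norm (grad_y u X))\<^sup>2
        + (norm (tangential_grad u (\<lambda>Z. norm (grad_y u Z)) X))\<^sup>2
        + (p (fst X) - 2) / (norm (grad u X))\<^sup>2 * \<T> u X) * (\<phi> X)\<^sup>2"
    and "rhs \<equiv> \<lambda>X. (norm (grad_y u X))\<^sup>2 * matrix_form (\<B> \<alpha> p (fst X) (grad u X)) (grad \<phi> X) (grad \<phi> X)"
  shows "integrable (lebesgue_on R) lhs" "integrable (lebesgue_on \<Omega>) rhs"
    "(LINT X|lebesgue_on R. lhs X) \<le> (LINT X|lebesgue_on \<Omega>. rhs X)"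
proof -
  define Q where "Q X = (\<Sum>j\<in>UNIV. bil X (h j X) (h j X)) - bil X (normal_hess u X) (normal_hess u X)" for X
  define P where "P X = bil X (grad \<phi> X) (grad \<phi> X)" for X
  note main = poincare_inequality[OF \<phi>, folded Q_def P_def]
  have L: "lhs X = (\<phi> X)\<^sup>2 * Q X" if X: "X \<in> R" for X
  proof -
    define k where "k = (p (fst X) - 2) / (norm (grad u X))\<^sup>2"
    have b: "bil X v v = wt X * ((norm v)\<^sup>2 + k * (grad u X \<bullet> v)\<^sup>2)" for v
      by (simp add: bil_def k_def dot_square_norm power2_eq_square)
    have "Q X = wt X * (((\<Sum>j\<in>UNIV. (norm (h j X))\<^sup>2) - (norm (normal_hess u X))\<^sup>2) + k * \<T> u X)"
      unfolding Q_def b T_eq[OF X]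
      by (simp add: sum.distrib sum_distrib_left[symmetric] algebra_simps)
    then show ?thesis
      unfolding sternberg_zumbrun[OF X, symmetric] lhs_def wt_def[symmetric] k_def by (simp add: mult_ac)
  qed
  \<comment> \<open>The factor |grad_y u|^2 vanishes off \<open>\<R>\<close>, so the value of
    \<open>\<B>\<close> at critical points of u does not enter.\<close>
  have Rz: "rhs X = 0" if "X \<in> \<Omega>" "X \<notin> R" for X
    using that by (simp add: rhs_def grad_y_u R_iff)
  have RR: "rhs X = (w X)\<^sup>2 * P X" if X: "X \<in> R" for X
    using bil_eq_matrix_form[OF R_grad[OF X]] by (simp add: rhs_def P_def grad_y_u[OF subsetD[OF R_subset X]])
  show "integrable (lebesgue_on R) lhs"
    using main(1) by (rule Bochner_Integration.integrable_cong[THEN iffD1, rotated 2]) (auto simp: L)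
  have "integrable (lebesgue_on R) rhs"
    using main(2) by (rule Bochner_Integration.integrable_cong[THEN iffD1, rotated 2]) (auto simp: RR)
  then show "integrable (lebesgue_on \<Omega>) rhs" using integral_\<Omega>_R(2)[of rhs, OF Rz] by blast
  have "(LINT X|lebesgue_on R. lhs X) = (LINT X|lebesgue_on R. (\<phi> X)\<^sup>2 * Q X)"
    by (intro Bochner_Integration.integral_cong) (auto simp: L)
  also have "\<dots> \<le> (LINT X|lebesgue_on R. (w X)\<^sup>2 * P X)" by (rule main(3))
  also have "\<dots> = (LINT X|lebesgue_on R. rhs X)"
    by (intro Bochner_Integration.integral_cong) (auto simp: RR)
  also have "\<dots> = (LINT X|lebesgue_on \<Omega>. rhs X)" by (rule integral_\<Omega>_R(1)[of rhs, OF Rz, symmetric])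
  finally show "(LINT X|lebesgue_on R. lhs X) \<le> (LINT X|lebesgue_on \<Omega>. rhs X)" .
qed

end

theorem theorem1p1:
  fixes \<Omega> :: "((real ^ 'm) \<times> (real ^ 'k)) set"
    and f :: "real ^ 'm \<Rightarrow> real \<Rightarrow> real"
    and \<alpha> p :: "real ^ 'm \<Rightarrow> real"
    and u :: "(real ^ 'm) \<times> (real ^ 'k) \<Rightarrow> real"
  assumes "open \<Omega>"
    and "Linf_on UNIV (\<lambda>(x, s). f x s)"
    and "\<forall>x s. f x differentiable (at s)"
    and "Linf_on UNIV (\<lambda>(x, s). deriv (f x) s)"
    and "Linf_on UNIV \<alpha>"
    and "bdd_below (range \<alpha>)" and "(INF x. \<alpha> x) > 0"
    and "Linf_on UNIV p"
    and "\<forall>x. p x \<ge> 2"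
    and "Ck_on 1 \<Omega> u"
    and "Ck_on 2 (\<Omega> \<inter> {X. grad u X \<noteq> 0}) u"
    and "Linf_on \<Omega> u"
    and "Linf_on \<Omega> (grad u)"
    and "W12_loc_on \<Omega> (grad u)"
    and "weak_solution \<Omega> \<alpha> p f u"
    and "stable_solution \<Omega> \<alpha> p f u"
  shows "(\<forall>\<phi>. test_fun \<Omega> \<phi> \<longrightarrow>
           (let lhs = (\<lambda>X. \<alpha> (fst X) * norm (grad u X) powr (p (fst X) - 2) *
                  (\<S> u X + (\<K> \<Omega> u X)\<^sup>2 * (norm (grad_y u X))\<^sup>2
                    + (norm (tangential_grad u (\<lambda>Z. norm (grad_y u Z)) X))\<^sup>2
                    + (p (fst X) - 2) / (norm (grad u X))\<^sup>2 * \<T> u X) * (\<phi> X)\<^sup>2);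
                rhs = (\<lambda>X. (norm (grad_y u X))\<^sup>2 *
                  matrix_form (\<B> \<alpha> p (fst X) (grad u X)) (grad \<phi> X) (grad \<phi> X))
            in integrable (lebesgue_on (\<R> \<Omega> u)) lhs \<and>
               integrable (lebesgue_on \<Omega>) rhs \<and>
               (LINT X|lebesgue_on (\<R> \<Omega> u). lhs X) \<le> (LINT X|lebesgue_on \<Omega>. rhs X)))
       \<and> (\<forall>X\<in>\<R> \<Omega> u. \<S> u X \<ge> 0 \<and> \<T> u X \<ge> 0 \<and>
            (\<S> u X = 0 \<longleftrightarrow>
              (\<forall>i. \<exists>c. grad_y (\<lambda>Z. grad_x u Z $ i) X = c *\<^sub>R grad_y u X)))"
proof -
  have "(INF x. \<alpha> x) \<le> \<alpha> x" for x using assms(6) by (intro cINF_lower) auto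
  with assms(7) have "0 \<le> \<alpha> x" for x by (meson less_imp_le order_trans)
  then interpret stable_weak_solution \<Omega> u \<alpha> p f
    by unfold_locales (use assms in blast)+
  show ?thesis
    unfolding Let_def using geometric_poincare S_nonneg T_nonneg S_zero_iff by blast
qed

end
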